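(* (a) For each $\alpha\in(0,1]$ there is a set of full measure $\mathfrak N_\alpha\subset(1,\infty)$ such that whenever $\nu_0\in\mathfrak N_\alpha$ and $\nu=\nu_0=\nu_0(\tau)=(1+\tau^2)^{1/2}$, zero is a non-trivial eigenvalue of $\mathfrak L_0$ and $$\ker\mathfrak L_0=\operatorname{span}\{1,\exp(\pm ik_0\cdot Y),\exp(\pm ik_0^*\cdot Y)\},\qquad k_0=(1,1),\ k_0^*=(-1,1),$$ $$\|\mathfrak L_0^{-1}u\|_{s-(1+\alpha)/2}\le c\|u\|_s\quad\text{when } u\in(\ker\mathfrak L_0)^\perp\cap H^s.$$ (b) Suppose $\nu_0\in\mathfrak N_\alpha$ with $\alpha\in(0,1/78)$. Then there is a set $\mathcal E\subset[0,r_0)$ with $$\frac2{r^2}\int_{[0,r]\cap\mathcal E}\varepsilon\,d\varepsilon\to1\quad\text{as }r\to0,$$ such that for all $\varepsilon\in\mathcal E$, $j,s\ge1$, and $\nu=\nu_j(\varepsilon)$, $\varkappa=\varkappa_j(\varepsilon)$, $$\|(\mathfrak L-\varkappa)^{-1}u\|_{s-1}\le c\|u\|_s\quad\text{when }u\in(\ker\mathfrak L_0)^\perp\cap H^s,$$ where the positive constant $c$ depends on $\alpha$, $\nu_0$ and $R$ only.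
   Context: $\tau>0$. $H^s$ is the Sobolev space of functions $u(Y)$ on the torus ($2\pi$-periodic in $y_1,y_2$) with norm $\|u\|_s=(\sum_k(1+|k|)^{2s}|\hat u(k)|^2)^{1/2}$, $k\in\mathbb Z^2$. $\mathfrak L=\nu\partial_{y_1}^2+(-\Delta)^{1/2}$ is the Fourier multiplier with symbol $L(k)=-\nu k_1^2+(k_1^2+\tau^2k_2^2)^{1/2}$; $\mathfrak L_0$ is $\mathfrak L$ with $\nu=\nu_0(\tau)=(1+\tau^2)^{1/2}$ (so $\tau=(\nu_0^2-1)^{1/2}$ is determined by $\nu_0$). $(\mathfrak L-\varkappa)^{-1}$ is the multiplier $(L(k)-\varkappa)^{-1}$. Perturbed parameters: $\nu_j(\varepsilon)=\nu_0-\varepsilon^2\nu_1+\varepsilon^3\tilde\nu_j(\varepsilon)$, $\varkappa_j(\varepsilon)=\varepsilon^2\tilde\varkappa_j(\varepsilon)$, $j\ge1$, where, with $\mu_c=\nu_0^{-1}$, $\nu_1=\nu_1(\tau)=\frac1{4\mu_c^5}-\frac1{2\mu_c^4}+\frac1{2\mu_c^3}+\frac7{8\mu_c^2}-\frac1{4\mu_c}-\frac9{16(2-\mu_c)}$ (a positive number), and the real functions $\tilde\nu_j,\tilde\varkappa_j$ on $[0,r_0]$ satisfy, for a constant $R$ and all $j\ge1$, $\varepsilon,\varepsilon',\varepsilon''\in[0,r_0]$: $|\tilde\nu_j(\varepsilon)|+|\tilde\varkappa_j(\varepsilon)|\le R$; $|\tilde\nu_j(\varepsilon')-\tilde\nu_j(\varepsilon'')|+|\tilde\varkappa_j(\varepsilon')-\tilde\varkappa_j(\varepsilon'')|\le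 R|\varepsilon'-\varepsilon''|$; $|\tilde\nu_{j+1}-\tilde\nu_j|+|\tilde\varkappa_{j+1}-\tilde\varkappa_j|\le R\,2^{-j}$. *)

theory Defs
  imports "HOL-Analysis.Analysis"
begin

section \<open>Test functions and distributions on the torus\<close>

definition pd1 :: "(real \<times> real \<Rightarrow> complex) \<Rightarrow> real \<times> real \<Rightarrow> complex" where
  "pd1 f = (\<lambda>(y1, y2). vector_derivative (\<lambda>t. f (t, y2)) (at y1))"

definition pd2 :: "(real \<times> real \<Rightarrow> complex) \<Rightarrow> real \<times> real \<Rightarrow> complex" where
  "pd2 f = (\<lambda>(y1, y2). vector_derivative (\<lambda>t. f (y1, t)) (at y2))"

primrec C_class :: "nat \<Rightarrow> (real \<times> real \<Rightarrow> complex) \<Rightarrow> bool" where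
  "C_class 0 f \<longleftrightarrow> continuous_on UNIV f"
| "C_class (Suc n) f \<longleftrightarrow> continuous_on UNIV f
     \<and> (\<forall>y1 y2. (\<lambda>t. f (t, y2)) differentiable (at y1))
     \<and> (\<forall>y1 y2. (\<lambda>t. f (y1, t)) differentiable (at y2))
     \<and> C_class n (pd1 f) \<and> C_class n (pd2 f)"

definition torus_periodic :: "(real \<times> real \<Rightarrow> complex) \<Rightarrow> bool" where
  "torus_periodic f \<longleftrightarrow>
     (\<forall>y1 y2. f (y1 + 2 * pi, y2) = f (y1, y2) \<and> f (y1, y2 + 2 * pi) = f (y1, y2))"

definition torus_test :: "(real \<times> real \<Rightarrow> complex) set" where
  "torus_test = {f. (\<forall>n. C_class n f) \<and> torus_periodic f}"

definition CN_norm :: "nat \<Rightarrow> (real \<times> real \<Rightarrow> complex) \<Rightarrow> real" where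
  "CN_norm N f = (\<Sum>a\<le>N. \<Sum>b\<le>N - a. SUP Y. cmod ((pd1 ^^ a) ((pd2 ^^ b) f) Y))"

text \<open>
  Periodic distributions: the continuous linear functionals on the space of test functions. They are
  extended by 0 to arguments that are not test functions, so that distributions which
  agree on all test functions are equal.
\<close>

definition torus_distr :: "((real \<times> real \<Rightarrow> complex) \<Rightarrow> complex) set" where
  "torus_distr = {u.
     (\<forall>f. f \<notin> torus_test \<longrightarrow> u f = 0)
     \<and> (\<forall>f\<in>torus_test. \<forall>g\<in>torus_test. \<forall>a b. u (\<lambda>Y. a * f Y + b * g Y) = a * u f + b * u g)
     \<and> (\<exists>C N. \<forall>f\<in>torus_test. cmod (u f) \<le> C * CN_norm N f)}"

text \<open>The distribution given by a function on the torus.\<close>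

definition distr_of :: "(real \<times> real \<Rightarrow> complex) \<Rightarrow> (real \<times> real \<Rightarrow> complex) \<Rightarrow> complex" where
  "distr_of f g =
     (if g \<in> torus_test then integral (cbox (0, 0) (2 * pi, 2 * pi)) (\<lambda>Y. f Y * g Y) else 0)"

definition torus_char :: "int \<times> int \<Rightarrow> real \<times> real \<Rightarrow> complex" where
  "torus_char k Y = exp (\<i> * complex_of_real (of_int (fst k) * fst Y + of_int (snd k) * snd Y))"

definition fourier_coeff ::
    "((real \<times> real \<Rightarrow> complex) \<Rightarrow> complex) \<Rightarrow> int \<times> int \<Rightarrow> complex" where
  "fourier_coeff u k = u (torus_char (- fst k, - snd k)) / complex_of_real ((2 * pi)\<^sup>2)"

definition distr_span ::
    "((real \<times> real \<Rightarrow> complex) \<Rightarrow> complex) set \<Rightarrow> ((real \<times> real \<Rightarrow> complex) \<Rightarrow> complex) set" where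
  "distr_span S = {(\<lambda>g. \<Sum>v\<in>F. a v * v g) | F a. finite F \<and> F \<subseteq> S}"

text \<open>
  Orthogonality with respect to the inner product of \<open>L\<^sup>2\<close>, extended to the case that one argument is
  a distribution and the other a smooth function. It is used for a space \<open>V\<close> that
  consists of smooth functions.
\<close>

definition torus_orth ::
    "((real \<times> real \<Rightarrow> complex) \<Rightarrow> complex) set \<Rightarrow> ((real \<times> real \<Rightarrow> complex) \<Rightarrow> complex) set" where
  "torus_orth V =
     {u\<in>torus_distr. \<forall>f\<in>torus_test. distr_of f \<in> V \<longrightarrow> u (\<lambda>Y. cnj (f Y)) = 0}"

section \<open>Sobolev spaces of any real order\<close>

definition freq_norm :: "int \<times> int \<Rightarrow> real" where
  "freq_norm k = sqrt ((of_int (fst k))\<^sup>2 + (of_int (snd k))\<^sup>2)"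

definition sobolev ::
    "real \<Rightarrow> ((real \<times> real \<Rightarrow> complex) \<Rightarrow> complex) set" where
  "sobolev s = {u\<in>torus_distr.
     (\<lambda>k. (1 + freq_norm k) powr (2 * s) * (cmod (fourier_coeff u k))\<^sup>2) summable_on UNIV}"

definition sobolev_norm ::
    "real \<Rightarrow> ((real \<times> real \<Rightarrow> complex) \<Rightarrow> complex) \<Rightarrow> real" where
  "sobolev_norm s u =
     sqrt (\<Sum>\<^sub>\<infinity>k. (1 + freq_norm k) powr (2 * s) * (cmod (fourier_coeff u k))\<^sup>2)"

section \<open>The operator and its inverses\<close>

text \<open>\<open>multiplier_graph m u v\<close>: the Fourier multiplier with symbol \<open>m\<close> maps \<open>u\<close> to \<open>v\<close>.\<close>

definition multiplier_graph ::
    "(int \<times> int \<Rightarrow> real) \<Rightarrow> ((real \<times> real \<Rightarrow> complex) \<Rightarrow> complex) \<Rightarrow>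
      ((real \<times> real \<Rightarrow> complex) \<Rightarrow> complex) \<Rightarrow> bool" where
  "multiplier_graph m u v \<longleftrightarrow> u \<in> torus_distr \<and> v \<in> torus_distr \<and>
     (\<forall>k. fourier_coeff v k = complex_of_real (m k) * fourier_coeff u k)"

definition L_symbol :: "real \<Rightarrow> real \<Rightarrow> int \<times> int \<Rightarrow> real" where
  "L_symbol \<nu> \<tau> k =
     - \<nu> * (of_int (fst k))\<^sup>2 + sqrt ((of_int (fst k))\<^sup>2 + \<tau>\<^sup>2 * (of_int (snd k))\<^sup>2)"

text \<open>
  \<open>resolvent_graph \<nu> \<tau> \<kappa> u w\<close>: the multiplier with symbol \<open>1 / (L k - \<kappa>)\<close> maps \<open>u\<close> to \<open>w\<close>. The first
  conjunct says that \<open>u\<close> is in the domain: frequencies at which \<open>L k - \<kappa>\<close> vanishes (where the division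
  below has the value 0 by convention) do not occur in \<open>u\<close>.
\<close>

definition resolvent_graph ::
    "real \<Rightarrow> real \<Rightarrow> real \<Rightarrow> ((real \<times> real \<Rightarrow> complex) \<Rightarrow> complex) \<Rightarrow>
      ((real \<times> real \<Rightarrow> complex) \<Rightarrow> complex) \<Rightarrow> bool" where
  "resolvent_graph \<nu> \<tau> \<kappa> u w \<longleftrightarrow>
     (\<forall>k. fourier_coeff u k \<noteq> 0 \<longrightarrow> L_symbol \<nu> \<tau> k - \<kappa> \<noteq> 0) \<and>
     multiplier_graph (\<lambda>k. 1 / (L_symbol \<nu> \<tau> k - \<kappa>)) u w"

definition nu0 :: "real \<Rightarrow> real" where
  "nu0 \<tau> = sqrt (1 + \<tau>\<^sup>2)"

definition ker_L0 :: "real \<Rightarrow> ((real \<times> real \<Rightarrow> complex) \<Rightarrow> complex) set" where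
  "ker_L0 \<tau> = {u. multiplier_graph (L_symbol (nu0 \<tau>) \<tau>) u (\<lambda>_. 0)}"

section \<open>Perturbed parameters\<close>

definition nu1 :: "real \<Rightarrow> real" where
  "nu1 \<tau> = (let \<mu> = 1 / nu0 \<tau> in
     1 / (4 * \<mu>^5) - 1 / (2 * \<mu>^4) + 1 / (2 * \<mu>^3) + 7 / (8 * \<mu>^2) - 1 / (4 * \<mu>)
       - 9 / (16 * (2 - \<mu>)))"

definition perturbation_bounds ::
    "real \<Rightarrow> real \<Rightarrow> (nat \<Rightarrow> real \<Rightarrow> real) \<Rightarrow> (nat \<Rightarrow> real \<Rightarrow> real) \<Rightarrow> bool" where
  "perturbation_bounds R r0 nut kapt \<longleftrightarrow>
     (\<forall>j\<ge>1. \<forall>\<epsilon>\<in>{0..r0}. \<bar>nut j \<epsilon>\<bar> + \<bar>kapt j \<epsilon>\<bar> \<le> R) \<and>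
     (\<forall>j\<ge>1. \<forall>\<epsilon>'\<in>{0..r0}. \<forall>\<epsilon>''\<in>{0..r0}.
        \<bar>nut j \<epsilon>' - nut j \<epsilon>''\<bar> + \<bar>kapt j \<epsilon>' - kapt j \<epsilon>''\<bar> \<le> R * \<bar>\<epsilon>' - \<epsilon>''\<bar>) \<and>
     (\<forall>j\<ge>1. \<forall>\<epsilon>\<in>{0..r0}.
        \<bar>nut (j + 1) \<epsilon> - nut j \<epsilon>\<bar> + \<bar>kapt (j + 1) \<epsilon> - kapt j \<epsilon>\<bar> \<le> R * (1 / 2) ^ j)"

definition nu_pert :: "real \<Rightarrow> (nat \<Rightarrow> real \<Rightarrow> real) \<Rightarrow> nat \<Rightarrow> real \<Rightarrow> real" where
  "nu_pert \<tau> nut j \<epsilon> = nu0 \<tau> - \<epsilon>^2 * nu1 \<tau> + \<epsilon>^3 * nut j \<epsilon>"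

definition kappa_pert :: "(nat \<Rightarrow> real \<Rightarrow> real) \<Rightarrow> nat \<Rightarrow> real \<Rightarrow> real" where
  "kappa_pert kapt j \<epsilon> = \<epsilon>^2 * kapt j \<epsilon>"

end

theory Submission
  imports Defs
begin

text \<open>
  Write \<open>k = (\<plusminus>n, \<plusminus>m)\<close> with \<open>n \<ge> 1\<close>. For fixed \<open>n\<close> the divisor \<open>L(k) - \<kappa>\<close> vanishes at exactly one real
  \<open>m\<close>, namely \<open>y = ((\<nu>n\<^sup>2 + \<kappa>)\<^sup>2 - n\<^sup>2)\<^sup>1\<^sup>/\<^sup>2 / \<tau>\<close>, which is of order \<open>n\<^sup>2\<close>, and \<open>|L(k) - \<kappa>|\<close> dominates \<open>|y - m|\<close>. So
  everything depends on the distance \<open>d\<^sub>n\<close> of \<open>y\<close> to the integers.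

  For \<open>\<kappa> = 0\<close>, \<open>y\<close> is a strictly monotone function of \<open>\<nu>\<^sub>0\<close> with slope of order \<open>n\<^sup>2\<close>, so \<open>d\<^sub>n \<le> \<delta>\<close> happens on a set of measure
  \<open>O(\<delta>)\<close>, uniformly in \<open>n\<close>. Hence \<open>\<Sum> n\<^sup>-\<^sup>1\<^sup>-\<^sup>\<eta> d\<^sub>n\<^sup>-\<^sup>1\<^sup>+\<^sup>\<eta>\<close> is finite for almost every \<open>\<nu>\<^sub>0\<close>. With \<open>\<eta> = \<alpha>/4\<close> this
  gives both \<open>d\<^sub>n \<ge> c n\<^sup>-\<^sup>1\<^sup>-\<^sup>\<alpha>\<close>, which is (a), and \<open>\<Sum> n\<^sup>-\<^sup>7\<^sup>/\<^sup>4 / d\<^sub>n < \<infinity>\<close>.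

  For (b), remove from \<open>[0, r]\<close> the \<open>\<epsilon>\<close> with \<open>|y - m| < \<gamma>/n\<^sup>2\<close> for some \<open>n, m, j\<close>. As \<open>\<nu>\<^sub>1 > 0\<close>, \<open>y\<close> moves with speed
  of order \<open>n\<^sup>2\<close> in the variable \<open>\<epsilon>\<^sup>2\<close>, so each triple costs \<open>O(n\<^sup>-\<^sup>4)\<close> in the measure \<open>\<epsilon> d\<epsilon>\<close>. Triples exist only
  if \<open>d\<^sub>n = O(r\<^sup>2n\<^sup>2)\<close>, the number of \<open>m\<close> is then \<open>O(r\<^sup>2n\<^sup>2/d\<^sub>n)\<close>, and \<open>O(log n)\<close> values of \<open>j\<close> suffice because the
  parameters converge geometrically. The total is at most \<open>r\<^sup>2\<close> times a sum of terms \<open>O(n\<^sup>-\<^sup>7\<^sup>/\<^sup>4/d\<^sub>n)\<close> over those \<open>n\<close> with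
  \<open>d\<^sub>n = O(r\<^sup>2n\<^sup>2)\<close>. These \<open>n\<close> tend to infinity as \<open>r \<rightarrow> 0\<close>, so the total is \<open>o(r\<^sup>2)\<close>.
\<close>

section \<open>Test functions\<close>

lemma has_pd1:
  assumes "f \<in> torus_test"
  shows "((\<lambda>t. f (t, y2)) has_vector_derivative pd1 f (y1, y2)) (at y1)"
proof -
  have "C_class (Suc 0) f" using assms by (simp add: torus_test_def)
  then show ?thesis by (simp add: pd1_def vector_derivative_works[symmetric])
qed

lemma has_pd2:
  assumes "f \<in> torus_test"
  shows "((\<lambda>t. f (y1, t)) has_vector_derivative pd2 f (y1, y2)) (at y2)"
proof -
  have "C_class (Suc 0) f" using assms by (simp add: torus_test_def)
  then show ?thesis by (simp add: pd2_def vector_derivative_works[symmetric])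
qed

lemma torus_test_continuous:
  assumes "f \<in> torus_test"
  shows "continuous_on A f"
proof -
  have "C_class 0 f" using assms unfolding torus_test_def by blast
  then have "continuous_on UNIV f" by simp
  then show ?thesis using continuous_on_subset by blast
qed

lemma torus_test_C_class: "f \<in> torus_test \<Longrightarrow> C_class n f"
  by (simp add: torus_test_def)

lemma torus_test_periodic:
  "f \<in> torus_test \<Longrightarrow> f (y1 + 2 * pi, y2) = f (y1, y2)"
  "f \<in> torus_test \<Longrightarrow> f (y1, y2 + 2 * pi) = f (y1, y2)"
  by (simp_all add: torus_test_def torus_periodic_def)

text \<open>Makes a partial derivative periodic in the variable of differentiation; in the other
  variable periodicity passes through the definition directly.\<close>

lemma vector_derivative_shift_periodic:
  fixes g :: "real \<Rightarrow> complex"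
  assumes "\<And>t. g (t + p) = g t" "(g has_vector_derivative D) (at (y + p))"
  shows "(g has_vector_derivative D) (at y)"
proof -
  have "((\<lambda>t. t + p) has_vector_derivative 1) (at y)"
    by (auto intro!: derivative_eq_intros)
  from vector_diff_chain_at[OF this, of g D] assms(2)
  have "(g \<circ> (\<lambda>t. t + p) has_vector_derivative D) (at y)" by simp
  moreover have "g \<circ> (\<lambda>t. t + p) = g" using assms(1) by auto
  ultimately show ?thesis by simp
qed

lemma torus_test_pd1:
  assumes "f \<in> torus_test"
  shows "pd1 f \<in> torus_test"
proof -
  have "C_class n (pd1 f)" for n
    using torus_test_C_class[OF assms, of "Suc n"] by simp
  moreover have "pd1 f (y1 + 2 * pi, y2) = pd1 f (y1, y2)" for y1 y2
    using vector_derivative_unique_at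
      [OF vector_derivative_shift_periodic[OF _ has_pd1[OF assms]] has_pd1[OF assms]]
      torus_test_periodic[OF assms] by blast
  moreover have "pd1 f (y1, y2 + 2 * pi) = pd1 f (y1, y2)" for y1 y2
    by (simp add: pd1_def torus_test_periodic[OF assms])
  ultimately show ?thesis by (simp add: torus_test_def torus_periodic_def)
qed

lemma torus_test_pd2:
  assumes "f \<in> torus_test"
  shows "pd2 f \<in> torus_test"
proof -
  have "C_class n (pd2 f)" for n
    using torus_test_C_class[OF assms, of "Suc n"] by simp
  moreover have "pd2 f (y1, y2 + 2 * pi) = pd2 f (y1, y2)" for y1 y2
    using vector_derivative_unique_at
      [OF vector_derivative_shift_periodic[OF _ has_pd2[OF assms]] has_pd2[OF assms]]
      torus_test_periodic[OF assms] by blast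
  moreover have "pd2 f (y1 + 2 * pi, y2) = pd2 f (y1, y2)" for y1 y2
    by (simp add: pd2_def torus_test_periodic[OF assms])
  ultimately show ?thesis by (simp add: torus_test_def torus_periodic_def)
qed

lemma torus_test_derivs:
  assumes "f \<in> torus_test"
  shows "(pd1 ^^ a) ((pd2 ^^ b) f) \<in> torus_test"
proof -
  have "(pd2 ^^ b) f \<in> torus_test" by (induction b) (auto simp: assms torus_test_pd2)
  then show ?thesis by (induction a) (auto simp: torus_test_pd1)
qed

lemma pd1_linear:
  assumes "\<And>y1 y2. (\<lambda>t. f (t, y2)) differentiable (at y1)"
    and "\<And>y1 y2. (\<lambda>t. g (t, y2)) differentiable (at y1)"
  shows "pd1 (\<lambda>Y. a * f Y + b * g Y) = (\<lambda>Y. a * pd1 f Y + b * pd1 g Y)"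
proof (intro ext)
  fix Y :: "real \<times> real"
  obtain y1 y2 where Y: "Y = (y1, y2)" by force
  have "((\<lambda>t. a * f (t, y2) + b * g (t, y2)) has_vector_derivative
      a * vector_derivative (\<lambda>t. f (t, y2)) (at y1) + b * vector_derivative (\<lambda>t. g (t, y2)) (at y1)) (at y1)"
    by (intro has_vector_derivative_add has_vector_derivative_mult_right)
      (use assms in \<open>simp_all add: vector_derivative_works[symmetric]\<close>)
  then show "pd1 (\<lambda>Y. a * f Y + b * g Y) Y = a * pd1 f Y + b * pd1 g Y"
    by (simp add: pd1_def Y vector_derivative_at)
qed

lemma pd2_linear:
  assumes "\<And>y1 y2. (\<lambda>t. f (y1, t)) differentiable (at y2)"
    and "\<And>y1 y2. (\<lambda>t. g (y1, t)) differentiable (at y2)"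
  shows "pd2 (\<lambda>Y. a * f Y + b * g Y) = (\<lambda>Y. a * pd2 f Y + b * pd2 g Y)"
proof (intro ext)
  fix Y :: "real \<times> real"
  obtain y1 y2 where Y: "Y = (y1, y2)" by force
  have "((\<lambda>t. a * f (y1, t) + b * g (y1, t)) has_vector_derivative
      a * vector_derivative (\<lambda>t. f (y1, t)) (at y2) + b * vector_derivative (\<lambda>t. g (y1, t)) (at y2)) (at y2)"
    by (intro has_vector_derivative_add has_vector_derivative_mult_right)
      (use assms in \<open>simp_all add: vector_derivative_works[symmetric]\<close>)
  then show "pd2 (\<lambda>Y. a * f Y + b * g Y) Y = a * pd2 f Y + b * pd2 g Y"
    by (simp add: pd2_def Y vector_derivative_at)
qed

lemma C_class_linear:
  "C_class n f \<Longrightarrow> C_class n g \<Longrightarrow> C_class n (\<lambda>Y. a * f Y + b * g Y)"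
proof (induction n arbitrary: f g)
  case 0
  then show ?case by (auto intro!: continuous_intros)
next
  case (Suc n)
  have "pd1 (\<lambda>Y. a * f Y + b * g Y) = (\<lambda>Y. a * pd1 f Y + b * pd1 g Y)"
    "pd2 (\<lambda>Y. a * f Y + b * g Y) = (\<lambda>Y. a * pd2 f Y + b * pd2 g Y)"
    using Suc.prems by (intro pd1_linear pd2_linear; auto)+
  then show ?case using Suc by (auto intro!: continuous_intros derivative_intros)
qed

lemma torus_test_linear:
  assumes "f \<in> torus_test" "g \<in> torus_test"
  shows "(\<lambda>Y. a * f Y + b * g Y) \<in> torus_test"
  using assms by (auto simp: torus_test_def torus_periodic_def C_class_linear)

lemma derivs_linear:
  assumes "f \<in> torus_test" "g \<in> torus_test"
  shows "(pd1 ^^ m) ((pd2 ^^ n) (\<lambda>Y. a * f Y + b * g Y)) =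
    (\<lambda>Y. a * (pd1 ^^ m) ((pd2 ^^ n) f) Y + b * (pd1 ^^ m) ((pd2 ^^ n) g) Y)"
proof -
  have diff: "(\<lambda>t. h (t, y2)) differentiable (at y1)" "(\<lambda>t. h (y1, t)) differentiable (at y2)"
    if "h \<in> torus_test" for h y1 y2
    using torus_test_C_class[OF that, of "Suc 0"] by auto
  have 2: "(pd2 ^^ n) (\<lambda>Y. a * f Y + b * g Y) = (\<lambda>Y. a * (pd2 ^^ n) f Y + b * (pd2 ^^ n) g Y)"
  proof (induction n)
    case (Suc n)
    show ?case
      using torus_test_derivs[OF assms(1), of 0 n] torus_test_derivs[OF assms(2), of 0 n]
      by (simp add: Suc pd2_linear diff)
  qed simp
  show ?thesis
  proof (induction m)
    case (Suc m)
    show ?case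
      using torus_test_derivs[OF assms(1), of m n] torus_test_derivs[OF assms(2), of m n]
      by (simp add: Suc pd1_linear diff)
  qed (simp add: 2)
qed

section \<open>Characters and trigonometric polynomials\<close>

lemma continuous_torus_char: "continuous_on A (torus_char k)"
  unfolding torus_char_def[abs_def] by (intro continuous_intros)

lemma norm_torus_char [simp]: "cmod (torus_char k Y) = 1"
  by (simp add: torus_char_def)

lemma torus_char_mult: "torus_char k Y * torus_char l Y = torus_char (fst k + fst l, snd k + snd l) Y"
  by (simp add: torus_char_def exp_add[symmetric] algebra_simps)

lemma torus_char_zero [simp]: "torus_char (0, 0) Y = 1"
  by (simp add: torus_char_def)

lemma torus_char_has_derivative1:
  "((\<lambda>t. torus_char k (t, y2)) has_vector_derivative \<i> * of_int (fst k) * torus_char k (y1, y2)) (at y1)"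
proof -
  have "((\<lambda>z. exp (\<i> * (of_int (fst k) * z + of_int (snd k) * complex_of_real y2))) has_field_derivative
      \<i> * of_int (fst k) * torus_char k (y1, y2)) (at (complex_of_real y1))"
    by (auto intro!: derivative_eq_intros simp: torus_char_def)
  from has_vector_derivative_real_field[OF this] show ?thesis
    by (simp add: torus_char_def[abs_def])
qed

lemma torus_char_has_derivative2:
  "((\<lambda>t. torus_char k (y1, t)) has_vector_derivative \<i> * of_int (snd k) * torus_char k (y1, y2)) (at y2)"
proof -
  have "((\<lambda>z. exp (\<i> * (of_int (fst k) * complex_of_real y1 + of_int (snd k) * z))) has_field_derivative
      \<i> * of_int (snd k) * torus_char k (y1, y2)) (at (complex_of_real y2))"
    by (auto intro!: derivative_eq_intros simp: torus_char_def)
  from has_vector_derivative_real_field[OF this] show ?thesis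
    by (simp add: torus_char_def[abs_def])
qed

lemma pd1_char: "pd1 (\<lambda>Y. a * torus_char k Y) = (\<lambda>Y. (\<i> * of_int (fst k) * a) * torus_char k Y)"
  by (auto simp: pd1_def fun_eq_iff intro!: vector_derivative_at
      has_vector_derivative_eq_rhs[OF has_vector_derivative_mult_right[OF torus_char_has_derivative1]])

lemma pd2_char: "pd2 (\<lambda>Y. a * torus_char k Y) = (\<lambda>Y. (\<i> * of_int (snd k) * a) * torus_char k Y)"
  by (auto simp: pd2_def fun_eq_iff intro!: vector_derivative_at
      has_vector_derivative_eq_rhs[OF has_vector_derivative_mult_right[OF torus_char_has_derivative2]])

lemma derivs_char:
  "(pd1 ^^ m) ((pd2 ^^ n) (\<lambda>Y. a * torus_char k Y)) =
    (\<lambda>Y. ((\<i> * of_int (fst k)) ^ m * (\<i> * of_int (snd k)) ^ n * a) * torus_char k Y)"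
proof -
  have "(pd2 ^^ n) (\<lambda>Y. a * torus_char k Y) = (\<lambda>Y. ((\<i> * of_int (snd k)) ^ n * a) * torus_char k Y)"
    by (induction n) (simp_all add: pd2_char del: mult.assoc, simp add: mult.assoc)
  then show ?thesis
    by (induction m) (simp_all add: pd1_char del: mult.assoc, simp add: mult.assoc)
qed

lemma C_class_char: "C_class n (\<lambda>Y. a * torus_char k Y)"
proof (induction n arbitrary: a)
  case 0
  then show ?case by (auto intro!: continuous_intros continuous_torus_char)
next
  case (Suc n)
  have "(\<lambda>t. a * torus_char k (t, y2)) differentiable (at y1)"
    "(\<lambda>t. a * torus_char k (y1, t)) differentiable (at y2)" for y1 y2
    using torus_char_has_derivative1 torus_char_has_derivative2
    by (intro derivative_intros differentiableI_vector; blast)+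
  then show ?case
    by (auto intro!: continuous_intros continuous_torus_char simp: pd1_char pd2_char Suc)
qed

lemma exp_2pi_int: "exp (\<i> * complex_of_real (of_int m * (2 * pi))) = 1"
  using exp_2pi_1_int[of m] by (simp add: algebra_simps)

lemma torus_char_periodic:
  "torus_char k (y1 + 2 * pi, y2) = torus_char k (y1, y2)"
  "torus_char k (y1, y2 + 2 * pi) = torus_char k (y1, y2)"
proof -
  have "torus_char k (y1 + 2 * pi, y2) =
      torus_char k (y1, y2) * exp (\<i> * complex_of_real (of_int (fst k) * (2 * pi)))"
    unfolding torus_char_def exp_add[symmetric] by (simp add: algebra_simps)
  then show "torus_char k (y1 + 2 * pi, y2) = torus_char k (y1, y2)"
    by (simp only: exp_2pi_int mult_1_right)
  have "torus_char k (y1, y2 + 2 * pi) =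
      torus_char k (y1, y2) * exp (\<i> * complex_of_real (of_int (snd k) * (2 * pi)))"
    unfolding torus_char_def exp_add[symmetric] by (simp add: algebra_simps)
  then show "torus_char k (y1, y2 + 2 * pi) = torus_char k (y1, y2)"
    by (simp only: exp_2pi_int mult_1_right)
qed

lemma torus_test_char: "(\<lambda>Y. a * torus_char k Y) \<in> torus_test"
  by (simp add: torus_test_def C_class_char torus_periodic_def torus_char_periodic)

lemma torus_test_char': "torus_char k \<in> torus_test"
  using torus_test_char[of 1 k] by simp

lemma trig_poly_test:
  assumes "finite F"
  shows "(\<lambda>Y. \<Sum>k\<in>F. c k * torus_char k Y) \<in> torus_test"
  using assms
proof induction
  case empty
  then show ?case using torus_test_char[of 0] by simp
next
  case (insert k F)
  then show ?case
    using torus_test_linear[OF torus_test_char[of "c k" k] insert.IH, of 1 1] by simp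
qed

text \<open>Together with \<open>torus_coeff_derivs\<close> this shows that differentiation commutes
  with taking partial Fourier sums.\<close>

lemma derivs_trig_poly:
  assumes "finite F"
  shows "(pd1 ^^ m) ((pd2 ^^ n) (\<lambda>Y. \<Sum>k\<in>F. c k * torus_char k Y)) =
    (\<lambda>Y. \<Sum>k\<in>F. ((\<i> * of_int (fst k)) ^ m * (\<i> * of_int (snd k)) ^ n * c k) * torus_char k Y)"
  using assms
proof induction
  case empty
  then show ?case using derivs_char[of m n 0 "(0, 0)"] by simp
next
  case (insert k F)
  then show ?case
    using derivs_linear[OF torus_test_char[of "c k" k] trig_poly_test[OF insert.hyps(1), of c], of m n 1 1]
    by (simp add: derivs_char)
qed

section \<open>Reduction to a fundamental cell and the seminorms\<close>

lemma periodic_nat_mult: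
  fixes g :: "real \<Rightarrow> 'a"
  assumes "\<And>t. g (t + p) = g t"
  shows "g (t + of_int m * p) = g t"
proof -
  have N: "g (t + of_nat n * p) = g t" for n t
  proof (induction n)
    case (Suc n)
    have "g (t + of_nat (Suc n) * p) = g (t + of_nat n * p + p)" by (simp add: algebra_simps)
    then show ?case using assms Suc by simp
  qed simp
  show ?thesis
  proof (cases "m \<ge> 0")
    case True
    then show ?thesis using N[of t "nat m"] by simp
  next
    case False
    then have "g (t + of_int m * p) = g (t + of_int m * p + of_nat (nat (- m)) * p)"
      using N[of "t + of_int m * p" "nat (- m)"] by simp
    then show ?thesis using False by (simp add: algebra_simps)
  qed
qed

lemma reduce_mod_2pi:
  obtains m :: int where "t + of_int m * (2 * pi) \<in> {0..2 * pi}"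
proof
  let ?m = "- \<lfloor>t / (2 * pi)\<rfloor>"
  have "of_int \<lfloor>t / (2 * pi)\<rfloor> * (2 * pi) \<le> t"
    by (metis floor_divide_lower pi_gt_zero zero_less_mult_iff zero_less_numeral)
  moreover have "t < (of_int \<lfloor>t / (2 * pi)\<rfloor> + 1) * (2 * pi)"
    by (metis floor_divide_upper pi_gt_zero zero_less_mult_iff zero_less_numeral)
  ultimately show "t + of_int ?m * (2 * pi) \<in> {0..2 * pi}" by (simp add: algebra_simps)
qed

lemma periodic_reduce:
  assumes "torus_periodic f"
  obtains Z where "Z \<in> cbox (0, 0) (2 * pi, 2 * pi)" "f Z = f Y"
proof -
  obtain y1 y2 where Y: "Y = (y1, y2)" by force
  obtain m where m: "y1 + of_int m * (2 * pi) \<in> {0..2 * pi}" using reduce_mod_2pi by blast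
  obtain n where n: "y2 + of_int n * (2 * pi) \<in> {0..2 * pi}" using reduce_mod_2pi by blast
  have "f (y1 + of_int m * (2 * pi), y2 + of_int n * (2 * pi)) = f (y1, y2 + of_int n * (2 * pi))"
    using assms periodic_nat_mult[of "\<lambda>t. f (t, y2 + of_int n * (2 * pi))" "2 * pi"]
    unfolding torus_periodic_def by blast
  also have "\<dots> = f (y1, y2)"
    using assms periodic_nat_mult[of "\<lambda>t. f (y1, t)" "2 * pi"]
    unfolding torus_periodic_def by blast
  finally show ?thesis
    using m n by (intro that[of "(y1 + of_int m * (2 * pi), y2 + of_int n * (2 * pi))"]) (simp_all add: Y)
qed

text \<open>Without boundedness the suprema in \<open>CN_norm\<close> would be unspecified values.
  Periodicity reduces boundedness to compactness of the closed cell.\<close>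

lemma bounded_periodic:
  assumes "torus_periodic f" "continuous_on UNIV f"
  shows "bdd_above (range (\<lambda>Y. cmod (f Y)))"
proof -
  have "compact (f ` cbox (0, 0) (2 * pi, 2 * pi))"
    using compact_continuous_image[OF continuous_on_subset[OF assms(2) subset_UNIV] compact_cbox] .
  from compact_imp_bounded[OF this]
  obtain B where B: "\<And>Y. Y \<in> cbox (0, 0) (2 * pi, 2 * pi) \<Longrightarrow> cmod (f Y) \<le> B"
    unfolding bounded_iff by (metis imageI)
  have "cmod (f Y) \<le> B" for Y
  proof -
    obtain Z where "Z \<in> cbox (0, 0) (2 * pi, 2 * pi)" "f Z = f Y" using periodic_reduce[OF assms(1)] .
    then show ?thesis using B by metis
  qed
  then show ?thesis by (auto intro!: bdd_aboveI)
qed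

lemma torus_test_le_Sup:
  assumes "f \<in> torus_test"
  shows "cmod (f Y) \<le> (SUP Y. cmod (f Y))"
  using assms bounded_periodic[of f] torus_test_continuous[of f UNIV]
  by (auto simp: torus_test_def intro!: cSUP_upper)

lemma torus_test_Sup_nonneg:
  assumes "f \<in> torus_test"
  shows "0 \<le> (SUP Y. cmod (f Y))"
  by (rule order_trans[OF norm_ge_zero torus_test_le_Sup[OF assms]])

lemma CN_norm_bound:
  assumes "f \<in> torus_test" "a + b \<le> N"
  shows "cmod ((pd1 ^^ a) ((pd2 ^^ b) f) Y) \<le> CN_norm N f"
proof -
  let ?S = "\<lambda>a b. SUP Y. cmod ((pd1 ^^ a) ((pd2 ^^ b) f) Y)"
  have nn: "0 \<le> ?S a b" for a b
    by (intro torus_test_Sup_nonneg torus_test_derivs assms(1))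
  have "cmod ((pd1 ^^ a) ((pd2 ^^ b) f) Y) \<le> ?S a b"
    by (rule torus_test_le_Sup[OF torus_test_derivs[OF assms(1)]])
  also have "\<dots> \<le> (\<Sum>b\<le>N - a. ?S a b)"
    using assms(2) nn by (intro member_le_sum) auto
  also have "\<dots> \<le> CN_norm N f"
    unfolding CN_norm_def using assms(2) nn
    by (intro member_le_sum[of a _ "\<lambda>a. \<Sum>b\<le>N - a. ?S a b"]) (auto intro!: sum_nonneg)
  finally show ?thesis .
qed

lemma CN_norm_nonneg:
  assumes "f \<in> torus_test"
  shows "0 \<le> CN_norm N f"
proof -
  have "0 \<le> cmod ((pd1 ^^ 0) ((pd2 ^^ 0) f) undefined)" by (rule norm_ge_zero)
  also have "\<dots> \<le> CN_norm N f" by (rule CN_norm_bound[OF assms]) simp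
  finally show ?thesis .
qed

section \<open>Fourier series on the torus\<close>

abbreviation torus_box :: "(real \<times> real) set" where
  "torus_box \<equiv> cbox (0, 0) (2 * pi, 2 * pi)"

text \<open>The character is not conjugated: this is the pairing of f with
  \<open>torus_char k\<close>, that is, (2 pi)^2 times the Fourier coefficient of f at -k.\<close>

definition fourier_int :: "(real \<times> real \<Rightarrow> complex) \<Rightarrow> int \<times> int \<Rightarrow> complex" where
  "fourier_int f k = integral torus_box (\<lambda>Y. f Y * torus_char k Y)"

lemma content_torus_box: "measure lborel torus_box = (2 * pi)\<^sup>2"
  by (simp add: content_Pair power2_eq_square)

lemma norm_torus_integral_le:
  assumes "continuous_on torus_box f" "\<And>Y. Y \<in> torus_box \<Longrightarrow> cmod (f Y) \<le> B"
  shows "cmod (integral torus_box f) \<le> B * (2 * pi)\<^sup>2"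
proof -
  have "(0, 0) \<in> torus_box" by simp
  then have "0 \<le> B" using assms(2) norm_ge_zero order_trans by blast
  then show ?thesis
    using has_integral_bound[OF _ integrable_integral[OF integrable_continuous[OF assms(1)]], of B] assms(2)
    by (simp add: content_torus_box)
qed

lemma torus_integral_iterated:
  fixes f :: "real \<times> real \<Rightarrow> complex"
  assumes "continuous_on UNIV f"
  shows "integral torus_box f = integral {0..2 * pi} (\<lambda>y1. integral {0..2 * pi} (\<lambda>y2. f (y1, y2)))"
    and "integral torus_box f = integral {0..2 * pi} (\<lambda>y2. integral {0..2 * pi} (\<lambda>y1. f (y1, y2)))"
proof -
  have c: "continuous_on torus_box f" using assms continuous_on_subset by blast
  show *: "integral torus_box f = integral {0..2 * pi} (\<lambda>y1. integral {0..2 * pi} (\<lambda>y2. f (y1, y2)))"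
    using integral_prod_continuous[OF c] by simp
  have "continuous_on torus_box (\<lambda>(x, y). f (x, y))" using c by simp
  from integral_swap_continuous[OF this]
  show "integral torus_box f = integral {0..2 * pi} (\<lambda>y2. integral {0..2 * pi} (\<lambda>y1. f (y1, y2)))"
    unfolding * by simp
qed

lemma integral_periodic_derivative:
  fixes g g' :: "real \<Rightarrow> complex"
  assumes "\<And>t. (g has_vector_derivative g' t) (at t)" "g (2 * pi) = g 0"
  shows "integral {0..2 * pi} g' = 0"
  using fundamental_theorem_of_calculus[of 0 "2 * pi" g g'] assms
  by (simp add: has_vector_derivative_at_within integral_unique)

text \<open>Integration by parts: the product of f with a character takes equal values at both ends
  of a period, so its y1-derivative integrates to zero. The iterated integral with y1 innermost is
  the one to use.\<close>

lemma fourier_int_pd1: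
  assumes f: "f \<in> torus_test"
  shows "fourier_int (pd1 f) k = - (\<i> * of_int (fst k)) * fourier_int f k"
proof -
  note cont = torus_test_continuous[OF f] torus_test_continuous[OF torus_test_pd1[OF f]] continuous_torus_char
  let ?g = "\<lambda>Y. pd1 f Y * torus_char k Y + f Y * (\<i> * of_int (fst k) * torus_char k Y)"
  have "((\<lambda>t. f (t, y2) * torus_char k (t, y2)) has_vector_derivative ?g (t, y2)) (at t)" for t y2
    by (rule has_vector_derivative_eq_rhs
          [OF has_vector_derivative_mult[OF has_pd1[OF f] torus_char_has_derivative1]]) simp
  then have "integral {0..2 * pi} (\<lambda>t. ?g (t, y2)) = 0" for y2
    by (rule integral_periodic_derivative)
      (use torus_test_periodic(1)[OF f, of 0] torus_char_periodic(1)[of k 0] in simp)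
  moreover have "continuous_on UNIV ?g" by (intro continuous_intros cont)
  ultimately have "integral torus_box ?g = 0" by (simp add: torus_integral_iterated(2))
  moreover have "integral torus_box ?g = integral torus_box (\<lambda>Y. pd1 f Y * torus_char k Y) +
      integral torus_box (\<lambda>Y. (\<i> * of_int (fst k)) * (f Y * torus_char k Y))"
    by (subst integral_add[symmetric])
      (auto intro!: integrable_continuous continuous_intros cont simp: mult_ac)
  ultimately show ?thesis
    by (simp add: fourier_int_def add_eq_0_iff2)
qed

lemma fourier_int_pd2:
  assumes f: "f \<in> torus_test"
  shows "fourier_int (pd2 f) k = - (\<i> * of_int (snd k)) * fourier_int f k"
proof -
  note cont = torus_test_continuous[OF f] torus_test_continuous[OF torus_test_pd2[OF f]] continuous_torus_char
  let ?g = "\<lambda>Y. pd2 f Y * torus_char k Y + f Y * (\<i> * of_int (snd k) * torus_char k Y)"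
  have "((\<lambda>t. f (y1, t) * torus_char k (y1, t)) has_vector_derivative ?g (y1, t)) (at t)" for t y1
    by (rule has_vector_derivative_eq_rhs
          [OF has_vector_derivative_mult[OF has_pd2[OF f] torus_char_has_derivative2]]) simp
  then have "integral {0..2 * pi} (\<lambda>t. ?g (y1, t)) = 0" for y1
    by (rule integral_periodic_derivative)
      (use torus_test_periodic(2)[OF f, of _ 0] torus_char_periodic(2)[of k _ 0] in simp)
  moreover have "continuous_on UNIV ?g" by (intro continuous_intros cont)
  ultimately have "integral torus_box ?g = 0" by (simp add: torus_integral_iterated(1))
  moreover have "integral torus_box ?g = integral torus_box (\<lambda>Y. pd2 f Y * torus_char k Y) +
      integral torus_box (\<lambda>Y. (\<i> * of_int (snd k)) * (f Y * torus_char k Y))"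
    by (subst integral_add[symmetric])
      (auto intro!: integrable_continuous continuous_intros cont simp: mult_ac)
  ultimately show ?thesis
    by (simp add: fourier_int_def add_eq_0_iff2)
qed

lemma fourier_int_derivs:
  assumes f: "f \<in> torus_test"
  shows "fourier_int ((pd1 ^^ m) ((pd2 ^^ n) f)) k =
    (- (\<i> * of_int (fst k))) ^ m * (- (\<i> * of_int (snd k))) ^ n * fourier_int f k"
proof -
  have "fourier_int ((pd2 ^^ n) f) k = (- (\<i> * of_int (snd k))) ^ n * fourier_int f k"
  proof (induction n)
    case (Suc n)
    show ?case using fourier_int_pd2[OF torus_test_derivs[OF f, of 0 n], of k] Suc
      by (simp add: mult.assoc)
  qed simp
  then show ?thesis
  proof (induction m)
    case (Suc m)
    then show ?case using fourier_int_pd1[OF torus_test_derivs[OF f, of m n], of k]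
      by (simp add: mult.assoc)
  qed simp
qed

text \<open>A product weight, so that its reciprocal square is summable over the lattice as a product of
  two one-dimensional series.\<close>

definition lattice_weight :: "int \<times> int \<Rightarrow> real" where
  "lattice_weight k = (1 + \<bar>of_int (fst k)\<bar>) * (1 + \<bar>of_int (snd k)\<bar>)"

lemma lattice_weight_ge_1: "1 \<le> lattice_weight k"
  unfolding lattice_weight_def by (intro mult_ge1_I[of "1 + \<bar>of_int (fst k)\<bar> :: real"]) auto

lemma fourier_int_abs_le:
  assumes f: "f \<in> torus_test" and "m + n \<le> N"
  shows "\<bar>of_int (fst k)\<bar> ^ m * \<bar>of_int (snd k)\<bar> ^ n * cmod (fourier_int f k) \<le> (2 * pi)\<^sup>2 * CN_norm N f"
proof -
  have "\<bar>of_int (fst k)\<bar> ^ m * \<bar>of_int (snd k)\<bar> ^ n * cmod (fourier_int f k)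
      = cmod (fourier_int ((pd1 ^^ m) ((pd2 ^^ n) f)) k)"
    by (simp add: fourier_int_derivs[OF f] norm_mult norm_power)
  also have "\<dots> \<le> CN_norm N f * (2 * pi)\<^sup>2"
    unfolding fourier_int_def
    by (intro norm_torus_integral_le continuous_on_mult continuous_torus_char
          torus_test_continuous[OF torus_test_derivs[OF f]])
      (use CN_norm_bound[OF f assms(2)] in \<open>simp add: norm_mult\<close>)
  finally show ?thesis by (simp add: mult.commute)
qed

lemma power_one_plus_le: "(1 + x) ^ q \<le> 2 ^ q * (1 + x ^ q)" if "0 \<le> (x::real)"
proof (cases "x \<le> 1")
  case True
  then have "(1 + x) ^ q \<le> 2 ^ q" using that by (intro power_mono) auto
  then show ?thesis using that by (simp add: distrib_left add_increasing2)
next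
  case False
  then have "(1 + x) ^ q \<le> (2 * x) ^ q" by (intro power_mono) auto
  then show ?thesis using that by (simp add: distrib_left add_increasing power_mult_distrib)
qed

text \<open>The q-th power of the weight is dominated by the four monomials 1, |k1|^q, |k2|^q and
  |k1 k2|^q. Each of them is absorbed by a derivative of order at most 2 q.\<close>

lemma fourier_int_decay:
  assumes f: "f \<in> torus_test"
  shows "lattice_weight k ^ q * cmod (fourier_int f k) \<le> 4 ^ (q + 1) * (2 * pi)\<^sup>2 * CN_norm (2 * q) f"
proof -
  let ?a = "\<bar>of_int (fst k)\<bar> :: real" and ?b = "\<bar>of_int (snd k)\<bar> :: real" and ?F = "cmod (fourier_int f k)"
  let ?C = "(2 * pi)\<^sup>2 * CN_norm (2 * q) f"
  have "lattice_weight k ^ q \<le> (2 ^ q * (1 + ?a ^ q)) * (2 ^ q * (1 + ?b ^ q))"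
    unfolding lattice_weight_def power_mult_distrib
    by (intro mult_mono power_one_plus_le) auto
  also have "\<dots> = (2 ^ q * 2 ^ q) * (1 + ?a ^ q + ?b ^ q + ?a ^ q * ?b ^ q)"
    by (simp only: algebra_simps)
  also have "2 ^ q * 2 ^ q = (4 ^ q :: real)" by (simp flip: power_mult_distrib)
  finally have "lattice_weight k ^ q * ?F \<le> 4 ^ q * (1 + ?a ^ q + ?b ^ q + ?a ^ q * ?b ^ q) * ?F"
    by (intro mult_right_mono) auto
  also have "\<dots> = 4 ^ q * (?F + ?a ^ q * ?F + ?b ^ q * ?F + ?a ^ q * ?b ^ q * ?F)"
    by (simp add: algebra_simps)
  also have "\<dots> \<le> 4 ^ q * (?C + ?C + ?C + ?C)"
    using fourier_int_abs_le[OF f, of 0 0 "2 * q" k] fourier_int_abs_le[OF f, of q 0 "2 * q" k]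
      fourier_int_abs_le[OF f, of 0 q "2 * q" k] fourier_int_abs_le[OF f, of q q "2 * q" k]
    by (intro mult_left_mono add_mono) auto
  finally show ?thesis by simp
qed

section \<open>Lattice sums and orthogonality of the characters\<close>

lemma summable_on_int_inverse_squares: "(\<lambda>n::int. 1 / (1 + \<bar>of_int n\<bar>)\<^sup>2 :: real) summable_on UNIV"
proof -
  have "summable (\<lambda>n. 1 / (1 + real n)\<^sup>2)"
    using inverse_power_summable[of 2, where 'a = real] summable_Suc_iff[of "\<lambda>n. inverse (real n ^ 2)"]
    by (simp add: inverse_eq_divide add.commute)
  then have N: "(\<lambda>n::nat. 1 / (1 + real n)\<^sup>2) summable_on UNIV"
    by (intro norm_summable_imp_summable_on) simp
  have "(\<lambda>n::int. 1 / (1 + \<bar>of_int n\<bar>)\<^sup>2 :: real) summable_on range int"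
    by (subst summable_on_reindex) (use N in \<open>auto simp: o_def\<close>)
  moreover have "(\<lambda>n::int. 1 / (1 + \<bar>of_int n\<bar>)\<^sup>2 :: real) summable_on range (\<lambda>n. - int n)"
    by (subst summable_on_reindex) (use N in \<open>auto simp: o_def inj_on_def\<close>)
  moreover have "range int \<union> range (\<lambda>n. - int n) = UNIV"
    using int_cases2 by (auto simp: image_iff) metis
  ultimately show ?thesis using summable_on_union by metis
qed

lemma summable_on_lattice_weight: "(\<lambda>k. 1 / (lattice_weight k)\<^sup>2) summable_on UNIV"
proof -
  let ?h = "\<lambda>n::int. 1 / (1 + \<bar>of_int n\<bar>)\<^sup>2 :: real"
  have "(\<lambda>p. ?h (fst p) * ?h (snd p)) summable_on (UNIV \<times> UNIV)"
  proof (rule summable_on_SigmaI)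
    show "((\<lambda>y. ?h (fst (x, y)) * ?h (snd (x, y))) has_sum (?h x * infsum ?h UNIV)) UNIV" for x
      by (simp del: times_divide_eq_left times_divide_eq_right)
        (intro has_sum_cmult_right has_sum_infsum summable_on_int_inverse_squares)
    show "(\<lambda>x. ?h x * infsum ?h UNIV) summable_on UNIV"
      by (intro summable_on_cmult_left summable_on_int_inverse_squares)
  qed auto
  then show ?thesis by (simp add: lattice_weight_def power_mult_distrib)
qed

lemma int_char_integral:
  "integral {0..2 * pi} (\<lambda>t. exp (\<i> * complex_of_real (of_int m * t))) = (if m = 0 then 2 * pi else 0)"
proof (cases "m = 0")
  case False
  let ?g = "\<lambda>t. exp (\<i> * complex_of_real (of_int m * t)) / (\<i> * of_int m)"
  have "(?g has_vector_derivative exp (\<i> * complex_of_real (of_int m * t))) (at t)" for t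
  proof -
    have "((\<lambda>z. exp (\<i> * (of_int m * z)) / (\<i> * of_int m)) has_field_derivative
        exp (\<i> * (of_int m * complex_of_real t))) (at (complex_of_real t))"
      using False by (auto intro!: derivative_eq_intros simp: mult_ac)
    from has_vector_derivative_real_field[OF this] show ?thesis by simp
  qed
  then show ?thesis
    using integral_periodic_derivative[of ?g] False exp_2pi_int[of m] by simp
qed (simp add: scaleR_conv_of_real)

lemma integral_torus_char:
  "integral torus_box (torus_char k) = (if k = (0, 0) then (2 * pi)\<^sup>2 else 0)"
proof -
  have c: "torus_char k (y1, y2) = exp (\<i> * complex_of_real (of_int (fst k) * y1)) *
      exp (\<i> * complex_of_real (of_int (snd k) * y2))" for y1 y2
    by (simp add: torus_char_def exp_add[symmetric] algebra_simps)
  have "integral torus_box (torus_char k) = integral {0..2 * pi} (\<lambda>t. exp (\<i> * complex_of_real (of_int (fst k) * t))) *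
      integral {0..2 * pi} (\<lambda>t. exp (\<i> * complex_of_real (of_int (snd k) * t)))"
    by (subst torus_integral_iterated(1)[OF continuous_torus_char])
      (simp only: c integral_mult_right integral_mult_left)
  then show ?thesis
    unfolding int_char_integral by (cases k) (auto simp: power2_eq_square)
qed

lemma fourier_int_char:
  "fourier_int (torus_char l) k = (if k = (- fst l, - snd l) then (2 * pi)\<^sup>2 else 0)"
proof -
  have "fourier_int (torus_char l) k = integral torus_box (torus_char (fst l + fst k, snd l + snd k))"
    by (simp add: fourier_int_def torus_char_mult)
  then show ?thesis
    unfolding integral_torus_char by (cases k) (auto simp: add_eq_0_iff)
qed

section \<open>Uniqueness of Fourier coefficients\<close>

text \<open>Multiplying by a trigonometric polynomial only mixes shifted Fourier integrals. The
  induction must therefore carry all k at once.\<close>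

lemma fourier_int_trig_poly_power_eq_0:
  assumes h: "continuous_on UNIV h" and zero: "\<And>k. fourier_int h k = 0" and F: "finite F"
  shows "fourier_int (\<lambda>Y. h Y * (\<Sum>l\<in>F. c l * torus_char l Y) ^ N) k = 0"
proof (induction N arbitrary: k)
  case 0
  then show ?case using zero by simp
next
  case (Suc N)
  let ?p = "\<lambda>Y. \<Sum>l\<in>F. c l * torus_char l Y"
  let ?g = "\<lambda>l Y. h Y * ?p Y ^ N * torus_char (fst l + fst k, snd l + snd k) Y"
  have "continuous_on torus_box h" using h continuous_on_subset by blast
  then have int: "?g l integrable_on torus_box" for l
    by (intro integrable_continuous continuous_intros continuous_torus_char)
  have "fourier_int (\<lambda>Y. h Y * ?p Y ^ Suc N) k = integral torus_box (\<lambda>Y. \<Sum>l\<in>F. c l * ?g l Y)"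
    unfolding fourier_int_def
    by (rule integral_cong) (simp add: sum_distrib_left sum_distrib_right torus_char_mult[symmetric] mult_ac)
  also have "\<dots> = (\<Sum>l\<in>F. c l * integral torus_box (?g l))"
    using int by (subst integral_sum) (auto simp: F intro!: integrable_on_mult_right)
  also have "\<dots> = 0"
    using Suc by (simp add: fourier_int_def)
  finally show ?case .
qed

text \<open>Exhibits the function whose powers will concentrate at (a1, a2) as a trigonometric
  polynomial with five frequencies.\<close>

lemma cos_eq_trig_poly:
  "complex_of_real (c + d * (cos (y1 - a1) + cos (y2 - a2))) =
    (\<Sum>l\<in>{(0, 0), (1, 0), (- 1, 0), (0, 1), (0, - 1)}.
      (if l = (0, 0) then of_real c
       else of_real (d / 2) * cnj (torus_char l (a1, a2))) * torus_char l (y1, y2))"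
proof -
  have e: "complex_of_real (cos t) = (exp (\<i> * of_real t) + exp (- (\<i> * of_real t))) / 2" for t
    by (simp add: cos_of_real[symmetric] cos_exp_eq)
  have E: "exp (\<i> * of_real (x - y)) = exp (\<i> * of_real x) * exp (- (\<i> * complex_of_real y))"
    "exp (- (\<i> * of_real (x - y))) = exp (- (\<i> * of_real x)) * exp (\<i> * complex_of_real y)" for x y
    by (simp_all add: exp_add[symmetric] algebra_simps)
  show ?thesis
    by (simp add: torus_char_def exp_cnj e E of_real_add of_real_mult del: of_real_diff)
      (simp add: algebra_simps add_divide_distrib)
qed

text \<open>Powers of a trigonometric polynomial that exceeds 1 only near a point \<open>a\<close> concentrate at \<open>a\<close>,
  so they detect a non-zero value there.\<close>

lemma fourier_int_zero_interior:
  assumes h: "continuous_on UNIV h" and zero: "\<And>k. fourier_int h k = 0"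
    and a: "0 < a1" "a1 < 2 * pi" "0 < a2" "a2 < 2 * pi"
  shows "h (a1, a2) = 0"
proof (rule ccontr)
  assume nz: "h (a1, a2) \<noteq> 0"
  define a where "a = (a1, a2)"
  \<comment> \<open>Multiplying by the conjugate of h(a) before taking the real part gives a real
    function with the positive value |h(a)|^2 at a.\<close>
  define H where "H Y = Re (h Y * cnj (h a))" for Y
  define \<eta> where "\<eta> = H a / 2"
  have \<eta>: "\<eta> > 0" using nz by (simp add: \<eta>_def H_def a_def complex_mult_cnj flip: cmod_power2)
  have Hc: "continuous_on UNIV H" unfolding H_def by (intro continuous_intros h)
  obtain \<delta> where \<delta>: "\<delta> > 0" "\<And>Y. dist Y a < \<delta> \<Longrightarrow> dist (H Y) (H a) < \<eta>"
    using Hc \<eta> unfolding continuous_on_iff by blast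
  have near: "H Y \<ge> \<eta>" if "dist Y a < \<delta>" for Y
    using \<delta>(2)[OF that] by (simp add: \<eta>_def dist_real_def abs_if split: if_splits)
  \<comment> \<open>On the closed cell q attains its maximum 2 only at a: as a is an interior point,
    no coordinate difference reaches 2 pi.\<close>
  define q where "q Y = cos (fst Y - a1) + cos (snd Y - a2)" for Y
  have qc: "continuous_on A q" for A unfolding q_def by (intro continuous_intros)
  have q2: "q Y < 2" if "Y \<in> torus_box" "Y \<noteq> a" for Y
  proof -
    have "cos x < 1" if "\<bar>x\<bar> < 2 * pi" "x \<noteq> 0" for x
    proof -
      have "cos x \<noteq> 1"
      proof
        assume "cos x = 1"
        then obtain n :: int where n: "x = of_int n * 2 * pi" by (auto simp: cos_one_2pi_int)
        then have "\<bar>of_int n\<bar> * (2 * pi) < 1 * (2 * pi)" using that(1) by (simp add: abs_mult)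
        then have "\<bar>of_int n\<bar> < (1::real)" by (rule mult_right_less_imp_less) simp
        then show False using n that(2) by simp
      qed
      then show ?thesis using cos_le_one[of x] by linarith
    qed
    moreover have "\<bar>fst Y - a1\<bar> < 2 * pi" "\<bar>snd Y - a2\<bar> < 2 * pi"
      using that a by (auto simp: mem_box cbox_Pair_eq abs_if)
    moreover have "fst Y - a1 \<noteq> 0 \<or> snd Y - a2 \<noteq> 0"
      using that by (cases Y) (auto simp: a_def)
    ultimately show ?thesis unfolding q_def
      by (metis add_less_le_mono add_le_less_mono cos_le_one one_add_one)
  qed
  obtain \<gamma> where \<gamma>: "\<gamma> > 0" "\<And>Y. Y \<in> torus_box \<Longrightarrow> dist Y a \<ge> \<delta> \<Longrightarrow> q Y \<le> 2 - \<gamma>"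
  proof -
    let ?K = "torus_box \<inter> {Y. dist Y a \<ge> \<delta>}"
    have "closed {Y. dist Y a \<ge> \<delta>}" by (intro closed_Collect_le continuous_intros)
    then have K: "compact ?K" by (intro compact_Int_closed compact_cbox)
    show ?thesis
    proof (cases "?K = {}")
      case True
      then show ?thesis using that[of 1] by auto
    next
      case False
      then obtain Z where Z: "Z \<in> ?K" "\<And>Y. Y \<in> ?K \<Longrightarrow> q Y \<le> q Z"
        using continuous_attains_sup[OF K False qc] by blast
      have "Z \<noteq> a" using Z(1) \<delta>(1) by auto
      then have "q Z < 2" using q2[of Z] Z(1) by blast
      then show ?thesis using that[of "2 - q Z"] Z by auto
    qed
  qed
  \<comment> \<open>The affine rescaling is chosen so that 0 < p everywhere, p \<le> 1 where q \<le>
    2 - \<gamma>, and p = 1 + \<gamma>/4 at a.\<close>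
  define p where "p Y = (1 / 2 + \<gamma> / 4) + 1 / 4 * q Y" for Y
  have pc: "continuous_on A p" for A unfolding p_def by (intro continuous_intros qc)
  have p0: "p Y > 0" for Y
  proof -
    have "- 1 + - 1 \<le> q Y" unfolding q_def by (intro add_mono cos_ge_minus_one)
    then show ?thesis using \<gamma>(1) by (simp add: p_def)
  qed
  obtain \<rho> where \<rho>: "\<rho> > 0" "\<And>Y. dist Y a < \<rho> \<Longrightarrow> dist (q Y) (q a) < \<gamma> / 2"
    using qc[of UNIV] \<gamma>(1) unfolding continuous_on_iff by (metis UNIV_I half_gt_zero)
  have pnear: "p Y \<ge> 1 + \<gamma> / 8" if "dist Y a < \<rho>" for Y
  proof -
    have "q a = 2" by (simp add: q_def a_def)
    then have "q Y > 2 - \<gamma> / 2" using \<rho>(2)[OF that] unfolding dist_real_def by linarith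
    then show ?thesis by (simp add: p_def)
  qed
  obtain \<sigma> where \<sigma>: "\<sigma> > 0" "cbox (a1 - \<sigma>, a2 - \<sigma>) (a1 + \<sigma>, a2 + \<sigma>) \<subseteq> torus_box \<inter> ball a \<rho>"
  proof -
    define \<sigma> where "\<sigma> = Min {a1, a2, 2 * pi - a1, 2 * pi - a2, \<rho> / 3}"
    have "\<sigma> > 0" using a \<rho>(1) by (auto simp: \<sigma>_def)
    moreover have "\<sigma> \<le> a1" "\<sigma> \<le> a2" "\<sigma> \<le> 2 * pi - a1" "\<sigma> \<le> 2 * pi - a2" "\<sigma> \<le> \<rho> / 3"
      unfolding \<sigma>_def by (rule Min_le; simp)+
    ultimately have s: "\<sigma> > 0" "\<sigma> \<le> a1" "\<sigma> \<le> a2" "\<sigma> \<le> 2 * pi - a1" "\<sigma> \<le> 2 * pi - a2" "\<sigma> \<le> \<rho> / 3"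
      by simp_all
    have "Y \<in> torus_box \<inter> ball a \<rho>" if "Y \<in> cbox (a1 - \<sigma>, a2 - \<sigma>) (a1 + \<sigma>, a2 + \<sigma>)" for Y
    proof -
      obtain y1 y2 where Y: "Y = (y1, y2)" by force
      have y: "\<bar>a1 - y1\<bar> \<le> \<sigma>" "\<bar>a2 - y2\<bar> \<le> \<sigma>" using that by (auto simp: Y cbox_Pair_eq abs_le_iff)
      have "dist a Y \<le> \<bar>a1 - y1\<bar> + \<bar>a2 - y2\<bar>"
        unfolding a_def Y dist_Pair_Pair dist_real_def by (rule order_trans[OF sqrt_sum_squares_le_sum_abs]) simp
      also have "\<dots> < \<rho>" using y s(6) \<rho>(1) by linarith
      finally show ?thesis using y s by (auto simp: Y cbox_Pair_eq abs_le_iff)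
    qed
    then show ?thesis using s(1) that by blast
  qed
  have "compact (H ` torus_box)"
    by (rule compact_continuous_image[OF continuous_on_subset[OF Hc subset_UNIV] compact_cbox])
  from compact_imp_bounded[OF this]
  obtain M where M: "\<And>Y. Y \<in> torus_box \<Longrightarrow> \<bar>H Y\<bar> \<le> M" unfolding bounded_iff by (metis imageI real_norm_def)
  have "a \<in> torus_box" using a by (simp add: a_def cbox_Pair_eq)
  then have M0: "M \<ge> 0" using M[of a] by linarith
  have zero_int: "integral torus_box (\<lambda>Y. H Y * p Y ^ N) = 0" for N
  proof -
    define l where "l = {(0, 0), (1, 0), (- 1, 0), (0, 1), (0, - 1) :: int \<times> int}"
    define b where "b k = (if k = (0, 0) then complex_of_real (1 / 2 + \<gamma> / 4)
       else of_real (1 / 4 / 2) * cnj (torus_char k (a1, a2)))" for k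
    have pb: "complex_of_real (p Y) = (\<Sum>k\<in>l. b k * torus_char k Y)" for Y
      unfolding p_def q_def l_def b_def using cos_eq_trig_poly[of "1 / 2 + \<gamma> / 4" "1 / 4" "fst Y" a1 "snd Y" a2]
      by simp
    have "fourier_int (\<lambda>Y. h Y * of_real (p Y) ^ N) (0, 0) = 0"
      unfolding pb by (rule fourier_int_trig_poly_power_eq_0[OF h zero]) (simp add: l_def)
    then have 0: "integral torus_box (\<lambda>Y. h Y * of_real (p Y) ^ N) = 0" by (simp add: fourier_int_def)
    have "(\<lambda>Y. h Y * of_real (p Y) ^ N) integrable_on torus_box"
      by (intro integrable_continuous continuous_intros pc continuous_on_subset[OF h subset_UNIV])
    then have "((\<lambda>Y. h Y * of_real (p Y) ^ N) has_integral 0) torus_box"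
      unfolding 0[symmetric] by (rule integrable_integral)
    then have "((\<lambda>Y. Re (h Y * of_real (p Y) ^ N * cnj (h a))) has_integral Re (0 * cnj (h a))) torus_box"
      by (intro has_integral_Re has_integral_mult_left)
    moreover have "Re (h Y * of_real (p Y) ^ N * cnj (h a)) = H Y * p Y ^ N" for Y
      unfolding H_def of_real_power[symmetric] by (simp add: algebra_simps)
    ultimately show ?thesis by (simp add: integral_unique)
  qed
  \<comment> \<open>The right-hand side is independent of N, while the left-hand side grows
    geometrically: this is the contradiction. It compares the mass of p^N on a small box around a
    with a bound that follows from the vanishing of the integral of H p^N.\<close>
  have "(1 + \<gamma> / 8) ^ N \<le> (M + \<eta>) * (2 * pi)\<^sup>2 / (\<eta> * (2 * \<sigma>)\<^sup>2)" for N
  proof -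
    let ?B = "cbox (a1 - \<sigma>, a2 - \<sigma>) (a1 + \<sigma>, a2 + \<sigma>)"
    have pint: "(\<lambda>Y. p Y ^ N) integrable_on cbox u v" for u v
      by (intro integrable_continuous continuous_intros pc)
    \<comment> \<open>Near a, H is at least \<eta>. Elsewhere p \<le> 1, so that replacing H by
      \<eta> costs at most M + \<eta>.\<close>
    have pt: "\<eta> * p Y ^ N - (M + \<eta>) \<le> H Y * p Y ^ N" if Y: "Y \<in> torus_box" for Y
    proof (cases "dist Y a < \<delta>")
      case True
      then have "\<eta> * p Y ^ N \<le> H Y * p Y ^ N"
        using near p0[of Y] by (intro mult_right_mono) auto
      then show ?thesis using \<eta> M0 by linarith
    next
      case False
      then have "p Y \<le> 1" using \<gamma>(2)[OF Y] by (simp add: p_def)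
      then have p1: "p Y ^ N \<le> 1" "p Y ^ N \<ge> 0" using p0[of Y] by (auto intro: power_le_one)
      have "- M \<le> - \<bar>H Y * p Y ^ N\<bar>"
        using mult_mono[OF M[OF Y] p1(1) M0 p1(2)] p1(2) by (simp add: abs_mult)
      moreover have "\<eta> * p Y ^ N \<le> \<eta>" using p1 \<eta> by (simp add: mult_left_le)
      ultimately show ?thesis by linarith
    qed
    have "integral torus_box (\<lambda>Y. \<eta> * p Y ^ N - (M + \<eta>)) \<le> integral torus_box (\<lambda>Y. H Y * p Y ^ N)"
      by (intro integral_le pt integrable_continuous continuous_intros pc continuous_on_subset[OF Hc subset_UNIV]) auto
    then have 1: "\<eta> * integral torus_box (\<lambda>Y. p Y ^ N) \<le> (M + \<eta>) * (2 * pi)\<^sup>2"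
      using zero_int content_torus_box pint
      by (subst (asm) integral_diff) (auto intro!: integrable_on_mult_right simp: mult.commute)
    have "(1 + \<gamma> / 8) ^ N * (2 * \<sigma>)\<^sup>2 = integral ?B (\<lambda>Y. (1 + \<gamma> / 8) ^ N)"
      using \<sigma>(1) by (simp add: content_Pair power2_eq_square)
    also have "\<dots> \<le> integral ?B (\<lambda>Y. p Y ^ N)"
      using \<sigma>(2) \<gamma>(1) pnear by (intro integral_le pint power_mono) (auto simp: dist_commute)
    also have "\<dots> \<le> integral torus_box (\<lambda>Y. p Y ^ N)"
      using \<sigma>(2) p0 by (intro integral_subset_le pint) (auto simp: less_imp_le)
    finally have "\<eta> * ((1 + \<gamma> / 8) ^ N * (2 * \<sigma>)\<^sup>2) \<le> (M + \<eta>) * (2 * pi)\<^sup>2"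
      using 1 \<eta> by (meson mult_left_mono less_imp_le order_trans)
    then show ?thesis using \<eta> \<sigma>(1) by (simp add: field_simps)
  qed
  moreover have "1 < 1 + \<gamma> / 8" using \<gamma>(1) by simp
  ultimately show False by (meson real_arch_pow not_le)
qed

text \<open>The interior of the cell is covered by \<open>fourier_int_zero_interior\<close>;
  continuity adds its boundary and periodicity the rest of the plane.\<close>

lemma fourier_int_zero_imp_zero:
  assumes h: "continuous_on UNIV h" and per: "torus_periodic h" and zero: "\<And>k. fourier_int h k = 0"
  shows "h Y = 0"
proof -
  have "closed {Y. h Y = 0}" by (intro closed_Collect_eq h continuous_on_const)
  moreover have "box (0, 0) (2 * pi, 2 * pi) \<subseteq> {Y. h Y = 0}"
  proof
    fix Y :: "real \<times> real"
    assume "Y \<in> box (0, 0) (2 * pi, 2 * pi)"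
    then show "Y \<in> {Y. h Y = 0}"
      using fourier_int_zero_interior[OF h zero, of "fst Y" "snd Y"] by (cases Y) (auto simp: mem_box Basis_prod_def)
  qed
  ultimately have "closure (box (0, 0) (2 * pi, 2 * pi)) \<subseteq> {Y. h Y = 0}"
    by (rule closure_minimal[rotated])
  moreover have "box (0, 0) (2 * pi, 2 * pi :: real) \<noteq> {}"
    by (simp add: box_ne_empty Basis_prod_def)
  then have "closure (box (0, 0) (2 * pi, 2 * pi)) = torus_box" by (rule closure_box)
  ultimately have "h Z = 0" if "Z \<in> torus_box" for Z using that by blast
  then show ?thesis using periodic_reduce[OF per, of Y] by metis
qed

section \<open>Fourier inversion\<close>

lemma lattice_weight_neg [simp]: "lattice_weight (- a, - b) = lattice_weight (a, b)"
  by (simp add: lattice_weight_def)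

lemma fourier_int_char_sum:
  assumes "finite F"
  shows "fourier_int (\<lambda>Y. \<Sum>k\<in>F. c k * torus_char k Y) l =
    (if (- fst l, - snd l) \<in> F then c (- fst l, - snd l) * (2 * pi)\<^sup>2 else 0)"
proof -
  have "fourier_int (\<lambda>Y. \<Sum>k\<in>F. c k * torus_char k Y) l = (\<Sum>k\<in>F. c k * fourier_int (torus_char k) l)"
    unfolding fourier_int_def sum_distrib_right mult.assoc
    using assms by (subst integral_sum)
      (auto intro!: integrable_continuous continuous_intros continuous_torus_char)
  also have "\<dots> = (\<Sum>k\<in>F. if k = (- fst l, - snd l) then c k * (2 * pi)\<^sup>2 else 0)"
    by (intro sum.cong) (auto simp: fourier_int_char)
  finally show ?thesis using assms by simp
qed

definition torus_coeff :: "(real \<times> real \<Rightarrow> complex) \<Rightarrow> int \<times> int \<Rightarrow> complex" where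
  "torus_coeff f k = fourier_int f (- fst k, - snd k) / complex_of_real ((2 * pi)\<^sup>2)"

lemma torus_coeff_derivs:
  "f \<in> torus_test \<Longrightarrow> torus_coeff ((pd1 ^^ m) ((pd2 ^^ n) f)) k =
    (\<i> * of_int (fst k)) ^ m * (\<i> * of_int (snd k)) ^ n * torus_coeff f k"
  by (simp add: torus_coeff_def fourier_int_derivs)

lemma norm_torus_coeff_le:
  assumes "f \<in> torus_test"
  shows "cmod (torus_coeff f k) \<le> (4 ^ 3 * CN_norm 4 f) * (1 / (lattice_weight k)\<^sup>2)"
proof -
  have "lattice_weight k ^ 2 * cmod (fourier_int f (- fst k, - snd k)) \<le> 4 ^ 3 * (2 * pi)\<^sup>2 * CN_norm 4 f"
    using fourier_int_decay[OF assms, of "(- fst k, - snd k)" 2] by simp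
  moreover have "lattice_weight k ^ 2 > 0" using lattice_weight_ge_1[of k] by auto
  moreover have "0 < (2 * pi)\<^sup>2" by simp
  ultimately show ?thesis
    unfolding torus_coeff_def norm_divide norm_of_real
    by (simp add: divide_le_eq pos_le_divide_eq mult_ac del: power_mult_distrib)
qed

text \<open>The decay of the coefficients gives a uniformly convergent series. Its sum g is
  continuous, periodic and has the Fourier integrals of f, so the uniqueness result applies to f -
  g.\<close>

lemma fourier_inversion:
  assumes f: "f \<in> torus_test"
  shows "uniform_limit UNIV
    (\<lambda>F Y. \<Sum>k\<in>F. torus_coeff f k * torus_char k Y) f (finite_subsets_at_top UNIV)"
proof -
  let ?c = "torus_coeff f"
  let ?S = "\<lambda>F Y. \<Sum>k\<in>F. ?c k * torus_char k Y"
  let ?M = "\<lambda>k. (4 ^ 3 * CN_norm 4 f) * (1 / (lattice_weight k)\<^sup>2)"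
  have M: "cmod (?c k * torus_char k Y) \<le> ?M k" for k Y
    using norm_torus_coeff_le[OF f, of k] by (simp only: norm_mult norm_torus_char mult_1_right)
  have "?M summable_on UNIV" by (intro summable_on_cmult_right summable_on_lattice_weight)
  with M have lim: "uniform_limit UNIV ?S (\<lambda>Y. \<Sum>\<^sub>\<infinity>k. ?c k * torus_char k Y) (finite_subsets_at_top UNIV)"
    by (rule Weierstrass_m_test_general)
  define g where "g Y = (\<Sum>\<^sub>\<infinity>k. ?c k * torus_char k Y)" for Y
  have S_cont: "continuous_on A (?S F)" for A F
    by (intro continuous_intros continuous_torus_char)
  have g: "continuous_on UNIV g"
    unfolding g_def by (rule uniform_limit_theorem[OF _ lim]) (auto intro: S_cont)
  have per: "torus_periodic (\<lambda>Y. f Y - g Y)"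
    unfolding torus_periodic_def by (simp add: g_def torus_char_periodic torus_test_periodic[OF f])
  have "fourier_int g l = fourier_int f l" for l
  proof -
    have "uniform_limit torus_box (\<lambda>F Y. ?S F Y * torus_char l Y) (\<lambda>Y. g Y * torus_char l Y) (finite_subsets_at_top UNIV)"
      unfolding uniform_limit_iff
    proof (intro allI impI)
      fix e :: real assume "e > 0"
      with lim have "\<forall>\<^sub>F F in finite_subsets_at_top UNIV. \<forall>Y\<in>UNIV. dist (?S F Y) (g Y) < e"
        unfolding uniform_limit_iff g_def by blast
      then show "\<forall>\<^sub>F F in finite_subsets_at_top UNIV. \<forall>Y\<in>torus_box. dist (?S F Y * torus_char l Y) (g Y * torus_char l Y) < e"
        by eventually_elim (simp add: dist_norm norm_mult flip: left_diff_distrib del: split_paired_All)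
    qed
    moreover have "continuous_on torus_box (\<lambda>Y. ?S F Y * torus_char l Y)" for F
      by (intro continuous_on_mult S_cont continuous_torus_char)
    ultimately
    obtain I J where IJ: "\<And>F. ((\<lambda>Y. ?S F Y * torus_char l Y) has_integral I F) torus_box"
      "((\<lambda>Y. g Y * torus_char l Y) has_integral J) torus_box" "(I \<longlongrightarrow> J) (finite_subsets_at_top UNIV)"
      by (rule uniform_limit_integral_cbox[OF _ _ finite_subsets_at_top_neq_bot]) blast
    have "\<forall>\<^sub>F F in finite_subsets_at_top UNIV. I F = fourier_int f l"
      unfolding eventually_finite_subsets_at_top
    \<comment> \<open>By orthogonality, pairing a partial sum with \<open>torus_char l\<close> sees
      only the index -l; the value is exact as soon as F contains that index.\<close>
    proof (intro exI[of _ "{(- fst l, - snd l)}"] conjI allI impI)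
      fix F assume F: "finite F \<and> {(- fst l, - snd l)} \<subseteq> F \<and> F \<subseteq> UNIV"
      have "I F = fourier_int (?S F) l"
        using IJ(1)[of F] by (simp add: fourier_int_def integral_unique)
      also have "\<dots> = fourier_int f l"
        by (subst fourier_int_char_sum) (use F in \<open>auto simp: torus_coeff_def simp del: power_mult_distrib\<close>)
      finally show "I F = fourier_int f l" .
    qed auto
    then have "(I \<longlongrightarrow> fourier_int f l) (finite_subsets_at_top UNIV)" by (rule tendsto_eventually)
    with IJ(3) have "J = fourier_int f l" using finite_subsets_at_top_neq_bot tendsto_unique by blast
    then show ?thesis using IJ(2) by (simp add: fourier_int_def integral_unique)
  qed
  moreover have "fourier_int (\<lambda>Y. f Y - g Y) l = fourier_int f l - fourier_int g l" for l
    unfolding fourier_int_def left_diff_distrib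
    by (intro integral_diff integrable_continuous continuous_intros continuous_torus_char
        torus_test_continuous[OF f] continuous_on_subset[OF g subset_UNIV])
  ultimately have "f Y - g Y = 0" for Y
    by (intro fourier_int_zero_imp_zero[OF _ per] continuous_intros g torus_test_continuous[OF f]) simp
  then have "f = g" by auto
  then show ?thesis using lim unfolding g_def by simp
qed

text \<open>Convergence in the test function topology: each derivative of a partial sum is the
  partial sum for that derivative of f, so uniform inversion is applied to the finitely many
  derivatives that occur.\<close>

lemma fourier_inversion_CN:
  assumes f: "f \<in> torus_test"
  shows "((\<lambda>F. CN_norm N (\<lambda>Y. f Y - (\<Sum>k\<in>F. torus_coeff f k * torus_char k Y)))
    \<longlongrightarrow> 0) (finite_subsets_at_top UNIV)"
proof -
  let ?c = torus_coeff
  let ?S = "\<lambda>f F Y. \<Sum>k\<in>F. ?c f k * torus_char k Y"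
  let ?D = "\<lambda>a b f. (pd1 ^^ a) ((pd2 ^^ b) f)"
  have D: "?D a b (\<lambda>Y. f Y - ?S f F Y) = (\<lambda>Y. ?D a b f Y - ?S (?D a b f) F Y)" if "finite F" for a b F
  proof -
    have "?D a b (?S f F) = ?S (?D a b f) F"
      by (simp add: derivs_trig_poly[OF that] torus_coeff_derivs[OF f])
    then show ?thesis
      using derivs_linear[OF f trig_poly_test[OF that, of "?c f"], of a b 1 "- 1"] by simp
  qed
  show ?thesis
  proof (rule tendstoI)
    fix e :: real assume "e > 0"
    \<comment> \<open>\<open>CN_norm N\<close> adds at most (N + 1)^2 suprema, so a bound d for each
      gives e / 2 in total.\<close>
    define d where "d = e / (2 * real (Suc N) ^ 2)"
    have d: "d > 0" using \<open>e > 0\<close> by (simp add: d_def)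
    have "\<forall>\<^sub>F F in finite_subsets_at_top UNIV. finite F"
      by (rule eventually_finite_subsets_at_top_weakI) auto
    moreover have "\<forall>\<^sub>F F in finite_subsets_at_top UNIV.
        \<forall>a\<in>{..N}. \<forall>b\<in>{..N}. \<forall>Y\<in>UNIV. dist (?S (?D a b f) F Y) (?D a b f Y) < d"
    proof (intro eventually_ball_finite finite_atMost; rule ballI; intro eventually_ball_finite finite_atMost; rule ballI)
      fix a b
      show "\<forall>\<^sub>F F in finite_subsets_at_top UNIV. \<forall>Y\<in>UNIV. dist (?S (?D a b f) F Y) (?D a b f Y) < d"
        using fourier_inversion[OF torus_test_derivs[OF f]] d unfolding uniform_limit_iff by blast
    qed
    ultimately show "\<forall>\<^sub>F F in finite_subsets_at_top UNIV. dist (CN_norm N (\<lambda>Y. f Y - ?S f F Y)) 0 < e"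
    proof eventually_elim
      case (elim F)
      let ?h = "\<lambda>Y. f Y - ?S f F Y"
      have h: "?h \<in> torus_test"
        using torus_test_linear[OF f trig_poly_test[OF elim(1), of "?c f"], of 1 "- 1"] by simp
      have "(SUP Y. cmod (?D a b ?h Y)) \<le> d" if "a \<le> N" "b \<le> N" for a b
      proof (rule cSUP_least)
        fix Y
        show "cmod (?D a b ?h Y) \<le> d"
        proof -
          have "dist (?S (?D a b f) F Y) (?D a b f Y) < d" using elim(2) that by blast
          then show ?thesis unfolding D[OF elim(1)] by (simp add: dist_norm norm_minus_commute)
        qed
      qed simp
      then have "CN_norm N ?h \<le> (\<Sum>a\<le>N. \<Sum>b\<le>N - a. d)"
        unfolding CN_norm_def by (intro sum_mono) auto
      also have "\<dots> \<le> (\<Sum>a\<le>N. \<Sum>b\<le>N. d)"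
        using d by (intro sum_mono sum_mono2) auto
      also have "\<dots> < e" using \<open>e > 0\<close> by (simp add: d_def power2_eq_square field_simps del: of_nat_Suc)
      finally show ?case using CN_norm_nonneg[OF h] by simp
    qed
  qed
qed

section \<open>Distributions and their Fourier coefficients\<close>

lemma distr_linear:
  assumes "u \<in> torus_distr" "f \<in> torus_test" "g \<in> torus_test"
  shows "u (\<lambda>Y. a * f Y + b * g Y) = a * u f + b * u g"
  using assms by (simp add: torus_distr_def)

lemma distr_char:
  assumes "u \<in> torus_distr"
  shows "u (torus_char k) = (2 * pi)\<^sup>2 * fourier_coeff u (- fst k, - snd k)"
  by (simp add: fourier_coeff_def del: power_mult_distrib)

lemma distr_trig_poly:
  assumes u: "u \<in> torus_distr" and F: "finite F"
  shows "u (\<lambda>Y. \<Sum>k\<in>F. c k * torus_char k Y) = (\<Sum>k\<in>F. c k * u (torus_char k))"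
  using F
proof induction
  case empty
  then show ?case using distr_linear[OF u torus_test_char' torus_test_char', of 0 _ 0] by simp
next
  case (insert k F)
  then show ?case
    using distr_linear[OF u torus_test_char' trig_poly_test[OF insert.hyps(1)], of "c k" k 1 c] by simp
qed

lemma distr_bound:
  assumes "u \<in> torus_distr"
  obtains C N where "0 \<le> C" "\<And>f. f \<in> torus_test \<Longrightarrow> cmod (u f) \<le> C * CN_norm N f"
proof -
  from assms obtain C N where C: "\<forall>f\<in>torus_test. cmod (u f) \<le> C * CN_norm N f"
    unfolding torus_distr_def by auto
  show ?thesis
  proof (rule that[of "\<bar>C\<bar>" N])
    fix f assume f: "f \<in> torus_test"
    have "cmod (u f) \<le> C * CN_norm N f" using C f by blast
    also have "\<dots> \<le> \<bar>C\<bar> * CN_norm N f" by (intro mult_right_mono CN_norm_nonneg f) simp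
    finally show "cmod (u f) \<le> \<bar>C\<bar> * CN_norm N f" .
  qed simp
qed

text \<open>A distribution is controlled by some \<open>CN_norm\<close>, in which the partial
  Fourier sums of a test function converge.\<close>

lemma distr_fourier_expansion:
  assumes u: "u \<in> torus_distr" and f: "f \<in> torus_test"
  shows "((\<lambda>F. \<Sum>k\<in>F. torus_coeff f k * u (torus_char k)) \<longlongrightarrow> u f) (finite_subsets_at_top UNIV)"
proof -
  obtain C N where C: "\<And>g. g \<in> torus_test \<Longrightarrow> cmod (u g) \<le> C * CN_norm N g"
    using distr_bound[OF u] by blast
  let ?h = "\<lambda>F Y. f Y - (\<Sum>k\<in>F. torus_coeff f k * torus_char k Y)"
  have bound: "cmod ((\<Sum>k\<in>F. torus_coeff f k * u (torus_char k)) - u f) \<le> C * CN_norm N (?h F)"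
    if F: "finite F" for F
  proof -
    have "?h F \<in> torus_test"
      using torus_test_linear[OF f trig_poly_test[OF F, of "torus_coeff f"], of 1 "- 1"] by simp
    moreover have "u (?h F) = u f - (\<Sum>k\<in>F. torus_coeff f k * u (torus_char k))"
      using distr_linear[OF u f trig_poly_test[OF F, of "torus_coeff f"], of 1 "- 1"]
      by (simp add: distr_trig_poly[OF u F])
    ultimately show ?thesis using C[of "?h F"] by (simp add: norm_minus_commute)
  qed
  have "((\<lambda>F. C * CN_norm N (?h F)) \<longlongrightarrow> C * 0) (finite_subsets_at_top UNIV)"
    by (intro tendsto_mult tendsto_const fourier_inversion_CN[OF f])
  then have "((\<lambda>F. (\<Sum>k\<in>F. torus_coeff f k * u (torus_char k)) - u f) \<longlongrightarrow> 0) (finite_subsets_at_top UNIV)"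
    using Lim_null_comparison[OF eventually_finite_subsets_at_top_weakI[OF bound]] by simp
  then show ?thesis by (rule LIM_zero_cancel)
qed

text \<open>The expansion settles the values on test functions. Elsewhere both functionals are 0 by
  the convention in \<open>torus_distr\<close>, so they agree as functions.\<close>

lemma distr_eqI:
  assumes u: "u \<in> torus_distr" and v: "v \<in> torus_distr"
    and eq: "\<And>k. fourier_coeff u k = fourier_coeff v k"
  shows "u = v"
proof
  fix f
  show "u f = v f"
  proof (cases "f \<in> torus_test")
    case True
    then show ?thesis
      using distr_fourier_expansion[OF u True] distr_fourier_expansion[OF v True]
      unfolding distr_char[OF u] distr_char[OF v] eq
      using tendsto_unique[OF finite_subsets_at_top_neq_bot] by blast
  qed (use u v in \<open>simp add: torus_distr_def\<close>)
qed

lemma CN_norm_mono: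
  assumes "f \<in> torus_test" "M \<le> N"
  shows "CN_norm M f \<le> CN_norm N f"
proof -
  let ?S = "\<lambda>a b. SUP Y. cmod ((pd1 ^^ a) ((pd2 ^^ b) f) Y)"
  have nn: "0 \<le> ?S a b" for a b
    by (intro torus_test_Sup_nonneg torus_test_derivs assms(1))
  have "CN_norm M f \<le> (\<Sum>a\<le>M. \<Sum>b\<le>N - a. ?S a b)"
    unfolding CN_norm_def using assms(2) nn by (intro sum_mono sum_mono2) auto
  also have "\<dots> \<le> CN_norm N f"
    unfolding CN_norm_def using assms(2) nn by (intro sum_mono2 sum_nonneg) auto
  finally show ?thesis .
qed

lemma torus_distr_linear:
  assumes u: "u \<in> torus_distr" and v: "v \<in> torus_distr"
  shows "(\<lambda>f. a * u f + b * v f) \<in> torus_distr"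
proof -
  obtain C N where C: "0 \<le> C" "\<And>g. g \<in> torus_test \<Longrightarrow> cmod (u g) \<le> C * CN_norm N g"
    using distr_bound[OF u] by blast
  obtain C' N' where C': "0 \<le> C'" "\<And>g. g \<in> torus_test \<Longrightarrow> cmod (v g) \<le> C' * CN_norm N' g"
    using distr_bound[OF v] by blast
  have "cmod (a * u g + b * v g) \<le> (cmod a * C + cmod b * C') * CN_norm (max N N') g"
    if g: "g \<in> torus_test" for g
  proof -
    have "cmod (a * u g + b * v g) \<le> cmod a * cmod (u g) + cmod b * cmod (v g)"
      by (metis norm_mult norm_triangle_ineq)
    also have "\<dots> \<le> cmod a * (C * CN_norm N g) + cmod b * (C' * CN_norm N' g)"
      by (intro add_mono mult_left_mono C C' g) auto
    also have "\<dots> \<le> cmod a * (C * CN_norm (max N N') g) + cmod b * (C' * CN_norm (max N N') g)"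
      by (intro add_mono mult_left_mono CN_norm_mono C C' g) auto
    finally show ?thesis by (simp add: algebra_simps)
  qed
  then have "\<exists>C N. \<forall>g\<in>torus_test. cmod (a * u g + b * v g) \<le> C * CN_norm N g" by blast
  moreover have "a * u f + b * v f = 0" if "f \<notin> torus_test" for f
    using u v that by (simp add: torus_distr_def)
  moreover have "a * u (\<lambda>Y. c * f Y + d * g Y) + b * v (\<lambda>Y. c * f Y + d * g Y) =
      c * (a * u f + b * v f) + d * (a * u g + b * v g)"
    if "f \<in> torus_test" "g \<in> torus_test" for f g c d
    using distr_linear[OF u that] distr_linear[OF v that] by (simp add: algebra_simps)
  ultimately show ?thesis unfolding torus_distr_def by blast
qed

lemma distr_of_in_torus_distr:
  assumes "continuous_on UNIV f"
  shows "distr_of f \<in> torus_distr"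
proof -
  have fc: "continuous_on A f" for A using assms continuous_on_subset by blast
  have "compact (f ` torus_box)" by (rule compact_continuous_image[OF fc compact_cbox])
  from compact_imp_bounded[OF this]
  obtain B where B: "\<And>Y. Y \<in> torus_box \<Longrightarrow> cmod (f Y) \<le> B" unfolding bounded_iff by (metis imageI)
  have "(0, 0) \<in> torus_box" by simp
  then have "0 \<le> B" using B norm_ge_zero order_trans by blast
  have "cmod (distr_of f g) \<le> (B * (2 * pi)\<^sup>2) * CN_norm 0 g" if g: "g \<in> torus_test" for g
  proof -
    have "cmod (integral torus_box (\<lambda>Y. f Y * g Y)) \<le> (B * CN_norm 0 g) * (2 * pi)\<^sup>2"
    proof (rule norm_torus_integral_le)
      show "cmod (f Y * g Y) \<le> B * CN_norm 0 g" if "Y \<in> torus_box" for Y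
        unfolding norm_mult using B[OF that] \<open>0 \<le> B\<close> CN_norm_bound[OF g, of 0 0 0 Y] by (intro mult_mono) auto
    qed (intro continuous_intros fc torus_test_continuous[OF g])
    then show ?thesis using g by (simp add: distr_of_def mult_ac)
  qed
  then have "\<exists>C N. \<forall>g\<in>torus_test. cmod (distr_of f g) \<le> C * CN_norm N g" by blast
  moreover have "distr_of f (\<lambda>Y. a * g Y + b * h Y) = a * distr_of f g + b * distr_of f h"
    if g: "g \<in> torus_test" and h: "h \<in> torus_test" for g h a b
  proof -
    have "((\<lambda>Y. a * (f Y * g Y) + b * (f Y * h Y)) has_integral
        a * integral torus_box (\<lambda>Y. f Y * g Y) + b * integral torus_box (\<lambda>Y. f Y * h Y)) torus_box"
      by (intro has_integral_add has_integral_mult_right integrable_integral integrable_continuous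
          continuous_intros fc torus_test_continuous[OF g] torus_test_continuous[OF h])
    then show ?thesis
      using g h by (simp add: distr_of_def torus_test_linear algebra_simps integral_unique)
  qed
  ultimately show ?thesis unfolding torus_distr_def by (auto simp: distr_of_def)
qed

lemma fourier_coeff_distr_of: "fourier_coeff (distr_of f) k = torus_coeff f k"
  by (simp add: fourier_coeff_def distr_of_def torus_test_char' torus_coeff_def fourier_int_def)

lemma fourier_coeff_distr_of_char:
  "fourier_coeff (distr_of (torus_char l)) k = (if k = l then 1 else 0)"
  by (cases k; cases l) (auto simp: fourier_coeff_distr_of torus_coeff_def fourier_int_char)

lemma CN_norm_char_le: "CN_norm N (torus_char k) \<le> (real (Suc N))\<^sup>2 * lattice_weight k ^ N"
proof -
  have "(SUP Y. cmod ((pd1 ^^ a) ((pd2 ^^ b) (torus_char k)) Y)) \<le> lattice_weight k ^ N" if "a + b \<le> N" for a b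
  proof (rule cSUP_least)
    fix Y
    have "cmod ((pd1 ^^ a) ((pd2 ^^ b) (torus_char k)) Y) = \<bar>of_int (fst k)\<bar> ^ a * \<bar>of_int (snd k)\<bar> ^ b"
      using derivs_char[of a b 1 k] by (simp add: norm_mult norm_power)
    also have "\<dots> \<le> (1 + \<bar>of_int (fst k)\<bar>) ^ N * (1 + \<bar>of_int (snd k)\<bar>) ^ N"
      using that by (intro mult_mono order_trans[OF power_mono power_increasing]) auto
    finally show "cmod ((pd1 ^^ a) ((pd2 ^^ b) (torus_char k)) Y) \<le> lattice_weight k ^ N"
      by (simp add: lattice_weight_def power_mult_distrib)
  qed simp
  then have "CN_norm N (torus_char k) \<le> (\<Sum>a\<le>N. \<Sum>b\<le>N - a. lattice_weight k ^ N)"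
    unfolding CN_norm_def by (intro sum_mono) auto
  also have "\<dots> \<le> (\<Sum>a\<le>N. \<Sum>b\<le>N. lattice_weight k ^ N)"
    using lattice_weight_ge_1[of k] by (intro sum_mono sum_mono2) auto
  finally show ?thesis by (simp add: power2_eq_square mult.assoc)
qed

text \<open>The continuity estimate is evaluated on characters, whose seminorms grow polynomially in
  the frequency.\<close>

lemma fourier_coeff_polynomial_growth:
  assumes u: "u \<in> torus_distr"
  obtains C N where "\<And>k. cmod (fourier_coeff u k) \<le> C * lattice_weight k ^ N"
proof -
  obtain C N where C: "0 \<le> C" "\<And>g. g \<in> torus_test \<Longrightarrow> cmod (u g) \<le> C * CN_norm N g"
    using distr_bound[OF u] by blast
  have "cmod (fourier_coeff u k) \<le> (C * (real (Suc N))\<^sup>2 / (2 * pi)\<^sup>2) * lattice_weight k ^ N" for k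
  proof -
    let ?k = "(- fst k, - snd k)"
    have "cmod (u (torus_char ?k)) \<le> C * CN_norm N (torus_char ?k)" by (intro C torus_test_char')
    also have "\<dots> \<le> C * ((real (Suc N))\<^sup>2 * lattice_weight ?k ^ N)" by (intro mult_left_mono CN_norm_char_le C)
    finally have "cmod (u (torus_char ?k)) / (2 * pi)\<^sup>2 \<le> C * ((real (Suc N))\<^sup>2 * lattice_weight k ^ N) / (2 * pi)\<^sup>2"
      by (intro divide_right_mono) auto
    then show ?thesis unfolding fourier_coeff_def norm_divide norm_of_real by (simp add: mult_ac)
  qed
  then show ?thesis using that by blast
qed

text \<open>The converse of polynomial growth. The Fourier integrals of a test function decay to
  order q + 2; q powers of the weight compensate the growth of the coefficients and the other two
  make the sum over the lattice converge.\<close>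

lemma distr_with_fourier_coeffs:
  assumes a: "\<And>k. cmod (a k) \<le> C * lattice_weight k ^ q"
  obtains w where "w \<in> torus_distr" "\<And>k. fourier_coeff w k = a k"
proof -
  \<comment> \<open>The formal series with terms \<open>a k * torus_char k\<close>, paired with f
    term by term.\<close>
  define w where "w f = (if f \<in> torus_test then \<Sum>\<^sub>\<infinity>k. a k * fourier_int f k else 0)" for f
  define D where "D = C * (4 ^ (q + 2 + 1) * (2 * pi)\<^sup>2)"
  have term_le: "cmod (a k * fourier_int f k) \<le> (D * CN_norm (2 * (q + 2)) f) * (1 / (lattice_weight k)\<^sup>2)"
    if f: "f \<in> torus_test" for f k
  proof -
    have w: "lattice_weight k > 0" using lattice_weight_ge_1[of k] by linarith
    have "0 \<le> C * lattice_weight k ^ q" using a[of k] norm_ge_zero order_trans by blast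
    then have C: "C \<ge> 0" using zero_less_power[OF w, of q] by (simp add: zero_le_mult_iff not_less)
    have "cmod (a k * fourier_int f k) * (lattice_weight k)\<^sup>2
        \<le> (C * lattice_weight k ^ q * cmod (fourier_int f k)) * (lattice_weight k)\<^sup>2"
      unfolding norm_mult by (intro mult_right_mono a) auto
    also have "\<dots> = C * (lattice_weight k ^ (q + 2) * cmod (fourier_int f k))"
      by (simp add: power_add mult_ac power2_eq_square)
    also have "\<dots> \<le> C * (4 ^ (q + 2 + 1) * (2 * pi)\<^sup>2 * CN_norm (2 * (q + 2)) f)"
      by (intro mult_left_mono fourier_int_decay f C)
    also have "\<dots> = D * CN_norm (2 * (q + 2)) f" by (simp only: D_def mult.assoc)
    finally show ?thesis using w by (simp add: field_simps)
  qed
  have summ: "(\<lambda>k. cmod (a k * fourier_int f k)) summable_on UNIV" if "f \<in> torus_test" for f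
  proof (rule summable_on_comparison_test[OF _ term_le[OF that]])
    show "(\<lambda>k. (D * CN_norm (2 * (q + 2)) f) * (1 / (lattice_weight k)\<^sup>2)) summable_on UNIV"
      by (intro summable_on_cmult_right summable_on_lattice_weight)
  qed simp
  have "cmod (w f) \<le> (D * infsum (\<lambda>k. 1 / (lattice_weight k)\<^sup>2) UNIV) * CN_norm (2 * (q + 2)) f"
    if f: "f \<in> torus_test" for f
  proof -
    have "cmod (w f) \<le> (\<Sum>\<^sub>\<infinity>k. cmod (a k * fourier_int f k))"
      using norm_infsum_bound[OF summ[OF f]] f by (simp add: w_def)
    also have "\<dots> \<le> (\<Sum>\<^sub>\<infinity>k. (D * CN_norm (2 * (q + 2)) f) * (1 / (lattice_weight k)\<^sup>2))"
      by (intro infsum_mono summ f summable_on_cmult_right summable_on_lattice_weight term_le)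
    also have "\<dots> = (D * CN_norm (2 * (q + 2)) f) * infsum (\<lambda>k. 1 / (lattice_weight k)\<^sup>2) UNIV"
      by (intro infsum_cmult_right summable_on_lattice_weight)
    finally show ?thesis by (simp add: mult_ac)
  qed
  then have "\<exists>C N. \<forall>f\<in>torus_test. cmod (w f) \<le> C * CN_norm N f" by blast
  moreover have "w (\<lambda>Y. b * f Y + c * g Y) = b * w f + c * w g"
    if f: "f \<in> torus_test" and g: "g \<in> torus_test" for f g b c
  proof -
    have "fourier_int (\<lambda>Y. b * f Y + c * g Y) k = b * fourier_int f k + c * fourier_int g k" for k
    proof -
      have "((\<lambda>Y. b * (f Y * torus_char k Y) + c * (g Y * torus_char k Y)) has_integral
          b * fourier_int f k + c * fourier_int g k) torus_box"
        unfolding fourier_int_def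
        by (intro has_integral_add has_integral_mult_right integrable_integral integrable_continuous
            continuous_intros continuous_torus_char torus_test_continuous[OF f] torus_test_continuous[OF g])
      then show ?thesis by (simp add: fourier_int_def integral_unique algebra_simps)
    qed
    then have "(\<lambda>k. a k * fourier_int (\<lambda>Y. b * f Y + c * g Y) k) =
        (\<lambda>k. b * (a k * fourier_int f k) + c * (a k * fourier_int g k))"
      by (simp add: fun_eq_iff algebra_simps)
    moreover have "(\<Sum>\<^sub>\<infinity>k. b * (a k * fourier_int f k) + c * (a k * fourier_int g k)) =
        b * (\<Sum>\<^sub>\<infinity>k. a k * fourier_int f k) + c * (\<Sum>\<^sub>\<infinity>k. a k * fourier_int g k)"
      using abs_summable_summable[OF summ[OF f]] abs_summable_summable[OF summ[OF g]]
      by (subst infsum_add) (auto intro!: summable_on_cmult_right simp: infsum_cmult_right)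
    ultimately show ?thesis using f g by (simp add: w_def torus_test_linear)
  qed
  ultimately have "w \<in> torus_distr" unfolding torus_distr_def by (auto simp: w_def)
  moreover have "fourier_coeff w k = a k" for k
  proof -
    have "w (torus_char (- fst k, - snd k)) = a k * (2 * pi)\<^sup>2"
    proof -
      have "(\<Sum>\<^sub>\<infinity>j. a j * fourier_int (torus_char (- fst k, - snd k)) j) =
          (\<Sum>\<^sub>\<infinity>j\<in>{k}. a j * fourier_int (torus_char (- fst k, - snd k)) j)"
        by (rule infsum_cong_neutral) (auto simp: fourier_int_char)
      then show ?thesis by (simp add: w_def torus_test_char' fourier_int_char)
    qed
    then show ?thesis by (simp add: fourier_coeff_def)
  qed
  ultimately show ?thesis using that by blast
qed

section \<open>Kernel and resolvent\<close>

text \<open>At \<nu> = \<open>nu0 \<tau>\<close> the symbol vanishes at these five points for every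
  \<tau> > 0. Whether it has further zeros depends on the parameter.\<close>

definition kernel_freqs :: "(int \<times> int) set" where
  "kernel_freqs = {(0, 0), (1, 1), (- 1, - 1), (- 1, 1), (1, - 1)}"

lemma freq_norm_nonneg: "0 \<le> freq_norm k"
  by (simp add: freq_norm_def)

lemma one_plus_freq_norm_le_lattice_weight: "1 + freq_norm k \<le> lattice_weight k"
proof -
  have "freq_norm k \<le> \<bar>of_int (fst k)\<bar> + \<bar>of_int (snd k)\<bar>"
    unfolding freq_norm_def by (rule sqrt_sum_squares_le_sum_abs)
  moreover have "0 \<le> \<bar>of_int (fst k)\<bar> * \<bar>of_int (snd k) :: real\<bar>" by simp
  ultimately show ?thesis unfolding lattice_weight_def distrib_left distrib_right by linarith
qed

lemma kernel_freqs_vanish_on_orth: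
  assumes "u \<in> torus_orth V" "distr_of (torus_char k) \<in> V"
  shows "fourier_coeff u k = 0"
proof -
  have "u (\<lambda>Y. cnj (torus_char k Y)) = 0"
    using assms torus_test_char' unfolding torus_orth_def by blast
  moreover have "(\<lambda>Y. cnj (torus_char k Y)) = torus_char (- fst k, - snd k)"
    by (simp add: torus_char_def exp_cnj fun_eq_iff algebra_simps)
  ultimately show ?thesis by (simp add: fourier_coeff_def)
qed

lemma fourier_coeff_zero_distr: "fourier_coeff (\<lambda>_. 0) k = 0"
  by (simp add: fourier_coeff_def)

lemma zero_distr: "(\<lambda>_. 0) \<in> torus_distr"
  using torus_distr_linear[of "distr_of (torus_char (0, 0))" "distr_of (torus_char (0, 0))" 0 0]
    distr_of_in_torus_distr[OF continuous_torus_char] by simp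

lemma ker_L0_iff:
  assumes "\<And>k. L_symbol (nu0 \<tau>) \<tau> k = 0 \<longleftrightarrow> k \<in> kernel_freqs"
  shows "u \<in> ker_L0 \<tau> \<longleftrightarrow> u \<in> torus_distr \<and> (\<forall>k. k \<notin> kernel_freqs \<longrightarrow> fourier_coeff u k = 0)"
  using assms by (auto simp: ker_L0_def multiplier_graph_def zero_distr fourier_coeff_zero_distr)

lemma char_in_ker_L0:
  assumes "\<And>k. L_symbol (nu0 \<tau>) \<tau> k = 0 \<longleftrightarrow> k \<in> kernel_freqs" and "k \<in> kernel_freqs"
  shows "distr_of (torus_char k) \<in> ker_L0 \<tau>"
  using assms(2)
  by (auto simp: ker_L0_iff[OF assms(1)] distr_of_in_torus_distr continuous_torus_char fourier_coeff_distr_of_char)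

lemma distr_sum:
  assumes "finite F" "\<And>v. v \<in> F \<Longrightarrow> v \<in> torus_distr"
  shows "(\<lambda>g. \<Sum>v\<in>F. a v * v g) \<in> torus_distr"
    and "fourier_coeff (\<lambda>g. \<Sum>v\<in>F. a v * v g) k = (\<Sum>v\<in>F. a v * fourier_coeff v k)"
proof -
  show "(\<lambda>g. \<Sum>v\<in>F. a v * v g) \<in> torus_distr"
    using assms
  proof (induction F)
    case empty
    then show ?case by (simp add: zero_distr)
  next
    case (insert v F)
    then have "v \<in> torus_distr" "(\<lambda>g. \<Sum>v\<in>F. a v * v g) \<in> torus_distr" by auto
    from torus_distr_linear[OF this, of "a v" 1] show ?case using insert.hyps by simp
  qed
  show "fourier_coeff (\<lambda>g. \<Sum>v\<in>F. a v * v g) k = (\<Sum>v\<in>F. a v * fourier_coeff v k)"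
    by (simp add: fourier_coeff_def sum_divide_distrib)
qed

text \<open>The coefficients in \<open>distr_span\<close> are indexed by distributions; injectivity
  allows indexing them by frequencies.\<close>

lemma inj_distr_of_char: "inj (\<lambda>k. distr_of (torus_char k))"
proof (rule injI)
  fix k l :: "int \<times> int"
  assume "distr_of (torus_char k) = distr_of (torus_char l)"
  then have "fourier_coeff (distr_of (torus_char k)) k = fourier_coeff (distr_of (torus_char l)) k" by simp
  then show "k = l" by (simp add: fourier_coeff_distr_of_char split: if_splits)
qed

lemma ker_L0_eq_span:
  assumes "\<And>k. L_symbol (nu0 \<tau>) \<tau> k = 0 \<longleftrightarrow> k \<in> kernel_freqs"
  shows "ker_L0 \<tau> = distr_span ((\<lambda>k. distr_of (torus_char k)) ` kernel_freqs)"
proof (intro set_eqI iffI)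
  let ?e = "\<lambda>k. distr_of (torus_char k)"
  have e: "?e k \<in> torus_distr" for k
    by (simp add: distr_of_in_torus_distr continuous_torus_char)
  fix u
  show "u \<in> ker_L0 \<tau>" if "u \<in> distr_span (?e ` kernel_freqs)"
  proof -
    obtain F a where F: "finite F" "F \<subseteq> ?e ` kernel_freqs" "u = (\<lambda>g. \<Sum>v\<in>F. a v * v g)"
      using \<open>u \<in> distr_span (?e ` kernel_freqs)\<close> unfolding distr_span_def by blast
    have F': "v \<in> torus_distr" if "v \<in> F" for v using that F(2) e by auto
    have "fourier_coeff u k = 0" if "k \<notin> kernel_freqs" for k
    proof -
      have "fourier_coeff u k = (\<Sum>v\<in>F. a v * fourier_coeff v k)"
        unfolding F(3) by (rule distr_sum(2)[OF F(1) F'])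
      also have "\<dots> = 0"
      proof (intro sum.neutral ballI)
        fix v assume "v \<in> F"
        then obtain l where "l \<in> kernel_freqs" "v = ?e l" using F(2) by blast
        then show "a v * fourier_coeff v k = 0" using that by (auto simp: fourier_coeff_distr_of_char)
      qed
      finally show ?thesis .
    qed
    then show ?thesis unfolding ker_L0_iff[OF assms] F(3) using distr_sum(1)[OF F(1) F'] by blast
  qed
  show "u \<in> distr_span (?e ` kernel_freqs)" if "u \<in> ker_L0 \<tau>"
  proof -
    have u: "u \<in> torus_distr" "\<And>k. k \<notin> kernel_freqs \<Longrightarrow> fourier_coeff u k = 0"
      using \<open>u \<in> ker_L0 \<tau>\<close> unfolding ker_L0_iff[OF assms] by auto
    define a where "a v = fourier_coeff u (inv ?e v)" for v
    have a: "a (?e k) = fourier_coeff u k" for k unfolding a_def inv_f_f[OF inj_distr_of_char] ..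
    have fin: "finite (?e ` kernel_freqs)" by (simp add: kernel_freqs_def)
    have "u = (\<lambda>g. \<Sum>v\<in>?e ` kernel_freqs. a v * v g)"
    proof (rule distr_eqI[OF u(1)])
      show "(\<lambda>g. \<Sum>v\<in>?e ` kernel_freqs. a v * v g) \<in> torus_distr"
        using e by (intro distr_sum(1) fin) auto
      fix k
      have "fourier_coeff (\<lambda>g. \<Sum>v\<in>?e ` kernel_freqs. a v * v g) k
          = (\<Sum>v\<in>?e ` kernel_freqs. a v * fourier_coeff v k)"
        using e by (intro distr_sum(2) fin) auto
      also have "\<dots> = (\<Sum>l\<in>kernel_freqs. if k = l then fourier_coeff u l else 0)"
        by (subst sum.reindex)
          (auto intro: inj_on_subset[OF inj_distr_of_char] intro!: sum.cong simp: a fourier_coeff_distr_of_char)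
      also have "\<dots> = fourier_coeff u k"
        using u(2) by (subst sum.delta') (auto simp: kernel_freqs_def)
      finally show "fourier_coeff u k = fourier_coeff (\<lambda>g. \<Sum>v\<in>?e ` kernel_freqs. a v * v g) k" by simp
    qed
    then show ?thesis using fin unfolding distr_span_def by blast
  qed
qed

text \<open>Non-triviality of the eigenvalue zero: the kernel goes beyond the constants, which have
  no Fourier coefficient at (1, 1).\<close>

lemma nonconstant_in_ker_L0:
  assumes "\<And>k. L_symbol (nu0 \<tau>) \<tau> k = 0 \<longleftrightarrow> k \<in> kernel_freqs"
  shows "\<exists>v\<in>ker_L0 \<tau>. \<forall>a. v \<noteq> distr_of (\<lambda>Y. a)"
proof (intro bexI[of _ "distr_of (torus_char (1, 1))"] allI notI)
  fix a
  assume "distr_of (torus_char (1, 1)) = distr_of (\<lambda>Y. a)"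
  then have "fourier_coeff (distr_of (torus_char (1, 1))) (1, 1) = fourier_coeff (distr_of (\<lambda>Y. a)) (1, 1)" by simp
  moreover have "fourier_coeff (distr_of (\<lambda>Y. a)) (1, 1) = 0"
    by (simp add: fourier_coeff_distr_of torus_coeff_def fourier_int_def integral_torus_char)
  ultimately show False by (simp add: fourier_coeff_distr_of_char)
qed (auto intro: char_in_ker_L0[OF assms] simp: kernel_freqs_def)

text \<open>Transfers a lower bound for the symbol to an operator bound: dividing by it costs q
  derivatives in the weighted sum that defines the Sobolev norm. Orthogonality to the kernel removes
  exactly the frequencies at which no lower bound is assumed.\<close>

lemma resolvent_bound:
  assumes ker: "\<And>k. L_symbol (nu0 \<tau>) \<tau> k = 0 \<longleftrightarrow> k \<in> kernel_freqs"
    and c: "c > 0" and q: "q \<ge> 0"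
    and lower: "\<And>k. k \<notin> kernel_freqs \<Longrightarrow> c * (1 + freq_norm k) powr (- q) \<le> \<bar>L_symbol \<nu> \<tau> k - \<kappa>\<bar>"
    and u: "u \<in> torus_orth (ker_L0 \<tau>) \<inter> sobolev s"
  shows "\<exists>w. resolvent_graph \<nu> \<tau> \<kappa> u w \<and> w \<in> sobolev (s - q) \<and>
    sobolev_norm (s - q) w \<le> 1 / c * sobolev_norm s u"
proof -
  let ?m = "\<lambda>k. L_symbol \<nu> \<tau> k - \<kappa>" and ?u = "fourier_coeff u"
  have u_distr: "u \<in> torus_distr" using u by (simp add: sobolev_def)
  have u0: "?u k = 0" if "k \<in> kernel_freqs" for k
    using u char_in_ker_L0[OF ker that] kernel_freqs_vanish_on_orth by blast
  have f1: "1 + freq_norm k \<ge> 1" for k using freq_norm_nonneg by simp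
  have nz: "?m k \<noteq> 0" if "k \<notin> kernel_freqs" for k
  proof -
    have "0 < c * (1 + freq_norm k) powr (- q)" using c f1[of k] by simp
    then show ?thesis using lower[OF that] by auto
  qed
  \<comment> \<open>At a kernel frequency \<open>?m k\<close> may be 0, with quotient 0 by
    convention; there \<open>?u k\<close> vanishes anyway.\<close>
  define a where "a k = complex_of_real (1 / ?m k) * ?u k" for k
  have a_le: "cmod (a k) \<le> 1 / c * ((1 + freq_norm k) powr q * cmod (?u k))" for k
  proof (cases "k \<in> kernel_freqs")
    case True
    then show ?thesis by (simp add: a_def u0)
  next
    case False
    have "0 < c * (1 + freq_norm k) powr (- q)" using c f1[of k] by simp
    then have "1 / \<bar>?m k\<bar> \<le> 1 / (c * (1 + freq_norm k) powr (- q))"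
      using lower[OF False] by (intro divide_left_mono) (auto intro: mult_pos_pos)
    also have "\<dots> = 1 / c * (1 + freq_norm k) powr q" by (simp add: powr_minus divide_inverse)
    finally have "1 / \<bar>?m k\<bar> * cmod (?u k) \<le> 1 / c * (1 + freq_norm k) powr q * cmod (?u k)"
      by (rule mult_right_mono) simp
    then show ?thesis unfolding a_def norm_mult norm_of_real by (simp add: mult.assoc)
  qed
  obtain C N where CN: "\<And>k. cmod (?u k) \<le> C * lattice_weight k ^ N"
    using fourier_coeff_polynomial_growth[OF u_distr] by blast
  \<comment> \<open>The solution must be shown to be a distribution. The growth criterion takes
    natural exponents, so q is rounded up.\<close>
  have "cmod (a k) \<le> (1 / c * C) * lattice_weight k ^ (nat \<lceil>q\<rceil> + N)" for k
  proof -
    have "(1 + freq_norm k) powr q \<le> lattice_weight k powr q"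
      using one_plus_freq_norm_le_lattice_weight freq_norm_nonneg q by (intro powr_mono2) auto
    also have "\<dots> \<le> lattice_weight k powr real (nat \<lceil>q\<rceil>)"
      using lattice_weight_ge_1 q by (intro powr_mono) auto
    also have "\<dots> = lattice_weight k ^ nat \<lceil>q\<rceil>"
      using lattice_weight_ge_1[of k] by (subst powr_realpow) auto
    finally have "(1 + freq_norm k) powr q * cmod (?u k) \<le> lattice_weight k ^ nat \<lceil>q\<rceil> * (C * lattice_weight k ^ N)"
      using lattice_weight_ge_1[of k] by (intro mult_mono CN) auto
    then have "1 / c * ((1 + freq_norm k) powr q * cmod (?u k)) \<le>
        1 / c * (lattice_weight k ^ nat \<lceil>q\<rceil> * (C * lattice_weight k ^ N))"
      using c by (intro mult_left_mono) auto
    then show ?thesis using a_le[of k] by (simp add: power_add mult_ac)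
  qed
  then obtain w where w: "w \<in> torus_distr" "\<And>k. fourier_coeff w k = a k"
    using distr_with_fourier_coeffs by blast
  let ?U = "\<lambda>k. (1 + freq_norm k) powr (2 * s) * (cmod (?u k))\<^sup>2"
  let ?W = "\<lambda>k. (1 + freq_norm k) powr (2 * (s - q)) * (cmod (fourier_coeff w k))\<^sup>2"
  have WU: "?W k \<le> 1 / c\<^sup>2 * ?U k" for k
  proof -
    have "(cmod (a k))\<^sup>2 \<le> (1 / c * ((1 + freq_norm k) powr q * cmod (?u k)))\<^sup>2"
      by (intro power_mono a_le) simp
    also have "\<dots> = 1 / c\<^sup>2 * ((1 + freq_norm k) powr (2 * q) * (cmod (?u k))\<^sup>2)"
      using f1[of k] by (simp add: power_mult_distrib power2_eq_square powr_add[symmetric] mult_ac)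
    finally have "?W k \<le> (1 + freq_norm k) powr (2 * (s - q)) * (1 / c\<^sup>2 * ((1 + freq_norm k) powr (2 * q) * (cmod (?u k))\<^sup>2))"
      unfolding w(2) by (intro mult_left_mono) auto
    also have "\<dots> = 1 / c\<^sup>2 * (((1 + freq_norm k) powr (2 * (s - q)) * (1 + freq_norm k) powr (2 * q)) * (cmod (?u k))\<^sup>2)"
      by (simp add: mult_ac)
    also have "\<dots> = 1 / c\<^sup>2 * ?U k" by (simp add: powr_add[symmetric])
    finally show ?thesis .
  qed
  have U: "?U summable_on UNIV" using u by (simp add: sobolev_def)
  have U': "(\<lambda>k. 1 / c\<^sup>2 * ?U k) summable_on UNIV" by (rule summable_on_cmult_right[OF U])
  have W: "?W summable_on UNIV"
    by (rule summable_on_comparison_test[OF U' WU]) auto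
  have "infsum ?W UNIV \<le> (\<Sum>\<^sub>\<infinity>k. 1 / c\<^sup>2 * ?U k)"
    by (rule infsum_mono[OF W U' WU])
  also have "\<dots> = 1 / c\<^sup>2 * infsum ?U UNIV" by (rule infsum_cmult_right[OF U])
  finally have "sobolev_norm (s - q) w \<le> sqrt (1 / c\<^sup>2 * infsum ?U UNIV)"
    unfolding sobolev_norm_def by (rule real_sqrt_le_mono)
  also have "\<dots> = 1 / c * sobolev_norm s u"
    using c by (simp add: sobolev_norm_def real_sqrt_mult real_sqrt_divide)
  finally have "sobolev_norm (s - q) w \<le> 1 / c * sobolev_norm s u" .
  moreover have "w \<in> sobolev (s - q)" using w(1) W by (simp add: sobolev_def)
  moreover have "resolvent_graph \<nu> \<tau> \<kappa> u w"
    unfolding resolvent_graph_def multiplier_graph_def w(2) a_def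
    using u_distr w(1) u0 nz by blast
  ultimately show ?thesis by blast
qed

section \<open>Small divisors for almost every parameter\<close>

definition int_dist :: "real \<Rightarrow> real" where
  "int_dist x = \<bar>x - of_int (round x)\<bar>"

lemma int_dist_le: "int_dist x \<le> \<bar>x - of_int m\<bar>"
  unfolding int_dist_def by (rule round_diff_minimal)

lemma int_dist_nonneg: "0 \<le> int_dist x"
  by (simp add: int_dist_def)

lemma int_dist_le_half: "int_dist x \<le> 1 / 2"
  using of_int_round_abs_le[of x] by (simp add: int_dist_def abs_minus_commute)

lemma borel_measurable_int_dist [measurable]: "int_dist \<in> borel_measurable borel"
  unfolding int_dist_def[abs_def] round_def by measurable

text \<open>For \<open>k\<^sub>1 = n\<close>, the zero \<open>|k\<^sub>2|\<close> of \<open>L - \<kappa>\<close>.\<close>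

definition zero_freq :: "real \<Rightarrow> real \<Rightarrow> real \<Rightarrow> nat \<Rightarrow> real" where
  "zero_freq \<tau> \<nu> \<kappa> n = sqrt ((\<nu> * (real n)\<^sup>2 + \<kappa>)\<^sup>2 - (real n)\<^sup>2) / \<tau>"

text \<open>The unperturbed zero with \<tau> eliminated through \<nu>^2 = 1 + \<tau>^2, hence a
  function of the single parameter in which measure is taken.\<close>

definition critical_freq :: "nat \<Rightarrow> real \<Rightarrow> real" where
  "critical_freq n \<nu> = zero_freq (sqrt (\<nu>\<^sup>2 - 1)) \<nu> 0 n"

text \<open>In this form \<nu> occurs only in the last fraction, which for n \<ge> 2 is strictly
  decreasing in \<nu>. For n = 1 it vanishes, so the value is 1 whatever \<nu> is.\<close>

lemma critical_freq_squared:
  assumes "1 < \<nu>" "1 \<le> n"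
  shows "(critical_freq n \<nu>)\<^sup>2 = (real n)\<^sup>2 * ((real n)\<^sup>2 + ((real n)\<^sup>2 - 1) / (\<nu>\<^sup>2 - 1))"
    and "0 \<le> critical_freq n \<nu>"
proof -
  have v: "1 < \<nu>\<^sup>2" using assms by (simp add: one_less_power)
  have n: "1 \<le> (real n)\<^sup>2" using assms by (simp add: one_le_power)
  have "(real n)\<^sup>2 \<le> (\<nu> * (real n)\<^sup>2)\<^sup>2"
  proof -
    have "1 * 1 \<le> \<nu>\<^sup>2 * (real n)\<^sup>2" using v n by (intro mult_mono) auto
    then have "1 * (real n)\<^sup>2 \<le> (\<nu>\<^sup>2 * (real n)\<^sup>2) * (real n)\<^sup>2" by (intro mult_right_mono) auto
    then show ?thesis by (simp add: power_mult_distrib power2_eq_square mult_ac)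
  qed
  then have "(critical_freq n \<nu>)\<^sup>2 = ((\<nu> * (real n)\<^sup>2)\<^sup>2 - (real n)\<^sup>2) / (\<nu>\<^sup>2 - 1)"
    using v by (simp add: critical_freq_def zero_freq_def power_divide)
  also have "\<dots> = (real n)\<^sup>2 * ((real n)\<^sup>2 + ((real n)\<^sup>2 - 1) / (\<nu>\<^sup>2 - 1))"
    using v by (simp add: field_simps power_mult_distrib power2_eq_square)
  finally show "(critical_freq n \<nu>)\<^sup>2 = (real n)\<^sup>2 * ((real n)\<^sup>2 + ((real n)\<^sup>2 - 1) / (\<nu>\<^sup>2 - 1))" .
  show "0 \<le> critical_freq n \<nu>"
    using v \<open>(real n)\<^sup>2 \<le> (\<nu> * (real n)\<^sup>2)\<^sup>2\<close> by (simp add: critical_freq_def zero_freq_def)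
qed

lemma critical_freq_le:
  assumes "1 < a" "a \<le> \<nu>" "1 \<le> n"
  shows "critical_freq n \<nu> \<le> (1 + 1 / (a\<^sup>2 - 1)) * (real n)\<^sup>2"
proof -
  let ?s = "1 / (a\<^sup>2 - 1)"
  have a: "1 < a\<^sup>2" using assms by (simp add: one_less_power)
  have "a\<^sup>2 \<le> \<nu>\<^sup>2" using assms by (intro power_mono) auto
  then have "1 / (\<nu>\<^sup>2 - 1) \<le> ?s" using a by (intro divide_left_mono) auto
  moreover have n: "1 \<le> (real n)\<^sup>2" using assms by (simp add: one_le_power)
  ultimately have "((real n)\<^sup>2 - 1) * (1 / (\<nu>\<^sup>2 - 1)) \<le> (real n)\<^sup>2 * ?s"
    using a \<open>a\<^sup>2 \<le> \<nu>\<^sup>2\<close> by (intro mult_mono) auto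
  then have "(critical_freq n \<nu>)\<^sup>2 \<le> (real n)\<^sup>2 * ((real n)\<^sup>2 + (real n)\<^sup>2 * ?s)"
    using critical_freq_squared(1)[of \<nu> n] assms by (simp add: mult_left_mono)
  also have "\<dots> = (1 + ?s) * ((real n)\<^sup>2)\<^sup>2" by (simp add: power2_eq_square algebra_simps)
  also have "\<dots> \<le> (1 + ?s)\<^sup>2 * ((real n)\<^sup>2)\<^sup>2"
    using a self_le_power[of "1 + ?s" 2] by (intro mult_right_mono) auto
  finally have "(critical_freq n \<nu>)\<^sup>2 \<le> ((1 + ?s) * (real n)\<^sup>2)\<^sup>2" by (simp only: power_mult_distrib)
  then show ?thesis by (rule power2_le_imp_le) (use a in simp)
qed

text \<open>The squares differ by a multiple of n^4 (\<nu>' - \<nu>), while the two values add up to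
  O(n^2); their difference is the quotient.\<close>

lemma critical_freq_transversal:
  assumes a: "1 < a" "a \<le> \<nu>" "\<nu> \<le> \<nu>'" "\<nu>' \<le> b" and n: "2 \<le> n"
  shows "(1 / (4 * (1 + 1 / (a\<^sup>2 - 1)) * b ^ 4)) * (real n)\<^sup>2 * (\<nu>' - \<nu>) \<le> critical_freq n \<nu> - critical_freq n \<nu>'"
proof -
  let ?K = "1 + 1 / (a\<^sup>2 - 1)" and ?y = "critical_freq n \<nu>" and ?y' = "critical_freq n \<nu>'" and ?N = "(real n)\<^sup>2"
  have a2: "1 < a\<^sup>2" using a by (simp add: one_less_power)
  have v: "a\<^sup>2 \<le> \<nu>\<^sup>2" "\<nu>\<^sup>2 \<le> \<nu>'\<^sup>2" "\<nu>'\<^sup>2 \<le> b\<^sup>2" using a by (auto intro: power_mono)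
  have "(2::real)\<^sup>2 \<le> ?N" using n by (intro power_mono) auto
  then have N: "4 \<le> ?N" by simp
  have K: "?K > 0" using a2 by (simp add: add_pos_pos)
  have d0: "0 < (\<nu>\<^sup>2 - 1) * (\<nu>'\<^sup>2 - 1)" using a2 v by (intro mult_pos_pos) auto
  have db: "(\<nu>\<^sup>2 - 1) * (\<nu>'\<^sup>2 - 1) \<le> b\<^sup>2 * b\<^sup>2" using a2 v by (intro mult_mono) auto
  have "2 * (\<nu>' - \<nu>) \<le> (\<nu>' + \<nu>) * (\<nu>' - \<nu>)" using a by (intro mult_right_mono) auto
  then have sq: "\<nu>' - \<nu> \<le> \<nu>'\<^sup>2 - \<nu>\<^sup>2" using a by (simp add: power2_eq_square algebra_simps)
  have "(\<nu>' - \<nu>) / b ^ 4 \<le> (\<nu>' - \<nu>) / ((\<nu>\<^sup>2 - 1) * (\<nu>'\<^sup>2 - 1))"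
    using a d0 db by (intro divide_left_mono) (auto simp: power2_eq_square power4_eq_xxxx mult_ac)
  also have "\<dots> \<le> (\<nu>'\<^sup>2 - \<nu>\<^sup>2) / ((\<nu>\<^sup>2 - 1) * (\<nu>'\<^sup>2 - 1))"
    using sq d0 by (intro divide_right_mono) auto
  also have "\<dots> = 1 / (\<nu>\<^sup>2 - 1) - 1 / (\<nu>'\<^sup>2 - 1)"
    using a2 v by (simp add: field_simps)
  finally have D: "(\<nu>' - \<nu>) / b ^ 4 \<le> 1 / (\<nu>\<^sup>2 - 1) - 1 / (\<nu>'\<^sup>2 - 1)" .
  have "?y\<^sup>2 - ?y'\<^sup>2 = ?N * ((?N - 1) * (1 / (\<nu>\<^sup>2 - 1) - 1 / (\<nu>'\<^sup>2 - 1)))"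
    using a n by (simp add: critical_freq_squared) (simp add: algebra_simps)
  \<comment> \<open>Here n \<ge> 2 enters, through n^2 - 1 \<ge> n^2 / 2.\<close>
  also have "\<dots> \<ge> ?N * (?N / 2 * ((\<nu>' - \<nu>) / b ^ 4))"
    using N a by (intro mult_left_mono mult_mono D) (auto intro!: divide_nonneg_nonneg)
  finally have E: "?N * (?N / 2 * ((\<nu>' - \<nu>) / b ^ 4)) \<le> (?y - ?y') * (?y + ?y')"
    by (simp add: power2_eq_square algebra_simps)
  have pos: "0 < ?y" "0 \<le> ?y'" and y: "?y + ?y' \<le> 2 * ?K * ?N"
  proof -
    have "0 < ?N * (?N + (?N - 1) / (\<nu>\<^sup>2 - 1))" using N a2 v n by (intro mult_pos_pos add_pos_nonneg) auto
    then have "?y\<^sup>2 \<noteq> 0" using critical_freq_squared(1)[of \<nu> n] a n by linarith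
    then show "0 < ?y" using critical_freq_squared(2)[of \<nu> n] a n by (simp add: less_le)
    show "0 \<le> ?y'" using critical_freq_squared(2)[of \<nu>' n] a n by simp
    show "?y + ?y' \<le> 2 * ?K * ?N"
      using critical_freq_le[of a \<nu> n] critical_freq_le[of a \<nu>' n] a n unfolding mult.assoc by linarith
  qed
  have "0 \<le> (?y - ?y') * (?y + ?y')"
    by (rule order_trans[OF _ E]) (use a N in auto)
  then have "0 \<le> ?y - ?y'" using pos by (simp add: zero_le_mult_iff)
  then have "(?y - ?y') * (?y + ?y') \<le> (?y - ?y') * (2 * ?K * ?N)" using y by (rule mult_left_mono[rotated])
  with E have "?N * (?N / 2 * ((\<nu>' - \<nu>) / b ^ 4)) \<le> ?N * ((?y - ?y') * (2 * ?K))" by (simp add: mult_ac)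
  then have "?N / 2 * ((\<nu>' - \<nu>) / b ^ 4) \<le> (?y - ?y') * (2 * ?K)" using N n by (subst (asm) mult_le_cancel_left_pos) auto
  then have "?N / 2 * ((\<nu>' - \<nu>) / b ^ 4) / (2 * ?K) \<le> ?y - ?y'" using K by (subst pos_divide_le_eq) auto
  then show ?thesis by (simp add: field_simps)
qed

text \<open>Each piece lies in the interval of radius D around a chosen point of it, whence the
  length 2 D; for an empty piece the choice is arbitrary.\<close>

lemma emeasure_finite_cover_le:
  fixes S :: "real set"
  assumes I: "finite I" and S: "S \<subseteq> (\<Union>m\<in>I. A m)" and D: "0 \<le> D"
    and diam: "\<And>m x y. m \<in> I \<Longrightarrow> x \<in> A m \<Longrightarrow> y \<in> A m \<Longrightarrow> \<bar>x - y\<bar> \<le> D"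
  shows "emeasure lborel S \<le> ennreal (real (card I) * (2 * D))"
proof -
  define x where "x m = (SOME x. x \<in> A m)" for m
  have "A m \<subseteq> {x m - D..x m + D}" if "m \<in> I" for m
  proof
    fix y assume y: "y \<in> A m"
    then have "x m \<in> A m" unfolding x_def by (rule someI)
    then have "\<bar>y - x m\<bar> \<le> D" by (rule diam[OF that y])
    then show "y \<in> {x m - D..x m + D}" by (auto simp: abs_le_iff)
  qed
  then have "emeasure lborel S \<le> emeasure lborel (\<Union>m\<in>I. {x m - D..x m + D})"
    using S by (intro emeasure_mono) (blast, use I in auto)
  also have "\<dots> \<le> (\<Sum>m\<in>I. emeasure lborel {x m - D..x m + D})"
    using I by (intro emeasure_subadditive_finite) auto
  also have "\<dots> = ennreal (real (card I) * (2 * D))"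
    using D by (simp add: ennreal_mult ennreal_of_nat_eq_real_of_nat)
  finally show ?thesis .
qed

text \<open>O(n^2) integers lie within the range of \<open>critical_freq n\<close>, and by
  transversality each of them captures a parameter set of diameter O(\<delta> / n^2). The powers of
  n cancel, so C is uniform in n.\<close>

lemma emeasure_near_integer_le:
  assumes ab: "1 < a" "a \<le> b"
  obtains C where "0 \<le> C" "\<And>n \<delta>. 2 \<le> n \<Longrightarrow> 0 < \<delta> \<Longrightarrow>
    emeasure lborel {v\<in>{a..b}. int_dist (critical_freq n v) \<le> \<delta>} \<le> ennreal (C * \<delta>)"
proof -
  define K where "K = 1 + 1 / (a\<^sup>2 - 1)"
  define c where "c = 1 / (4 * K * b ^ 4)"
  have "1 < a\<^sup>2" using ab by (simp add: one_less_power)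
  then have K: "K \<ge> 1" by (simp add: K_def)
  have c: "c > 0" using K ab by (simp add: c_def)
  \<comment> \<open>The first entry serves \<delta> \<ge> 1/2, where the length of the whole
    interval suffices; the second is what the covering argument yields for \<delta> < 1/2.\<close>
  define C where "C = max (2 * (b - a)) (4 * (K + 3) / c)"
  have "emeasure lborel {v\<in>{a..b}. int_dist (critical_freq n v) \<le> \<delta>} \<le> ennreal (C * \<delta>)"
    if n: "2 \<le> n" and \<delta>: "0 < \<delta>" for n \<delta>
  proof (cases "\<delta> < 1 / 2")
    case False
    have "emeasure lborel {v\<in>{a..b}. int_dist (critical_freq n v) \<le> \<delta>} \<le> emeasure lborel {a..b}"
      by (intro emeasure_mono) auto
    also have "\<dots> = ennreal (b - a)" using ab by simp
    also have "b - a \<le> 2 * (b - a) * \<delta>" using False ab mult_left_mono[of 1 "2 * \<delta>" "b - a"] by (simp add: mult_ac)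
    also have "\<dots> \<le> C * \<delta>" unfolding C_def using \<delta> by (intro mult_right_mono) auto
    finally show ?thesis by (simp add: ennreal_leI)
  next
    case True
    define N where "N = (real n)\<^sup>2"
    have "(1::real)\<^sup>2 \<le> N" unfolding N_def using n by (intro power_mono) auto
    then have N: "1 \<le> N" by simp
    \<comment> \<open>The summand 1 allows for rounding: the nearest integer can exceed the
      frequency.\<close>
    define I where "I = {0..\<lfloor>K * N + 1\<rfloor>}"
    define A where "A m = {v\<in>{a..b}. \<bar>critical_freq n v - of_int m\<bar> \<le> \<delta>}" for m :: int
    have "{v\<in>{a..b}. int_dist (critical_freq n v) \<le> \<delta>} \<subseteq> (\<Union>m\<in>I. A m)"
    proof
      fix v assume v: "v \<in> {v\<in>{a..b}. int_dist (critical_freq n v) \<le> \<delta>}"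
      define m where "m = round (critical_freq n v)"
      have m: "\<bar>critical_freq n v - of_int m\<bar> \<le> \<delta>" using v by (simp add: int_dist_def m_def)
      have "0 \<le> critical_freq n v" "critical_freq n v \<le> K * N"
        using critical_freq_squared(2)[of v n] critical_freq_le[of a v n] v ab n by (auto simp: K_def N_def)
      then have "0 \<le> m" "m \<le> \<lfloor>K * N + 1\<rfloor>" using m True by linarith+
      then show "v \<in> (\<Union>m\<in>I. A m)" using v m by (auto simp: I_def A_def)
    qed
    moreover have "\<bar>x - y\<bar> \<le> 2 * \<delta> / (c * N)" if "x \<in> A m" "y \<in> A m" for m x y
    proof -
      have *: "c * N * (y - x) \<le> 2 * \<delta>" if "x \<in> A m" "y \<in> A m" "x \<le> y" for x y
      proof -
        have "c * N * (y - x) \<le> critical_freq n x - critical_freq n y"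
          using critical_freq_transversal[of a x y b n] that ab n by (simp add: A_def c_def K_def N_def)
        also have "\<dots> \<le> 2 * \<delta>" using that by (auto simp: A_def)
        finally show ?thesis .
      qed
      have "c * N * \<bar>x - y\<bar> \<le> 2 * \<delta>"
        using *[OF that] *[OF that(2,1)] by (cases "x \<le> y") auto
      then show ?thesis using c N by (simp add: pos_le_divide_eq mult_ac)
    qed
    ultimately have "emeasure lborel {v\<in>{a..b}. int_dist (critical_freq n v) \<le> \<delta>}
        \<le> ennreal (real (card I) * (2 * (2 * \<delta> / (c * N))))"
      using c N \<delta> by (intro emeasure_finite_cover_le) (auto simp: I_def)
    also have "real (card I) * (2 * (2 * \<delta> / (c * N))) \<le> ((K + 3) * N) * (2 * (2 * \<delta> / (c * N)))"
    proof (rule mult_right_mono)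
      have "real (card I) \<le> K * N + 2"
        using K N of_int_floor_le[of "K * N + 1"] by (simp add: I_def of_nat_nat)
      then show "real (card I) \<le> (K + 3) * N" using N by (simp add: algebra_simps)
    qed (use c N \<delta> in auto)
    also have "\<dots> = (4 * (K + 3) / c) * \<delta>" using N c by (simp add: field_simps)
    also have "\<dots> \<le> C * \<delta>" unfolding C_def using \<delta> by (intro mult_right_mono) auto
    finally show ?thesis by (simp add: ennreal_leI)
  qed
  moreover have "0 \<le> C" using ab by (simp add: C_def)
  ultimately show ?thesis using that by blast
qed

lemma borel_measurable_critical_freq [measurable]: "critical_freq n \<in> borel_measurable borel"
  unfolding critical_freq_def[abs_def] zero_freq_def by measurable

text \<open>The layer-cake bound that turns measure estimates for the sublevel sets of a distance into
  integrability of its negative powers.\<close>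

lemma powr_le_dyadic_sum:
  assumes d: "0 \<le> d" "d \<le> 1" and \<beta>: "0 < \<beta>"
    and fin: "(\<Sum>j. ennreal ((2 powr \<beta>) ^ j) * indicator {x. x \<le> (1 / 2) ^ j} d) < \<infinity>"
  shows "0 < d" and "ennreal (d powr (- \<beta>)) \<le>
    ennreal (2 powr \<beta>) * (\<Sum>j. ennreal ((2 powr \<beta>) ^ j) * indicator {x. x \<le> (1 / 2) ^ j} d)"
proof -
  let ?f = "\<lambda>j. ennreal ((2 powr \<beta>) ^ j) * indicator {x. x \<le> (1 / 2) ^ j} d"
  have z: "1 \<le> 2 powr \<beta>" using \<beta> by (simp add: ge_one_powr_ge_zero)
  show "0 < d"
  proof (rule ccontr)
    \<comment> \<open>At d = 0 all indicators are 1 and all coefficients at least 1, so the series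
      would diverge.\<close>
    assume "\<not> 0 < d"
    then have "d = 0" using d by simp
    then have "1 \<le> ?f j" for j using z by (simp add: one_le_power ennreal_ge_1)
    then have le: "of_nat N \<le> suminf ?f" for N :: nat
      using sum_mono[of "{..<N}" "\<lambda>_. 1" ?f] sum_le_suminf[of ?f "{..<N}"] by (auto intro: order_trans)
    obtain N :: nat where "suminf ?f < of_nat N" using ennreal_Ex_less_of_nat fin by auto
    with le[of N] show False by simp
  qed
  then have "0 \<le> - log 2 d" using d by simp
  \<comment> \<open>The dyadic level of d, that is 2^(-j-1) < d \<le> 2^(-j). One term of the series
    at this level dominates the power, up to the factor \<open>2 powr \<beta>\<close> for
    rounding.\<close>
  define j where "j = nat \<lfloor>- log 2 d\<rfloor>"
  have j: "real j \<le> - log 2 d" "- log 2 d < real j + 1"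
    using \<open>0 \<le> - log 2 d\<close> unfolding j_def by linarith+
  have "d = 2 powr log 2 d" using \<open>0 < d\<close> by simp
  also have "\<dots> \<le> 2 powr (- real j)" using j by simp
  also have "\<dots> = (1 / 2) ^ j" by (simp add: powr_minus_divide powr_realpow power_one_over)
  finally have dj: "d \<le> (1 / 2) ^ j" .
  have "d powr (- \<beta>) = (2 powr log 2 d) powr (- \<beta>)" using \<open>0 < d\<close> by simp
  also have "\<dots> = 2 powr (\<beta> * (- log 2 d))" unfolding powr_powr by (simp add: mult.commute)
  also have "\<dots> \<le> 2 powr (\<beta> * (real j + 1))" using j \<beta> by (intro powr_mono mult_left_mono) auto
  also have "\<dots> = 2 powr \<beta> * (2 powr \<beta>) ^ j"
    by (simp add: powr_powr distrib_left powr_add flip: powr_realpow)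
  finally have "ennreal (d powr (- \<beta>)) \<le> ennreal (2 powr \<beta>) * ennreal ((2 powr \<beta>) ^ j)"
    by (simp add: ennreal_mult[symmetric] ennreal_leI)
  also have "ennreal ((2 powr \<beta>) ^ j) = (\<Sum>j\<in>{j}. ?f j)" using dj by simp
  also have "\<dots> \<le> suminf ?f" by (intro sum_le_suminf) auto
  finally show "ennreal (d powr (- \<beta>)) \<le> ennreal (2 powr \<beta>) * suminf ?f" by (simp add: mult_left_mono)
qed

text \<open>In the dyadic series the level 2^(-j) has coefficient z^j with z = 2^(1 - h) < 2 and
  measure O(2^(-j)), so its integral is bounded uniformly in n. The weights n^(-1-h) are summable,
  hence the integral of the whole sum is finite, and so is the sum almost everywhere. Indices start
  at 2 because \<open>critical_freq 1\<close> is always 1.\<close>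

lemma AE_summable_int_dist_powr:
  assumes ab: "1 < a" "a \<le> b" and h: "0 < h" "h < 1"
  shows "AE v in lborel. v \<in> {a..b} \<longrightarrow>
    (\<forall>n. 0 < int_dist (critical_freq (n + 2) v)) \<and>
    summable (\<lambda>n. real (n + 2) powr (- (1 + h)) * int_dist (critical_freq (n + 2) v) powr (- (1 - h)))"
proof -
  define \<beta> where "\<beta> = 1 - h"
  define z where "z = 2 powr \<beta>"
  define w where "w n = real (n + 2) powr (- (1 + h))" for n
  define d where "d n v = int_dist (critical_freq (n + 2) v)" for n v
  define G where "G n v = (\<Sum>j. ennreal (z ^ j) * indicator {x. x \<le> (1 / 2) ^ j} (d n v))" for n v
  obtain C where C: "0 \<le> C" "\<And>n \<delta>. 2 \<le> n \<Longrightarrow> 0 < \<delta> \<Longrightarrow>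
      emeasure lborel {v\<in>{a..b}. int_dist (critical_freq n v) \<le> \<delta>} \<le> ennreal (C * \<delta>)"
    using emeasure_near_integer_le[OF ab] by blast
  have z: "0 < z" "z < 2"
    using h powr_less_mono[of \<beta> 1 2] by (auto simp: z_def \<beta>_def)
  have w0: "w n > 0" for n by (simp add: w_def)
  have "summable (\<lambda>n. real n powr (- (1 + h)))" using h by (simp add: summable_real_powr_iff)
  then have w: "summable w" unfolding w_def by (subst summable_iff_shift)
  have [measurable]: "d n \<in> borel_measurable borel" for n unfolding d_def by measurable
  have [measurable]: "G n \<in> borel_measurable borel" for n unfolding G_def by measurable
  have "(\<integral>\<^sup>+v. G n v * indicator {a..b} v \<partial>lborel) \<le> ennreal (C / (1 - z / 2))" for n
  proof -
    have "(\<integral>\<^sup>+v. G n v * indicator {a..b} v \<partial>lborel) =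
        (\<integral>\<^sup>+v. (\<Sum>j. ennreal (z ^ j) * indicator {v\<in>{a..b}. d n v \<le> (1 / 2) ^ j} v) \<partial>lborel)"
      unfolding G_def ennreal_suminf_multc[symmetric]
      by (intro nn_integral_cong suminf_cong) (auto simp: indicator_def)
    also have "\<dots> = (\<Sum>j. ennreal (z ^ j) * emeasure lborel {v\<in>{a..b}. d n v \<le> (1 / 2) ^ j})"
      by (subst nn_integral_suminf) (auto simp: nn_integral_cmult_indicator)
    also have "\<dots> \<le> (\<Sum>j. ennreal (C * (z / 2) ^ j))"
    proof (intro suminf_le allI)
      fix j
      have "ennreal (z ^ j) * emeasure lborel {v\<in>{a..b}. d n v \<le> (1 / 2) ^ j} \<le> ennreal (z ^ j) * ennreal (C * (1 / 2) ^ j)"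
        unfolding d_def by (intro mult_left_mono C(2)) auto
      also have "\<dots> = ennreal (C * (z / 2) ^ j)"
        using z C by (simp add: ennreal_mult[symmetric] power_divide mult_ac)
      finally show "ennreal (z ^ j) * emeasure lborel {v\<in>{a..b}. d n v \<le> (1 / 2) ^ j} \<le> ennreal (C * (z / 2) ^ j)" .
    qed auto
    also have "\<dots> = ennreal (\<Sum>j. C * (z / 2) ^ j)"
      using z C by (intro suminf_ennreal2 summable_mult summable_geometric) auto
    also have "(\<Sum>j. C * (z / 2) ^ j) = C / (1 - z / 2)"
      using z by (subst suminf_mult) (auto simp: suminf_geometric summable_geometric)
    finally show ?thesis .
  qed
  note G_le = this
  have "(\<integral>\<^sup>+v. (\<Sum>n. ennreal (w n) * G n v) * indicator {a..b} v \<partial>lborel)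
      = (\<Sum>n. ennreal (w n) * (\<integral>\<^sup>+v. G n v * indicator {a..b} v \<partial>lborel))"
    unfolding ennreal_suminf_multc[symmetric]
    by (subst nn_integral_suminf) (auto simp: nn_integral_cmult mult.assoc)
  also have "\<dots> \<le> (\<Sum>n. ennreal (w n) * ennreal (C / (1 - z / 2)))"
    by (intro suminf_le mult_left_mono G_le) auto
  also have "\<dots> = (\<Sum>n. ennreal (w n)) * ennreal (C / (1 - z / 2))" by simp
  also have "\<dots> = ennreal (suminf w) * ennreal (C / (1 - z / 2))"
    using w w0 by (subst suminf_ennreal2) (auto intro: less_imp_le)
  also have "\<dots> < \<infinity>" by (simp add: ennreal_mult_less_top)
  finally have "AE v in lborel. (\<Sum>n. ennreal (w n) * G n v) * indicator {a..b} v \<noteq> \<infinity>"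
    by (intro nn_integral_PInf_AE) auto
  then show ?thesis
  proof eventually_elim
    case (elim v)
    show ?case
    proof
      assume "v \<in> {a..b}"
      then have fin: "(\<Sum>n. ennreal (w n) * G n v) < \<infinity>" using elim by (simp add: less_top)
      have Gfin: "G n v < \<infinity>" for n
      proof (rule ccontr)
        assume "\<not> G n v < \<infinity>"
        then have "ennreal (w n) * G n v = \<infinity>" using w0[of n] by (simp add: ennreal_mult_top less_top[symmetric])
        moreover have "(\<Sum>i\<in>{n}. ennreal (w i) * G i v) \<le> (\<Sum>n. ennreal (w n) * G n v)"
          by (intro sum_le_suminf) auto
        ultimately show False using fin by simp
      qed
      have d01: "0 \<le> d n v" "d n v \<le> 1" for n
        using int_dist_nonneg int_dist_le_half[of "critical_freq (n + 2) v"] unfolding d_def by auto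
      have \<beta>: "0 < \<beta>" using h by (simp add: \<beta>_def)
      note * = powr_le_dyadic_sum[OF d01 \<beta> Gfin[unfolded G_def z_def], folded z_def, folded G_def]
      have "(\<Sum>n. ennreal (w n * d n v powr (- \<beta>))) \<le> (\<Sum>n. ennreal z * (ennreal (w n) * G n v))"
      proof (intro suminf_le allI)
        fix n
        have "ennreal (w n * d n v powr (- \<beta>)) = ennreal (w n) * ennreal (d n v powr (- \<beta>))"
          using w0 by (intro ennreal_mult) (auto intro: less_imp_le)
        also have "\<dots> \<le> ennreal (w n) * (ennreal z * G n v)" by (intro mult_left_mono *) auto
        finally show "ennreal (w n * d n v powr (- \<beta>)) \<le> ennreal z * (ennreal (w n) * G n v)"
          by (simp add: mult_ac)
      qed auto
      also have "\<dots> = ennreal z * (\<Sum>n. ennreal (w n) * G n v)" by simp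
      also have "\<dots> < \<infinity>" using fin by (simp add: ennreal_mult_less_top)
      finally have "summable (\<lambda>n. w n * d n v powr (- \<beta>))"
        by (intro summable_suminf_not_top mult_nonneg_nonneg less_imp_le[OF w0] powr_ge_zero) simp
      then show "(\<forall>n. 0 < int_dist (critical_freq (n + 2) v)) \<and>
          summable (\<lambda>n. real (n + 2) powr (- (1 + h)) * int_dist (critical_freq (n + 2) v) powr (- (1 - h)))"
        using *(1) unfolding w_def d_def \<beta>_def by blast
    qed
  qed
qed

text \<open>The first condition bounds the unperturbed divisors and gives the perturbed frequencies
  their initial distance from resonance. The second controls the measure of the excluded \<epsilon>;
  its exponent is -2 + 1/4, where n^(1/4) absorbs the logarithmic number of indices j.\<close>

definition diophantine :: "real \<Rightarrow> real \<Rightarrow> bool" where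
  "diophantine \<alpha> v \<longleftrightarrow>
     (\<exists>c>0. \<forall>n\<ge>2. c * real n powr (- (1 + \<alpha>)) \<le> int_dist (critical_freq n v)) \<and>
     summable (\<lambda>n. real (n + 2) powr (- 7 / 4) / int_dist (critical_freq (n + 2) v))"

text \<open>With h = \<alpha>/4, boundedness of the terms gives d \<ge> c n^(-(1+h)/(1-h)), and
  (1+h)/(1-h) \<le> 1 + \<alpha>. Then 1/d is split into d^(-(1-h)) and d^(-h); the second factor is
  estimated by that lower bound, and the first leaves the given series.\<close>

lemma diophantineI:
  assumes \<alpha>: "0 < \<alpha>" "\<alpha> \<le> 1" and pos: "\<And>n. 0 < int_dist (critical_freq (n + 2) v)"
    and summ: "summable (\<lambda>n. real (n + 2) powr (- (1 + \<alpha> / 4)) *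
      int_dist (critical_freq (n + 2) v) powr (- (1 - \<alpha> / 4)))"
  shows "diophantine \<alpha> v"
proof -
  define d where "d n = int_dist (critical_freq n v)" for n
  define h where "h = \<alpha> / 4"
  define f where "f n = real (n + 2) powr (- (1 + h)) * d (n + 2) powr (- (1 - h))" for n
  have h: "0 < h" "h \<le> 1 / 4" "\<alpha> = 4 * h" using \<alpha> by (auto simp: h_def)
  have f: "summable f" using summ unfolding f_def[abs_def] d_def h_def .
  have d: "0 < d (n + 2)" for n using pos by (simp add: d_def)
  have f0: "0 < f n" for n using d[of n] by (simp add: f_def)
  obtain B where B: "\<And>n. f n \<le> B" "1 \<le> B"
  proof -
    have "Bseq f" using f by (simp add: summable_imp_Bseq)
    then obtain K where "\<And>n. norm (f n) \<le> K" by (rule BseqE) blast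
    then have "f n \<le> max K 1" for n by (metis abs_le_D1 max.coboundedI1 real_norm_def)
    then show ?thesis using that[of "max K 1"] by simp
  qed
  \<comment> \<open>Obtained by solving n^(-(1+h)) d^(-(1-h)) \<le> B for d.\<close>
  define c where "c = B powr (- 1 / (1 - h))"
  have c: "0 < c" using B by (simp add: c_def)
  have lower: "c * real (n + 2) powr (- (1 + \<alpha>)) \<le> d (n + 2)" for n
  proof -
    let ?x = "real (n + 2)"
    have "?x powr (- (1 + h)) * ?x powr (1 + h) = 1" unfolding powr_add[symmetric] by simp
    moreover have "f n * ?x powr (1 + h) = ?x powr (- (1 + h)) * ?x powr (1 + h) * d (n + 2) powr (- (1 - h))"
      by (simp only: f_def mult_ac)
    ultimately have "d (n + 2) powr (- (1 - h)) = f n * ?x powr (1 + h)" by (simp only: mult_1)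
    also have "\<dots> \<le> B * ?x powr (1 + h)" by (intro mult_right_mono B) auto
    finally have "(B * ?x powr (1 + h)) powr (- 1 / (1 - h)) \<le> (d (n + 2) powr (- (1 - h))) powr (- 1 / (1 - h))"
      using d[of n] h by (intro powr_mono2') (auto simp: divide_simps)
    also have "\<dots> = d (n + 2) powr 1"
      unfolding powr_powr by (rule arg_cong[of _ _ "\<lambda>x. d (n + 2) powr x"]) (use h in \<open>simp add: field_simps\<close>)
    also have "\<dots> = d (n + 2)" using d[of n] by simp
    finally have "c * ?x powr ((1 + h) * (- 1 / (1 - h))) \<le> d (n + 2)"
      using B by (simp only: c_def powr_mult powr_powr)
    moreover have "- (1 + \<alpha>) \<le> (1 + h) * (- 1 / (1 - h))"
    proof -
      have "h * h \<le> h * (1 / 4)" using h by (intro mult_left_mono) auto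
      then have "1 + h \<le> (1 + \<alpha>) * (1 - h)" using h by (simp add: algebra_simps)
      then have "(1 + h) / (1 - h) \<le> 1 + \<alpha>" using h by (subst pos_divide_le_eq) auto
      then show ?thesis by simp
    qed
    then have "c * ?x powr (- (1 + \<alpha>)) \<le> c * ?x powr ((1 + h) * (- 1 / (1 - h)))"
      using c by (intro mult_left_mono powr_mono) auto
    ultimately show ?thesis by linarith
  qed
  have le: "norm (real (n + 2) powr (- 7 / 4) / d (n + 2)) \<le> c powr (- h) * f n" for n
  proof -
    let ?x = "real (n + 2)"
    have x: "?x \<ge> 1" by simp
    have "1 / d (n + 2) = d (n + 2) powr (- (1 - h) + - h)"
      using d[of n] by (simp add: powr_neg_one)
    also have "\<dots> = d (n + 2) powr (- (1 - h)) * d (n + 2) powr (- h)" by (rule powr_add)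
    also have "\<dots> \<le> d (n + 2) powr (- (1 - h)) * (c * ?x powr (- (1 + \<alpha>))) powr (- h)"
      using c h lower[of n] by (intro mult_left_mono powr_mono2') auto
    also have "\<dots> = d (n + 2) powr (- (1 - h)) * (c powr (- h) * ?x powr ((1 + \<alpha>) * h))"
      by (simp only: powr_mult powr_powr mult_minus_left mult_minus_right minus_minus)
    finally have "?x powr (- 7 / 4) * (1 / d (n + 2)) \<le>
        ?x powr (- 7 / 4) * (d (n + 2) powr (- (1 - h)) * (c powr (- h) * ?x powr ((1 + \<alpha>) * h)))"
      by (intro mult_left_mono) auto
    also have "\<dots> = c powr (- h) * d (n + 2) powr (- (1 - h)) * ?x powr (- 7 / 4 + (1 + \<alpha>) * h)"
      unfolding powr_add by (simp add: mult_ac)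
    also have "\<dots> \<le> c powr (- h) * d (n + 2) powr (- (1 - h)) * ?x powr (- (1 + h))"
    proof (intro mult_left_mono powr_mono x)
      \<comment> \<open>Since \<alpha> = 4 h, the claim amounts to 4 h^2 + 2 h \<le> 3/4, with
        equality at h = 1/4.\<close>
      have "h * h \<le> 1 / 4 * (1 / 4)" using h by (intro mult_mono) auto
      then show "- 7 / 4 + (1 + \<alpha>) * h \<le> - (1 + h)" using h by (simp add: algebra_simps)
    qed (use c d[of n] in auto)
    finally have "?x powr (- 7 / 4) * (1 / d (n + 2)) \<le> c powr (- h) * f n"
      by (simp only: f_def mult_ac)
    moreover have "0 \<le> ?x powr (- 7 / 4) * (1 / d (n + 2))" using d[of n] by simp
    ultimately show ?thesis by (simp only: real_norm_def abs_of_nonneg times_divide_eq_right mult_1_right)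
  qed
  have "summable (\<lambda>n. real (n + 2) powr (- 7 / 4) / d (n + 2))"
    by (rule summable_comparison_test'[OF summable_mult[OF f], of 0, OF le])
  moreover have "c * real n powr (- (1 + \<alpha>)) \<le> d n" if "2 \<le> n" for n
    using lower[of "n - 2"] that by (simp only: le_add_diff_inverse2)
  ultimately show ?thesis using c unfolding diophantine_def d_def by blast
qed

text \<open>The half-line is exhausted by countably many compact intervals that avoid 1, where the
  constants degenerate.\<close>

lemma AE_diophantine:
  assumes \<alpha>: "0 < \<alpha>" "\<alpha> \<le> 1"
  shows "AE v in lborel. 1 < v \<longrightarrow> diophantine \<alpha> v"
proof -
  have "AE v in lborel. v \<in> {1 + 1 / real (Suc k)..real (Suc k) + 1} \<longrightarrow> diophantine \<alpha> v" for k
  proof -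
    have "1 / real (Suc k) \<le> real (Suc k)" by (rule order_trans[of _ 1]) auto
    then have "1 < 1 + 1 / real (Suc k)" "1 + 1 / real (Suc k) \<le> real (Suc k) + 1" by simp_all
    have "0 < \<alpha> / 4" "\<alpha> / 4 < 1" using \<alpha> by auto
    from AE_summable_int_dist_powr[OF \<open>1 < 1 + 1 / real (Suc k)\<close> \<open>1 + 1 / real (Suc k) \<le> real (Suc k) + 1\<close> this]
    show ?thesis by eventually_elim (blast intro: diophantineI[OF \<alpha>])
  qed
  then have "AE v in lborel. \<forall>k. v \<in> {1 + 1 / real (Suc k)..real (Suc k) + 1} \<longrightarrow> diophantine \<alpha> v"
    by (subst AE_all_countable) blast
  then show ?thesis
  proof eventually_elim
    case (elim v)
    show ?case
    proof
      assume "1 < v"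
      obtain k where k: "max v (1 / (v - 1)) \<le> real k" using real_arch_simple by blast
      then have "1 / (v - 1) \<le> real (Suc k)" "v \<le> real (Suc k) + 1" by auto
      then have "1 + 1 / real (Suc k) \<le> v" using \<open>1 < v\<close> by (simp add: field_simps)
      then show "diophantine \<alpha> v" using elim \<open>v \<le> real (Suc k) + 1\<close> by auto
    qed
  qed
qed

section \<open>Small divisors along the perturbed parameters\<close>

lemma nu0_gt_1: "0 < \<tau> \<Longrightarrow> 1 < nu0 \<tau>"
  by (simp add: nu0_def)

text \<open>In terms of x = \<open>nu0 \<tau>\<close> > 1, the square x^3 (x - 1)^2 / 4 is split
  off. The remaining terms exceed 1/4 + 5/8 - 9/16 > 0.\<close>

lemma nu1_pos:
  assumes "0 < \<tau>"
  shows "0 < nu1 \<tau>"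
proof -
  define x where "x = nu0 \<tau>"
  have x: "1 < x" using nu0_gt_1[OF assms] by (simp add: x_def)
  have "9 / (16 * (2 - 1 / x)) \<le> 9 / 16" using x by (simp add: field_simps)
  moreover have "nu1 \<tau> = x ^ 5 / 4 - x ^ 4 / 2 + x ^ 3 / 2 + 7 / 8 * x ^ 2 - x / 4 - 9 / (16 * (2 - 1 / x))"
    by (simp add: nu1_def x_def[symmetric] Let_def power_one_over)
  moreover have "x ^ 5 / 4 - x ^ 4 / 2 + x ^ 3 / 4 = x ^ 3 * (x - 1)\<^sup>2 / 4"
    by (simp add: power2_eq_square algebra_simps eval_nat_numeral)
  moreover have "0 \<le> x ^ 3 * (x - 1)\<^sup>2 / 4" using x by simp
  moreover have "1 \<le> x ^ 3" using x by (simp add: one_le_power)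
  moreover have "x \<le> x ^ 2" using x self_le_power[of x 2] by simp
  ultimately show ?thesis using x by linarith
qed

section \<open>From distance to resonance to a lower bound for the symbol\<close>

text \<open>A \<ge> a n^2 \<ge> a n keeps A above n by a fixed factor, so A and the root are
  comparable. The constant is their ratio at A = a n, the worst case.\<close>

lemma sqrt_shifted_square_bounds:
  fixes a :: real
  assumes a: "1 < a" and n: "1 \<le> n" and A: "a * n\<^sup>2 \<le> A"
  shows "0 \<le> A" "n \<le> A" "sqrt (A\<^sup>2 - n\<^sup>2) \<le> A" "A \<le> a / sqrt (a\<^sup>2 - 1) * sqrt (A\<^sup>2 - n\<^sup>2)"
proof -
  have a2: "1 < a\<^sup>2" using a by (simp add: one_less_power)
  have "n * 1 \<le> n * n" using n by (intro mult_left_mono) auto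
  then have "a * n \<le> a * n\<^sup>2" using a by (simp add: power2_eq_square)
  then have an: "a * n \<le> A" using A by simp
  moreover have "n \<le> a * n" using a n by simp
  ultimately show nA: "n \<le> A" "0 \<le> A" using n by linarith+
  show "sqrt (A\<^sup>2 - n\<^sup>2) \<le> A" using nA by (intro real_le_lsqrt) (auto simp: power_mono)
  have "(a * n)\<^sup>2 \<le> A\<^sup>2" using an a n by (intro power_mono) auto
  then have "(a\<^sup>2 - 1) * A\<^sup>2 \<le> a\<^sup>2 * (A\<^sup>2 - n\<^sup>2)" by (simp add: algebra_simps)
  then have "sqrt ((a\<^sup>2 - 1) * A\<^sup>2) \<le> sqrt (a\<^sup>2 * (A\<^sup>2 - n\<^sup>2))" by (rule real_sqrt_le_mono)
  then have "sqrt (a\<^sup>2 - 1) * A \<le> a * sqrt (A\<^sup>2 - n\<^sup>2)" using a nA by (simp add: real_sqrt_mult)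
  then show "A \<le> a / sqrt (a\<^sup>2 - 1) * sqrt (A\<^sup>2 - n\<^sup>2)" using a2 by (simp add: field_simps)
qed

text \<open>With S and T the two roots, (S - T)(S + T) = (A - B)(A + B), and the sums S + T and A +
  B are comparable by the previous lemma.\<close>

lemma sqrt_shifted_square_bilipschitz:
  fixes a :: real
  assumes a: "1 < a" and n: "1 \<le> n" and A: "a * n\<^sup>2 \<le> A" and B: "a * n\<^sup>2 \<le> B"
  shows "\<bar>A - B\<bar> \<le> \<bar>sqrt (A\<^sup>2 - n\<^sup>2) - sqrt (B\<^sup>2 - n\<^sup>2)\<bar>"
    and "\<bar>sqrt (A\<^sup>2 - n\<^sup>2) - sqrt (B\<^sup>2 - n\<^sup>2)\<bar> \<le> a / sqrt (a\<^sup>2 - 1) * \<bar>A - B\<bar>"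
proof -
  let ?S = "sqrt (A\<^sup>2 - n\<^sup>2)" and ?T = "sqrt (B\<^sup>2 - n\<^sup>2)" and ?K = "a / sqrt (a\<^sup>2 - 1)"
  note bA = sqrt_shifted_square_bounds[OF a n A] and bB = sqrt_shifted_square_bounds[OF a n B]
  have a2: "1 < a\<^sup>2" using a by (simp add: one_less_power)
  have AB: "0 < A + B" using bA bB n by linarith
  have K: "0 < ?K" using a a2 by simp
  have KST: "A + B \<le> ?K * (?S + ?T)" using bA(4) bB(4) unfolding distrib_left by (rule add_mono)
  have ST: "0 < ?S + ?T"
    by (rule zero_less_mult_pos[OF less_le_trans[OF AB KST] K])
  have "n\<^sup>2 \<le> A\<^sup>2" "n\<^sup>2 \<le> B\<^sup>2" using bA bB n by (auto intro: power_mono)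
  then have "(?S - ?T) * (?S + ?T) = (A - B) * (A + B)"
    by (simp add: algebra_simps flip: power2_eq_square)
  then have "\<bar>?S - ?T\<bar> * \<bar>?S + ?T\<bar> = \<bar>A - B\<bar> * \<bar>A + B\<bar>" by (metis abs_mult)
  then have eq: "\<bar>?S - ?T\<bar> * (?S + ?T) = \<bar>A - B\<bar> * (A + B)" using AB ST by simp
  have "\<bar>A - B\<bar> * (A + B) \<le> \<bar>?S - ?T\<bar> * (A + B)"
    unfolding eq[symmetric] using bA bB by (intro mult_left_mono) auto
  then show "\<bar>A - B\<bar> \<le> \<bar>?S - ?T\<bar>" using AB by simp
  have "\<bar>?S - ?T\<bar> * (?S + ?T) \<le> \<bar>A - B\<bar> * (?K * (?S + ?T))"
    unfolding eq using KST by (intro mult_left_mono) auto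
  then have "\<bar>?S - ?T\<bar> * (?S + ?T) \<le> (?K * \<bar>A - B\<bar>) * (?S + ?T)" by (simp only: mult_ac)
  then show "\<bar>?S - ?T\<bar> \<le> ?K * \<bar>A - B\<bar>" using ST by (rule mult_right_le_imp_le)
qed

text \<open>Being a function of these four arguments alone, the constant is visibly independent of
  \<nu>, \<kappa> and k. The outer \<open>\<tau> / 2\<close> serves k1 = 0; in the inner minimum,
  1/2 serves frequencies far from resonance and the other entry those near it.\<close>

definition symbol_const :: "real \<Rightarrow> real \<Rightarrow> real \<Rightarrow> real \<Rightarrow> real" where
  "symbol_const \<tau> a \<gamma> p = (let K = a / sqrt (a\<^sup>2 - 1) in
     min (\<tau> / 2) (\<tau> / (2 * K) * min (1 / 2) (\<gamma> * (K * \<tau>) powr (- (p / 2)))))"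

lemma symbol_const_pos:
  assumes "0 < \<tau>" "1 < a" "0 < \<gamma>"
  shows "0 < symbol_const \<tau> a \<gamma> p"
proof -
  have "1 < a\<^sup>2" using assms by (simp add: one_less_power)
  define K where "K = a / sqrt (a\<^sup>2 - 1)"
  have "0 < K" using \<open>1 < a\<^sup>2\<close> assms by (simp add: K_def)
  then show ?thesis using assms by (simp add: symbol_const_def Let_def flip: K_def)
qed

text \<open>For k1 = 0 the symbol is \<tau> |k2| \<ge> \<tau>, and \<kappa> removes at most half of
  it. Otherwise write n = |k1|, m = |k2|, B = \<nu> n^2 + \<kappa>, S for the root of B^2 - n^2 and
  Q for that of n^2 + \<tau>^2 m^2. Then (Q - B)(Q + B) = (\<tau> m - S)(\<tau> m + S), and the two
  sums are comparable, so |Q - B| dominates the distance of m to the zero y = S / \<tau>. Near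
  resonance m is close to y, which is at least of order n^2: this turns n^(-p) into a bound with
  |k|^(-p/2), halving the loss.\<close>

lemma symbol_lower_bound:
  assumes \<tau>: "0 < \<tau>" and a: "1 < a" and p: "0 \<le> p"
    and k: "k \<noteq> (0, 0)" and \<kappa>: "\<bar>\<kappa>\<bar> \<le> \<tau> / 2"
    and A: "fst k \<noteq> 0 \<Longrightarrow> a * (of_int (fst k))\<^sup>2 \<le> \<nu> * (of_int (fst k))\<^sup>2 + \<kappa>"
    and \<gamma>: "0 < \<gamma>"
    and dist: "fst k \<noteq> 0 \<Longrightarrow> \<gamma> * \<bar>of_int (fst k)\<bar> powr (- p)
      \<le> \<bar>zero_freq \<tau> \<nu> \<kappa> (nat \<bar>fst k\<bar>) - \<bar>of_int (snd k)\<bar>\<bar>"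
  shows "symbol_const \<tau> a \<gamma> p * (1 + freq_norm k) powr (- (p / 2)) \<le> \<bar>L_symbol \<nu> \<tau> k - \<kappa>\<bar>"
proof -
  define K where "K = a / sqrt (a\<^sup>2 - 1)"
  have a2: "1 < a\<^sup>2" using a by (simp add: one_less_power)
  have "sqrt (a\<^sup>2 - 1) \<le> a" using a by (intro real_le_lsqrt) auto
  then have K: "1 \<le> K" using a2 by (simp add: K_def)
  define e where "e = min (1 / 2) (\<gamma> * (K * \<tau>) powr (- (p / 2)))"
  have e: "0 < e" using \<gamma> K \<tau> by (simp add: e_def)
  define c where "c = min (\<tau> / 2) (\<tau> / (2 * K) * e)"
  have c_alt: "symbol_const \<tau> a \<gamma> p = c"
    by (simp only: c_def symbol_const_def K_def e_def Let_def)
  define F where "F = 1 + freq_norm k"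
  have F: "1 \<le> F" using freq_norm_nonneg by (simp add: F_def)
  have Fp: "F powr (- (p / 2)) \<le> 1" using F p powr_mono[of "- (p / 2)" 0 F] by simp
  define m where "m = \<bar>of_int (snd k) :: real\<bar>"
  have m: "0 \<le> m" "m \<le> freq_norm k" by (auto simp: m_def freq_norm_def intro: real_le_rsqrt)
  show ?thesis
  proof (cases "fst k = 0")
    case True
    then have "snd k \<noteq> 0" using k by (cases k) auto
    then have "1 \<le> m" by (simp add: m_def flip: of_int_abs)
    then have "\<tau> * 1 \<le> \<tau> * m" using \<tau> by (intro mult_left_mono) auto
    moreover have "L_symbol \<nu> \<tau> k = \<tau> * m"
      using True \<tau> by (simp add: L_symbol_def m_def real_sqrt_mult)
    ultimately have "\<tau> / 2 \<le> \<bar>L_symbol \<nu> \<tau> k - \<kappa>\<bar>" using \<kappa> by linarith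
    moreover have "c * F powr (- (p / 2)) \<le> \<tau> / 2 * 1"
      using Fp \<tau> by (intro mult_mono) (auto simp: c_def)
    ultimately show ?thesis by (simp add: F_def c_alt)
  next
    case False
    define n where "n = \<bar>of_int (fst k) :: real\<bar>"
    define B where "B = \<nu> * n\<^sup>2 + \<kappa>"
    define S where "S = sqrt (B\<^sup>2 - n\<^sup>2)"
    define Q where "Q = sqrt (n\<^sup>2 + \<tau>\<^sup>2 * m\<^sup>2)"
    define y where "y = S / \<tau>"
    have n: "1 \<le> n" using False by (simp add: n_def flip: of_int_abs)
    have aB: "a * n\<^sup>2 \<le> B" using A[OF False] by (simp add: n_def B_def)
    have zf: "zero_freq \<tau> \<nu> \<kappa> (nat \<bar>fst k\<bar>) = y"
      by (simp add: zero_freq_def y_def S_def B_def n_def)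
    have L: "L_symbol \<nu> \<tau> k - \<kappa> = Q - B"
      by (simp add: L_symbol_def Q_def B_def n_def m_def)
    note b = sqrt_shifted_square_bounds[OF a n aB, folded S_def K_def]
    have nB: "n\<^sup>2 \<le> B\<^sup>2" using b(2) n by (intro power_mono) auto
    then have "0 \<le> S" by (simp add: S_def)
    from nB have "(Q - B) * (Q + B) = (\<tau> * m - S) * (\<tau> * m + S)"
      by (simp add: Q_def S_def algebra_simps flip: power2_eq_square)
    then have "\<bar>Q - B\<bar> * \<bar>Q + B\<bar> = \<bar>\<tau> * m - S\<bar> * \<bar>\<tau> * m + S\<bar>" by (metis abs_mult)
    moreover have Q0: "0 \<le> Q" by (simp add: Q_def)
    moreover have tm: "0 \<le> \<tau> * m" using \<tau> m by simp
    ultimately have eq: "\<bar>Q - B\<bar> * (Q + B) = \<bar>\<tau> * m - S\<bar> * (\<tau> * m + S)" using b(1) \<open>0 \<le> S\<close> by simp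
    have "Q \<le> n + \<tau> * m"
    proof -
      have "0 \<le> n * (\<tau> * m)" using n tm by simp
      then have "n\<^sup>2 + \<tau>\<^sup>2 * m\<^sup>2 \<le> (n + \<tau> * m)\<^sup>2" by (simp add: power2_eq_square algebra_simps)
      then show ?thesis unfolding Q_def using n tm by (intro real_le_lsqrt) auto
    qed
    then have "Q + B \<le> 2 * B + \<tau> * m" using b(2) by linarith
    also have "\<dots> \<le> 2 * (K * S) + 2 * (K * (\<tau> * m))"
      using b(4) mult_right_mono[OF K tm] tm by linarith
    finally have "Q + B \<le> 2 * K * (\<tau> * m + S)" by (simp add: algebra_simps)
    then have "\<bar>Q - B\<bar> * (Q + B) \<le> \<bar>Q - B\<bar> * (2 * K * (\<tau> * m + S))" by (intro mult_left_mono) auto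
    then have "\<bar>\<tau> * m - S\<bar> * (\<tau> * m + S) \<le> (\<bar>Q - B\<bar> * (2 * K)) * (\<tau> * m + S)"
      unfolding eq by (simp only: mult_ac)
    moreover have "0 < S"
    proof (rule ccontr)
      assume "\<not> 0 < S"
      then have "S = 0" using \<open>0 \<le> S\<close> by simp
      then show False using b(2,4) n by simp
    qed
    ultimately have "\<bar>\<tau> * m - S\<bar> \<le> \<bar>Q - B\<bar> * (2 * K)" using tm by (simp add: mult_le_cancel_right)
    moreover have "\<bar>\<tau> * m - S\<bar> = \<tau> * \<bar>y - m\<bar>"
    proof -
      have "\<tau> * m - S = \<tau> * (m - y)" using \<tau> by (simp add: y_def right_diff_distrib)
      then show ?thesis using \<tau> by (simp add: abs_mult abs_minus_commute)
    qed
    ultimately have main: "\<tau> / (2 * K) * \<bar>y - m\<bar> \<le> \<bar>Q - B\<bar>" using K by (simp add: field_simps)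
    have "e * F powr (- (p / 2)) \<le> \<bar>y - m\<bar>"
    proof (cases "1 / 2 \<le> \<bar>y - m\<bar>")
      case True
      have "e * F powr (- (p / 2)) \<le> 1 / 2 * 1" using Fp by (intro mult_mono) (auto simp: e_def)
      then show ?thesis using True by simp
    next
      \<comment> \<open>Only in this case is the hypothesis on the distance used; m is within 1/2 of
        y, hence n^2 is at most a multiple of 1 + |k|.\<close>
      case near: False
      have "1 * n\<^sup>2 \<le> a * n\<^sup>2" using a by (intro mult_right_mono) auto
      then have "n\<^sup>2 \<le> K * S" using aB b(4) by linarith
      also have "\<dots> = K * \<tau> * y" using \<tau> by (simp add: y_def)
      also have "\<dots> \<le> K * \<tau> * F"
      proof (rule mult_left_mono)
        show "y \<le> F" using near m unfolding F_def by linarith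
      qed (use K \<tau> in simp)
      finally have "(K * \<tau> * F) powr (- (p / 2)) \<le> (n\<^sup>2) powr (- (p / 2))"
        using n p by (intro powr_mono2') auto
      also have "(n\<^sup>2) powr (- (p / 2)) = n powr (- p)"
        using n by (simp add: powr_powr flip: powr_numeral)
      finally have "\<gamma> * (K * \<tau> * F) powr (- (p / 2)) \<le> \<gamma> * n powr (- p)" using \<gamma> by simp
      also have "\<dots> \<le> \<bar>y - m\<bar>" using dist[OF False] by (simp add: zf n_def m_def)
      finally have "\<gamma> * (K * \<tau>) powr (- (p / 2)) * F powr (- (p / 2)) \<le> \<bar>y - m\<bar>"
        using K \<tau> F by (simp add: powr_mult)
      moreover have "e * F powr (- (p / 2)) \<le> \<gamma> * (K * \<tau>) powr (- (p / 2)) * F powr (- (p / 2))"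
        by (intro mult_right_mono) (auto simp: e_def)
      ultimately show ?thesis by simp
    qed
    then have "\<tau> / (2 * K) * (e * F powr (- (p / 2))) \<le> \<tau> / (2 * K) * \<bar>y - m\<bar>"
      using \<tau> K by (intro mult_left_mono) auto
    moreover have "c * F powr (- (p / 2)) \<le> \<tau> / (2 * K) * e * F powr (- (p / 2))"
      by (intro mult_right_mono) (auto simp: c_def)
    ultimately show ?thesis using main unfolding L F_def c_alt by (simp add: mult.assoc)
  qed
qed

text \<open>Bounds the number J of indices j that need separate treatment: a tail of size n^2 2^(-J)
  must fall below a multiple of n^(-2), so J is logarithmic in n. A fourth root of n is a cruder
  bound that still leaves a convergent series.\<close>

lemma dyadic_exponent_exists:
  obtains D where "0 < D" "\<And>n. 1 \<le> n \<Longrightarrow> \<exists>J\<ge>1. C * real n ^ 4 \<le> 2 ^ J \<and> real J \<le> D * real n powr (1 / 4)"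
proof -
  define b where "b = log 2 (max 1 C)"
  have b: "0 \<le> b" by (simp add: b_def)
  \<comment> \<open>With x = n^(1/4), 4 log2 n = 16 ln x / ln 2 \<le> 16 x / ln 2; the 2 pays for
    the ceiling and for the added 1 in J.\<close>
  define D where "D = b + 2 + 16 / ln 2"
  have "\<exists>J\<ge>1. C * real n ^ 4 \<le> 2 ^ J \<and> real J \<le> D * real n powr (1 / 4)" if n: "1 \<le> n" for n
  proof -
    define x where "x = real n powr (1 / 4)"
    have x: "1 \<le> x" using n by (simp add: x_def ge_one_powr_ge_zero)
    have "ln (real n) = 4 * ln x" using n by (simp add: x_def ln_powr)
    also have "\<dots> \<le> 4 * x" using ln_le_minus_one[of x] x by simp
    finally have "log 2 (real n) \<le> 4 * x / ln 2" by (simp add: log_def divide_right_mono)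
    define J where "J = nat \<lceil>b + 4 * log 2 (real n)\<rceil> + 1"
    have l: "0 \<le> b + 4 * log 2 (real n)" using b n by simp
    then have J: "b + 4 * log 2 (real n) \<le> real J" "real J \<le> b + 4 * log 2 (real n) + 2"
      unfolding J_def by linarith+
    have "max 1 C * real n ^ 4 = 2 powr (b + 4 * log 2 (real n))"
      using n by (simp add: b_def powr_add mult.commute[of 4] powr_powr[symmetric])
    also have "\<dots> \<le> 2 powr real J" using J by simp
    finally have "max 1 C * real n ^ 4 \<le> 2 ^ J" by (simp add: powr_realpow)
    moreover have "C * real n ^ 4 \<le> max 1 C * real n ^ 4" by (intro mult_right_mono) auto
    ultimately have 1: "C * real n ^ 4 \<le> 2 ^ J" by simp
    have "real J \<le> b * x + 2 * x + 16 / ln 2 * x"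
      using J(2) \<open>log 2 (real n) \<le> 4 * x / ln 2\<close> mult_left_mono[OF x b] x by simp
    then have "real J \<le> D * x" by (simp add: D_def algebra_simps)
    then show ?thesis using 1 unfolding x_def by (intro exI[of _ J]) (auto simp: J_def)
  qed
  moreover have "0 < D" using b by (simp add: D_def add_nonneg_pos)
  ultimately show ?thesis using that by blast
qed

text \<open>The measure t dt on the half-line: \<open>ennreal\<close> sends negative t to density
  0.\<close>

definition linear_density :: "real measure" where
  "linear_density = density lborel ennreal"

lemma sets_linear_density [simp, measurable_cong]: "sets linear_density = sets borel"
  by (simp add: linear_density_def)

lemma emeasure_linear_density_Icc:
  assumes "0 \<le> a" "a \<le> b"
  shows "emeasure linear_density {a..b} = ennreal ((b\<^sup>2 - a\<^sup>2) / 2)"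
proof -
  have "emeasure linear_density {a..b} = (\<integral>\<^sup>+x. ennreal x * indicator {a..b} x \<partial>lborel)"
    unfolding linear_density_def by (subst emeasure_density) auto
  also have "\<dots> = ennreal (b\<^sup>2 / 2 - a\<^sup>2 / 2)"
    using assms by (intro nn_integral_FTC_Icc) (auto intro!: derivative_eq_intros)
  finally show ?thesis by (simp add: diff_divide_distrib)
qed

text \<open>The measure t dt is half of Lebesgue measure in the variable t^2, so diameters are taken
  in t^2 and an interval of radius D there costs D.\<close>

lemma emeasure_linear_density_cover_le:
  fixes S :: "real set"
  assumes I: "finite I" and S: "S \<subseteq> (\<Union>m\<in>I. A m)" and D: "0 \<le> D"
    and pos: "\<And>m x. m \<in> I \<Longrightarrow> x \<in> A m \<Longrightarrow> 0 \<le> x"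
    and diam: "\<And>m x y. m \<in> I \<Longrightarrow> x \<in> A m \<Longrightarrow> y \<in> A m \<Longrightarrow> \<bar>x\<^sup>2 - y\<^sup>2\<bar> \<le> D"
  shows "emeasure linear_density S \<le> ennreal (real (card I) * D)"
proof -
  define x where "x m = (SOME x. x \<in> A m)" for m
  \<comment> \<open>The truncation at 0 keeps the root meaningful when the interval in t^2 would
    reach below 0.\<close>
  define l where "l m = sqrt (max 0 ((x m)\<^sup>2 - D))" for m
  define u where "u m = sqrt ((x m)\<^sup>2 + D)" for m
  have "A m \<subseteq> {l m..u m}" if "m \<in> I" for m
  proof
    fix y assume y: "y \<in> A m"
    then have "x m \<in> A m" unfolding x_def by (rule someI)
    then have "\<bar>y\<^sup>2 - (x m)\<^sup>2\<bar> \<le> D" by (rule diam[OF that y])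
    then show "y \<in> {l m..u m}"
      using pos[OF that y] by (auto simp: l_def u_def intro!: real_le_lsqrt real_le_rsqrt)
  qed
  then have "emeasure linear_density S \<le> emeasure linear_density (\<Union>m\<in>I. {l m..u m})"
    using S by (intro emeasure_mono) (blast, use I in auto)
  also have "\<dots> \<le> (\<Sum>m\<in>I. emeasure linear_density {l m..u m})"
    using I by (intro emeasure_subadditive_finite) auto
  also have "\<dots> \<le> (\<Sum>m\<in>I. ennreal D)"
  proof (rule sum_mono)
    fix m
    have "max 0 ((x m)\<^sup>2 - D) \<le> (x m)\<^sup>2 + D" using D by (auto simp: add_nonneg_nonneg)
    then have "emeasure linear_density {l m..u m} = ennreal (((u m)\<^sup>2 - (l m)\<^sup>2) / 2)"
      by (intro emeasure_linear_density_Icc) (auto simp: l_def u_def)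
    also have "((u m)\<^sup>2 - (l m)\<^sup>2) / 2 \<le> D" using D by (simp add: u_def l_def max_def)
    finally show "emeasure linear_density {l m..u m} \<le> ennreal D" by (simp add: ennreal_leI)
  qed
  also have "\<dots> = ennreal (real (card I) * D)"
    using D by (simp add: ennreal_mult ennreal_of_nat_eq_real_of_nat)
  finally show ?thesis .
qed

lemma integral_linear_density:
  assumes S: "S \<in> sets borel" "S \<subseteq> {0..b}" "0 \<le> b"
  shows "(LINT t:S|lebesgue. t) = measure linear_density S"
proof -
  have "(LINT t:S|lebesgue. t) = (LINT t|lborel. indicator S t *\<^sub>R t)"
    unfolding set_lebesgue_integral_def using S(1)
    by (intro integral_completion borel_measurable_scaleR borel_measurable_indicator) auto
  also have "\<dots> = enn2real (\<integral>\<^sup>+t. ennreal (indicator S t *\<^sub>R t) \<partial>lborel)"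
    using S by (intro integral_eq_nn_integral AE_I2) (auto simp: indicator_def)
  also have "(\<integral>\<^sup>+t. ennreal (indicator S t *\<^sub>R t) \<partial>lborel) = (\<integral>\<^sup>+t. ennreal t * indicator S t \<partial>lborel)"
    by (intro nn_integral_cong) (auto simp: indicator_def)
  also have "\<dots> = emeasure linear_density S"
    unfolding linear_density_def using S by (subst emeasure_density) auto
  finally show ?thesis by (simp add: measure_def)
qed

section \<open>Movement of the resonant frequencies with the parameters\<close>

locale perturbed_parameters =
  fixes \<tau> R r0 :: real and nut kapt :: "nat \<Rightarrow> real \<Rightarrow> real"
  assumes \<tau>: "0 < \<tau>" and r0: "0 < r0" and pert: "perturbation_bounds R r0 nut kapt"
begin

lemma pert_bounds:
  assumes "1 \<le> j" "t \<in> {0..r0}"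
  shows "\<bar>nut j t\<bar> \<le> R" "\<bar>kapt j t\<bar> \<le> R"
proof -
  have "\<bar>nut j t\<bar> + \<bar>kapt j t\<bar> \<le> R"
    using pert assms unfolding perturbation_bounds_def by blast
  then show "\<bar>nut j t\<bar> \<le> R" "\<bar>kapt j t\<bar> \<le> R" by linarith+
qed

lemma R_nonneg: "0 \<le> R"
  using pert_bounds[of 1 0] r0 by simp

lemma pert_lipschitz:
  assumes "1 \<le> j" "t \<in> {0..r0}" "t' \<in> {0..r0}"
  shows "\<bar>nut j t - nut j t'\<bar> \<le> R * \<bar>t - t'\<bar>" "\<bar>kapt j t - kapt j t'\<bar> \<le> R * \<bar>t - t'\<bar>"
proof -
  have "\<bar>nut j t - nut j t'\<bar> + \<bar>kapt j t - kapt j t'\<bar> \<le> R * \<bar>t - t'\<bar>"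
    using pert assms unfolding perturbation_bounds_def by blast
  then show "\<bar>nut j t - nut j t'\<bar> \<le> R * \<bar>t - t'\<bar>" "\<bar>kapt j t - kapt j t'\<bar> \<le> R * \<bar>t - t'\<bar>"
    by linarith+
qed

text \<open>Telescoping of the geometric bounds; the subtracted \<open>(1 / 2) ^ j\<close> is what
  lets the induction close.\<close>

lemma pert_tail:
  assumes J: "1 \<le> J" and "J \<le> j" and t: "t \<in> {0..r0}"
  shows "\<bar>nut j t - nut J t\<bar> + \<bar>kapt j t - kapt J t\<bar> \<le> 2 * R * ((1 / 2) ^ J - (1 / 2) ^ j)"
  using \<open>J \<le> j\<close>
proof (induction rule: dec_induct)
  case (step j)
  have "\<bar>nut (j + 1) t - nut j t\<bar> + \<bar>kapt (j + 1) t - kapt j t\<bar> \<le> R * (1 / 2) ^ j"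
    using pert t J step.hyps unfolding perturbation_bounds_def by auto
  moreover have "2 * R * ((1 / 2) ^ J - (1 / 2) ^ Suc j) = 2 * R * ((1 / 2) ^ J - (1 / 2) ^ j) + R * (1 / 2) ^ j"
    by (simp add: algebra_simps)
  ultimately show ?case using step.IH by simp
qed simp

text \<open>The value that the square root in the symbol must take at k1 = n for the divisor to
  vanish.\<close>

definition amplitude :: "nat \<Rightarrow> nat \<Rightarrow> real \<Rightarrow> real" where
  "amplitude n j t = nu_pert \<tau> nut j t * (real n)\<^sup>2 + kappa_pert kapt j t"

definition freq :: "nat \<Rightarrow> nat \<Rightarrow> real \<Rightarrow> real" where
  "freq n j t = zero_freq \<tau> (nu_pert \<tau> nut j t) (kappa_pert kapt j t) n"

lemma freq_eq: "freq n j t = sqrt ((amplitude n j t)\<^sup>2 - (real n)\<^sup>2) / \<tau>"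
  by (simp add: freq_def zero_freq_def amplitude_def)

text \<open>The midpoint between 1 and the unperturbed value: \<open>amplitude\<close> stays above
  this multiple of n^2 on the whole range, so the comparison constants stay fixed.\<close>

definition ellipticity :: real where
  "ellipticity = (1 + nu0 \<tau>) / 2"

text \<open>The Lipschitz constant from \<open>sqrt_shifted_square_bilipschitz\<close> for
  \<open>ellipticity\<close>.\<close>

definition slope :: real where
  "slope = ellipticity / sqrt (ellipticity\<^sup>2 - 1)"

text \<open>The displacement of \<open>amplitude\<close> from its value at t = 0 is at most this
  times t^2 n^2. One R comes from the cubic term, the other from \<kappa>.\<close>

definition drift :: real where
  "drift = nu1 \<tau> + 2 * R"

text \<open>In order, the entries keep t strictly below r0; make higher powers of t smaller; keep
  the cubic term below a quarter of the quadratic speed; secure \<open>amplitude_ge\<close>; keep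
  |\<kappa>| \<le> \<tau>/2; and keep the zero for n = 1 within 1/2 of its initial value 1.\<close>

definition range_bound :: real where
  "range_bound = Min {r0 / 2, 1, nu1 \<tau> / (12 * (R + 1)), (nu0 \<tau> - 1) / (2 * drift), \<tau> / (2 * (R + 1)),
     \<tau> / (2 * slope * drift)}"

lemma ellipticity: "1 < ellipticity"
  using nu0_gt_1[OF \<tau>] by (simp add: ellipticity_def)

lemma slope: "0 < slope"
proof -
  have "1 < ellipticity\<^sup>2" using ellipticity by (simp add: one_less_power)
  then show ?thesis using ellipticity by (simp add: slope_def)
qed

lemma drift: "0 < drift"
  using nu1_pos[OF \<tau>] R_nonneg by (simp add: drift_def)

lemma range_bound:
  "0 < range_bound" "range_bound \<le> r0 / 2" "range_bound \<le> 1" "range_bound * (12 * (R + 1)) \<le> nu1 \<tau>"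
  "range_bound * drift \<le> (nu0 \<tau> - 1) / 2" "range_bound * (R + 1) \<le> \<tau> / 2"
  "slope * (range_bound * drift) \<le> \<tau> / 2"
proof -
  have "\<And>x. x \<in> {r0 / 2, 1, nu1 \<tau> / (12 * (R + 1)), (nu0 \<tau> - 1) / (2 * drift), \<tau> / (2 * (R + 1)),
     \<tau> / (2 * slope * drift)} \<Longrightarrow> range_bound \<le> x"
    unfolding range_bound_def by (rule Min_le) simp_all
  then have m: "range_bound \<le> r0 / 2" "range_bound \<le> 1" "range_bound \<le> nu1 \<tau> / (12 * (R + 1))"
    "range_bound \<le> (nu0 \<tau> - 1) / (2 * drift)" "range_bound \<le> \<tau> / (2 * (R + 1))"
    "range_bound \<le> \<tau> / (2 * slope * drift)"
    by blast+
  then show "range_bound \<le> r0 / 2" "range_bound \<le> 1" by blast+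
  show "0 < range_bound"
    using r0 nu1_pos[OF \<tau>] R_nonneg nu0_gt_1[OF \<tau>] drift slope \<tau> unfolding range_bound_def
    by (subst Min_gr_iff) auto
  show "range_bound * (12 * (R + 1)) \<le> nu1 \<tau>" using m(3) R_nonneg by (subst (asm) pos_le_divide_eq) auto
  show "range_bound * drift \<le> (nu0 \<tau> - 1) / 2" using m(4) drift by (simp add: field_simps)
  show "range_bound * (R + 1) \<le> \<tau> / 2" using m(5) R_nonneg by (simp add: field_simps)
  show "slope * (range_bound * drift) \<le> \<tau> / 2" using m(6) slope drift by (simp add: field_simps)
qed

lemma amplitude_diff:
  "amplitude n j t - nu0 \<tau> * (real n)\<^sup>2 =
    (t ^ 3 * nut j t - t\<^sup>2 * nu1 \<tau>) * (real n)\<^sup>2 + t\<^sup>2 * kapt j t"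
  by (simp add: amplitude_def nu_pert_def kappa_pert_def algebra_simps)

lemma amplitude_close:
  assumes j: "1 \<le> j" and t: "t \<in> {0..range_bound}" and n: "1 \<le> n"
  shows "\<bar>amplitude n j t - nu0 \<tau> * (real n)\<^sup>2\<bar> \<le> drift * t\<^sup>2 * (real n)\<^sup>2"
proof -
  have e: "0 \<le> t" "t \<le> 1" "t \<in> {0..r0}" using t range_bound r0 by auto
  have N: "1 \<le> (real n)\<^sup>2" using n by (simp add: one_le_power)
  have "\<bar>t ^ 3 * nut j t\<bar> \<le> t\<^sup>2 * R"
    using pert_bounds(1)[OF j e(3)] e power_decreasing[of 2 3 t] by (simp add: abs_mult mult_mono)
  moreover have "\<bar>t\<^sup>2 * nu1 \<tau>\<bar> = t\<^sup>2 * nu1 \<tau>" using nu1_pos[OF \<tau>] by simp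
  ultimately have "\<bar>t ^ 3 * nut j t - t\<^sup>2 * nu1 \<tau>\<bar> \<le> t\<^sup>2 * R + t\<^sup>2 * nu1 \<tau>" by linarith
  then have "\<bar>(t ^ 3 * nut j t - t\<^sup>2 * nu1 \<tau>) * (real n)\<^sup>2\<bar> \<le> (t\<^sup>2 * R + t\<^sup>2 * nu1 \<tau>) * (real n)\<^sup>2"
    unfolding abs_mult by (intro mult_mono) auto
  moreover have "\<bar>t\<^sup>2 * kapt j t\<bar> \<le> t\<^sup>2 * R * (real n)\<^sup>2"
  proof -
    have "\<bar>t\<^sup>2 * kapt j t\<bar> \<le> t\<^sup>2 * R" using pert_bounds(2)[OF j e(3)] by (simp add: abs_mult mult_left_mono)
    also have "\<dots> \<le> t\<^sup>2 * R * (real n)\<^sup>2" using mult_left_mono[OF N, of "t\<^sup>2 * R"] R_nonneg by simp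
    finally show ?thesis .
  qed
  ultimately have "\<bar>amplitude n j t - nu0 \<tau> * (real n)\<^sup>2\<bar> \<le> (t\<^sup>2 * R + t\<^sup>2 * nu1 \<tau>) * (real n)\<^sup>2 + t\<^sup>2 * R * (real n)\<^sup>2"
    unfolding amplitude_diff by linarith
  then show ?thesis by (simp add: drift_def algebra_simps)
qed

lemma amplitude_ge:
  assumes j: "1 \<le> j" and t: "t \<in> {0..range_bound}" and n: "1 \<le> n"
  shows "ellipticity * (real n)\<^sup>2 \<le> amplitude n j t"
proof -
  have "t\<^sup>2 \<le> range_bound"
    using t range_bound mult_mono[of t range_bound t 1] by (simp add: power2_eq_square)
  then have "drift * t\<^sup>2 \<le> drift * range_bound" using drift by (intro mult_left_mono) auto
  also have "\<dots> \<le> (nu0 \<tau> - 1) / 2" using range_bound(5) by (simp add: mult.commute)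
  finally have "drift * t\<^sup>2 * (real n)\<^sup>2 \<le> (nu0 \<tau> - 1) / 2 * (real n)\<^sup>2" by (intro mult_right_mono) auto
  then have "nu0 \<tau> * (real n)\<^sup>2 - (nu0 \<tau> - 1) / 2 * (real n)\<^sup>2 \<le> amplitude n j t"
    using amplitude_close[OF assms] by linarith
  then show ?thesis by (simp add: ellipticity_def field_simps)
qed

lemma critical_freq_eq: "critical_freq n (nu0 \<tau>) = sqrt ((nu0 \<tau> * (real n)\<^sup>2)\<^sup>2 - (real n)\<^sup>2) / \<tau>"
proof -
  have "sqrt ((nu0 \<tau>)\<^sup>2 - 1) = \<tau>" using \<tau> by (simp add: nu0_def)
  then show ?thesis by (simp add: critical_freq_def zero_freq_def)
qed

lemma freq_diff_le:
  assumes "1 \<le> n" "ellipticity * (real n)\<^sup>2 \<le> A" "ellipticity * (real n)\<^sup>2 \<le> B" "\<bar>A - B\<bar> \<le> \<delta>"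
  shows "\<bar>sqrt (A\<^sup>2 - (real n)\<^sup>2) / \<tau> - sqrt (B\<^sup>2 - (real n)\<^sup>2) / \<tau>\<bar> \<le> slope * \<delta> / \<tau>"
proof -
  have "\<bar>sqrt (A\<^sup>2 - (real n)\<^sup>2) - sqrt (B\<^sup>2 - (real n)\<^sup>2)\<bar> \<le> slope * \<delta>"
    using sqrt_shifted_square_bilipschitz(2)[OF ellipticity _ assms(2,3)] assms(1)
      mult_left_mono[OF assms(4) less_imp_le[OF slope]]
    unfolding slope_def by linarith
  then show ?thesis using \<tau> by (simp add: abs_divide divide_right_mono flip: diff_divide_distrib)
qed

lemma freq_close:
  assumes "1 \<le> j" "t \<in> {0..range_bound}" "1 \<le> n"
  shows "\<bar>freq n j t - critical_freq n (nu0 \<tau>)\<bar> \<le> slope * drift / \<tau> * t\<^sup>2 * (real n)\<^sup>2"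
proof -
  have v: "ellipticity * (real n)\<^sup>2 \<le> nu0 \<tau> * (real n)\<^sup>2"
    using nu0_gt_1[OF \<tau>] by (intro mult_right_mono) (auto simp: ellipticity_def)
  show ?thesis
    using freq_diff_le[OF assms(3) amplitude_ge[OF assms] v amplitude_close[OF assms]]
    by (simp add: freq_eq critical_freq_eq mult_ac)
qed

lemma freq_tail:
  assumes J: "1 \<le> J" "J \<le> j" and t: "t \<in> {0..range_bound}" and n: "1 \<le> n"
  shows "\<bar>freq n j t - freq n J t\<bar> \<le> 2 * slope * R / \<tau> * (real n)\<^sup>2 * (1 / 2) ^ J"
proof -
  have e: "0 \<le> t" "t \<le> 1" "t \<in> {0..r0}" using t range_bound r0 by auto
  have j: "1 \<le> j" using J by simp
  have N: "1 \<le> (real n)\<^sup>2" using n by (simp add: one_le_power)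
  have "amplitude n j t - amplitude n J t = t ^ 3 * (real n)\<^sup>2 * (nut j t - nut J t) + t\<^sup>2 * (kapt j t - kapt J t)"
    by (simp add: amplitude_def nu_pert_def kappa_pert_def algebra_simps)
  then have "\<bar>amplitude n j t - amplitude n J t\<bar> \<le>
      t ^ 3 * (real n)\<^sup>2 * \<bar>nut j t - nut J t\<bar> + t\<^sup>2 * \<bar>kapt j t - kapt J t\<bar>"
    using e abs_triangle_ineq[of "t ^ 3 * (real n)\<^sup>2 * (nut j t - nut J t)" "t\<^sup>2 * (kapt j t - kapt J t)"]
    by (simp add: abs_mult)
  also have "\<dots> \<le> (real n)\<^sup>2 * \<bar>nut j t - nut J t\<bar> + (real n)\<^sup>2 * \<bar>kapt j t - kapt J t\<bar>"
  proof (intro add_mono mult_right_mono)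
    show "t ^ 3 * (real n)\<^sup>2 \<le> (real n)\<^sup>2" using e by (simp add: mult_left_le_one_le power_le_one)
    have "t\<^sup>2 \<le> 1" using e by (simp add: power_le_one)
    then show "t\<^sup>2 \<le> (real n)\<^sup>2" using N by linarith
  qed auto
  also have "\<dots> = (real n)\<^sup>2 * (\<bar>nut j t - nut J t\<bar> + \<bar>kapt j t - kapt J t\<bar>)" by (simp add: distrib_left)
  also have "\<dots> \<le> (real n)\<^sup>2 * (2 * R * (1 / 2) ^ J)"
  proof (rule mult_left_mono)
    have "2 * R * ((1 / 2) ^ J - (1 / 2) ^ j) \<le> 2 * R * (1 / 2) ^ J" using R_nonneg by (intro mult_left_mono) auto
    then show "\<bar>nut j t - nut J t\<bar> + \<bar>kapt j t - kapt J t\<bar> \<le> 2 * R * (1 / 2) ^ J"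
      using pert_tail[OF J e(3)] by linarith
  qed simp
  finally have d: "\<bar>amplitude n j t - amplitude n J t\<bar> \<le> (real n)\<^sup>2 * (2 * R * (1 / 2) ^ J)" .
  show ?thesis
    using freq_diff_le[OF n amplitude_ge[OF j t n] amplitude_ge[OF J(1) t n] d]
    by (simp add: freq_eq mult_ac)
qed

text \<open>In the variable t^2 the term with \<open>nu1 \<tau>\<close> moves
  \<open>amplitude\<close> at speed \<open>nu1 \<tau>\<close> times n^2. The choice of
  \<open>range_bound\<close> limits the cubic term to a quarter of this speed and the largeness of n
  does the same for \<kappa>, so half of it survives.\<close>

lemma freq_transversal:
  assumes j: "1 \<le> j" and t: "t \<in> {0..range_bound}" "t' \<in> {0..range_bound}"
    and n: "1 \<le> n" "8 * R \<le> nu1 \<tau> * (real n)\<^sup>2"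
  shows "nu1 \<tau> / (2 * \<tau>) * (real n)\<^sup>2 * \<bar>t\<^sup>2 - t'\<^sup>2\<bar> \<le> \<bar>freq n j t - freq n j t'\<bar>"
proof -
  have ordered: "nu1 \<tau> / 2 * (real n)\<^sup>2 * (y\<^sup>2 - x\<^sup>2) \<le> amplitude n j x - amplitude n j y"
    if xy: "0 \<le> x" "x \<le> y" "y \<le> range_bound" for x y
  proof -
    have y: "y \<le> 1" "x \<in> {0..r0}" "y \<in> {0..r0}" using xy range_bound r0 by auto
    define s where "s = y\<^sup>2 - x\<^sup>2"
    have s: "s = (y - x) * (y + x)" by (simp add: s_def power2_eq_square algebra_simps)
    have s0: "0 \<le> s" unfolding s using xy by (intro mult_nonneg_nonneg) auto
    have dy: "(y - x) * y \<le> s" unfolding s using xy by (intro mult_left_mono) auto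
    \<comment> \<open>The Lipschitz bounds are in t but speed is measured in t^2; the factor x^2
      converts one into the other without dividing by x.\<close>
    have x2: "x\<^sup>2 * (y - x) \<le> y * s"
    proof -
      have "x\<^sup>2 * (y - x) \<le> y\<^sup>2 * (y - x)" using xy by (intro mult_right_mono power_mono) auto
      also have "\<dots> = y * ((y - x) * y)" by (simp add: power2_eq_square)
      also have "\<dots> \<le> y * s" using xy dy by (intro mult_left_mono) auto
      finally show ?thesis .
    qed
    have cubic: "\<bar>y ^ 3 * nut j y - x ^ 3 * nut j x\<bar> \<le> 3 * R * y * s"
    proof -
      have "y ^ 3 * nut j y - x ^ 3 * nut j x = (y ^ 3 - x ^ 3) * nut j y + x ^ 3 * (nut j y - nut j x)"
        by (simp add: algebra_simps)
      moreover have "\<bar>(y ^ 3 - x ^ 3) * nut j y\<bar> \<le> 2 * y * s * R"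
        unfolding abs_mult
      proof (intro mult_mono pert_bounds(1)[OF j y(3)])
        have "y ^ 3 - x ^ 3 = (y - x) * (y * y + y * x + x * x)" by (simp add: power3_eq_cube algebra_simps)
        moreover have "y * y + y * x + x * x \<le> (y + x) * (2 * y)"
          using xy mult_mono[of x y x x] by (simp add: algebra_simps add_increasing2)
        ultimately have "y ^ 3 - x ^ 3 \<le> (y - x) * ((y + x) * (2 * y))" using xy by (simp add: mult_left_mono)
        moreover have "x ^ 3 \<le> y ^ 3" using xy by (intro power_mono) auto
        ultimately show "\<bar>y ^ 3 - x ^ 3\<bar> \<le> 2 * y * s" by (simp add: s algebra_simps)
        show "0 \<le> 2 * y * s" using xy s0 by simp
      qed auto
      moreover have "\<bar>x ^ 3 * (nut j y - nut j x)\<bar> \<le> y * s * R"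
      proof -
        have "\<bar>x ^ 3 * (nut j y - nut j x)\<bar> \<le> x\<^sup>2 * (R * (y - x))"
          unfolding abs_mult using pert_lipschitz(1)[OF j y(3,2)] xy y power_decreasing[of 2 3 x]
          by (intro mult_mono) auto
        also have "\<dots> = R * (x\<^sup>2 * (y - x))" by simp
        also have "\<dots> \<le> R * (y * s)" using x2 R_nonneg by (rule mult_left_mono)
        finally show ?thesis by (simp add: mult_ac)
      qed
      ultimately show ?thesis by (simp add: algebra_simps)
    qed
    have quadratic: "\<bar>y\<^sup>2 * kapt j y - x\<^sup>2 * kapt j x\<bar> \<le> 2 * R * s"
    proof -
      have "y\<^sup>2 * kapt j y - x\<^sup>2 * kapt j x = s * kapt j y + x\<^sup>2 * (kapt j y - kapt j x)"
        by (simp add: s_def algebra_simps)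
      moreover have "\<bar>s * kapt j y\<bar> \<le> s * R"
        unfolding abs_mult using s0 pert_bounds(2)[OF j y(3)] by (intro mult_mono) auto
      moreover have "\<bar>x\<^sup>2 * (kapt j y - kapt j x)\<bar> \<le> s * R"
      proof -
        have "\<bar>x\<^sup>2 * (kapt j y - kapt j x)\<bar> \<le> x\<^sup>2 * (R * (y - x))"
          unfolding abs_mult using pert_lipschitz(2)[OF j y(3,2)] xy by (intro mult_mono) auto
        also have "\<dots> = R * (x\<^sup>2 * (y - x))" by simp
        also have "\<dots> \<le> R * (y * s)" using x2 R_nonneg by (rule mult_left_mono)
        also have "\<dots> \<le> R * (1 * s)" using y s0 R_nonneg by (intro mult_left_mono mult_right_mono) auto
        finally show ?thesis by (simp add: mult_ac)
      qed
      moreover have "2 * R * s = s * R + s * R" by simp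
      ultimately show ?thesis by linarith
    qed
    have "3 * R * y \<le> nu1 \<tau> / 4"
    proof -
      have "R * y \<le> (R + 1) * range_bound" using xy R_nonneg by (intro mult_mono) auto
      then show ?thesis using range_bound(4) by (simp add: algebra_simps)
    qed
    then have "3 * R * y * s \<le> nu1 \<tau> / 4 * s" using s0 by (rule mult_right_mono)
    then have "(y ^ 3 * nut j y - x ^ 3 * nut j x) * (real n)\<^sup>2 \<le> nu1 \<tau> / 4 * s * (real n)\<^sup>2"
      using cubic by (intro mult_right_mono) auto
    moreover have "2 * R * s \<le> nu1 \<tau> / 4 * (real n)\<^sup>2 * s"
      using n(2) s0 by (intro mult_right_mono) auto
    moreover have "amplitude n j x - amplitude n j y =
        nu1 \<tau> * s * (real n)\<^sup>2 - (y ^ 3 * nut j y - x ^ 3 * nut j x) * (real n)\<^sup>2 - (y\<^sup>2 * kapt j y - x\<^sup>2 * kapt j x)"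
      by (simp add: amplitude_def nu_pert_def kappa_pert_def s_def algebra_simps)
    ultimately have "nu1 \<tau> * s * (real n)\<^sup>2 - nu1 \<tau> / 4 * s * (real n)\<^sup>2 - nu1 \<tau> / 4 * (real n)\<^sup>2 * s
        \<le> amplitude n j x - amplitude n j y"
      using quadratic by linarith
    then show ?thesis by (simp add: s_def field_simps)
  qed
  have "nu1 \<tau> / 2 * (real n)\<^sup>2 * \<bar>t\<^sup>2 - t'\<^sup>2\<bar> \<le> \<bar>amplitude n j t - amplitude n j t'\<bar>"
  proof (cases "t \<le> t'")
    case True
    then have "t\<^sup>2 \<le> t'\<^sup>2" using t by (intro power_mono) auto
    then have eq: "\<bar>t\<^sup>2 - t'\<^sup>2\<bar> = t'\<^sup>2 - t\<^sup>2" by simp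
    have "nu1 \<tau> / 2 * (real n)\<^sup>2 * (t'\<^sup>2 - t\<^sup>2) \<le> amplitude n j t - amplitude n j t'"
      using True t by (intro ordered) auto
    then show ?thesis unfolding eq by linarith
  next
    case False
    then have "t'\<^sup>2 \<le> t\<^sup>2" using t by (intro power_mono) auto
    then have eq: "\<bar>t\<^sup>2 - t'\<^sup>2\<bar> = t\<^sup>2 - t'\<^sup>2" by simp
    have "nu1 \<tau> / 2 * (real n)\<^sup>2 * (t\<^sup>2 - t'\<^sup>2) \<le> amplitude n j t' - amplitude n j t"
      using False t by (intro ordered) auto
    then show ?thesis unfolding eq by linarith
  qed
  also have "\<dots> \<le> \<bar>sqrt ((amplitude n j t)\<^sup>2 - (real n)\<^sup>2) - sqrt ((amplitude n j t')\<^sup>2 - (real n)\<^sup>2)\<bar>"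
    using n by (intro sqrt_shifted_square_bilipschitz(1)[OF ellipticity] amplitude_ge j t) auto
  also have "\<dots> = \<tau> * \<bar>freq n j t - freq n j t'\<bar>"
    using \<tau> by (simp add: freq_eq abs_divide flip: diff_divide_distrib)
  finally show ?thesis using \<tau> by (simp add: field_simps)
qed

end

section \<open>Measure of the excluded parameters\<close>

context perturbed_parameters
begin

lemma continuous_freq:
  assumes "1 \<le> j"
  shows "continuous_on {0..r0} (freq n j)"
proof -
  have [continuous_intros]: "continuous_on {0..r0} (nut j)" "continuous_on {0..r0} (kapt j)"
    using pert_lipschitz[OF assms] R_nonneg
    by (auto intro!: lipschitz_on_continuous_on[of R] lipschitz_onI simp: dist_real_def)
  show ?thesis
    unfolding freq_def[abs_def] zero_freq_def nu_pert_def kappa_pert_def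
    by (intro continuous_intros) (use \<tau> in auto)
qed

lemma closed_nonresonant:
  assumes "1 \<le> j" "b \<le> r0"
  shows "closed {t\<in>{0..b}. \<gamma> \<le> \<bar>freq n j t - of_int m\<bar>}"
  using assms by (intro continuous_on_closed_Collect_le continuous_intros
      continuous_on_subset[OF continuous_freq]) auto

text \<open>The zero for n = 1 starts at the integer 1, which belongs to the kernel frequencies; it
  is excluded here and treated directly.\<close>

definition good_set :: "real \<Rightarrow> real set" where
  "good_set \<gamma> = {t\<in>{0..range_bound}. \<forall>j\<ge>1. \<forall>n\<ge>2. \<forall>m::int. \<gamma> / (real n)\<^sup>2 \<le> \<bar>freq n j t - of_int m\<bar>}"

lemma closed_good_set: "closed (good_set \<gamma>)"
proof -
  have "good_set \<gamma> = {0..range_bound} \<inter> (\<Inter>j\<in>{1..}. \<Inter>n\<in>{2..}. \<Inter>m::int.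
      {t\<in>{0..range_bound}. \<gamma> / (real n)\<^sup>2 \<le> \<bar>freq n j t - of_int m\<bar>})"
    by (auto simp: good_set_def)
  also have "closed \<dots>"
    using range_bound r0 by (intro closed_Int closed_INT ballI closed_nonresonant closed_atLeastAtMost) auto
  finally show ?thesis .
qed

text \<open>The initial distance d to the integers is at least twice the resonance width 2 \<gamma>
  / n^2, so a resonance requires a displacement of at least d / 2. The displacement is O(r^2 n^2),
  which bounds d and also the integers that can be reached.\<close>

lemma resonance_imp_small_int_dist:
  assumes \<gamma>: "4 * \<gamma> / (real n)\<^sup>2 \<le> int_dist (critical_freq n (nu0 \<tau>))"
    and j: "1 \<le> j" and n: "1 \<le> n" and r: "r \<le> range_bound" and t: "t \<in> {0..r}"
    and res: "\<bar>freq n j t - of_int m\<bar> < 2 * \<gamma> / (real n)\<^sup>2"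
  shows "int_dist (critical_freq n (nu0 \<tau>)) \<le> 2 * (slope * drift / \<tau>) * r\<^sup>2 * (real n)\<^sup>2"
    and "\<bar>critical_freq n (nu0 \<tau>) - of_int m\<bar> \<le> 1 / 2 + slope * drift / \<tau> * r\<^sup>2 * (real n)\<^sup>2"
proof -
  let ?Y = "critical_freq n (nu0 \<tau>)"
  have "\<bar>freq n j t - ?Y\<bar> \<le> slope * drift / \<tau> * t\<^sup>2 * (real n)\<^sup>2"
    using t r by (intro freq_close j n) auto
  also have "\<dots> \<le> slope * drift / \<tau> * r\<^sup>2 * (real n)\<^sup>2"
    using t slope drift \<tau> by (intro mult_right_mono mult_left_mono power_mono) auto
  finally have "\<bar>?Y - of_int m\<bar> < 2 * \<gamma> / (real n)\<^sup>2 + slope * drift / \<tau> * r\<^sup>2 * (real n)\<^sup>2"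
    using res by linarith
  moreover have "2 * \<gamma> / (real n)\<^sup>2 \<le> int_dist ?Y / 2" using \<gamma> by simp
  moreover note int_dist_le[of ?Y m] int_dist_le_half[of ?Y]
  ultimately show "int_dist ?Y \<le> 2 * (slope * drift / \<tau>) * r\<^sup>2 * (real n)\<^sup>2"
    "\<bar>?Y - of_int m\<bar> \<le> 1 / 2 + slope * drift / \<tau> * r\<^sup>2 * (real n)\<^sup>2"
    by linarith+
qed

lemma card_integers_near: "0 \<le> s \<Longrightarrow> real (card {\<lceil>x - s\<rceil>..\<lfloor>x + s\<rfloor>}) \<le> 2 * s + 1"
  for x s :: real
  by (simp add: of_nat_nat) linarith

text \<open>From the index \<open>J\<close> on, the parameters move \<open>freq\<close> by at most \<open>\<gamma>/n\<^sup>2\<close>, so the resonances of width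
  \<open>\<gamma>/n\<^sup>2\<close> of all \<open>j \<ge> J\<close> are covered by those of width \<open>2\<gamma>/n\<^sup>2\<close> of \<open>J\<close>.\<close>

lemma emeasure_resonant_le:
  fixes n J :: nat
  assumes \<gamma>: "0 < \<gamma>" "4 * \<gamma> / (real n)\<^sup>2 \<le> int_dist (critical_freq n (nu0 \<tau>))"
    and n: "2 \<le> n" "8 * R \<le> nu1 \<tau> * (real n)\<^sup>2" and r: "0 \<le> r" "r \<le> range_bound"
    and J: "1 \<le> J" "2 * slope * R / (\<tau> * \<gamma>) * real n ^ 4 \<le> 2 ^ J"
  shows "emeasure linear_density {t\<in>{0..r}. \<exists>j\<ge>1. \<exists>m::int. \<bar>freq n j t - of_int m\<bar> < \<gamma> / (real n)\<^sup>2}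
    \<le> ennreal (real J * (40 * slope * drift * \<gamma> / nu1 \<tau>) * r\<^sup>2 / ((real n)\<^sup>2 * int_dist (critical_freq n (nu0 \<tau>))))"
proof -
  define Y where "Y = critical_freq n (nu0 \<tau>)"
  define d where "d = int_dist Y"
  define C where "C = slope * drift / \<tau>"
  define N where "N = (real n)\<^sup>2"
  define U where "U = {t\<in>{0..r}. \<exists>j\<ge>1. \<exists>m::int. \<bar>freq n j t - of_int m\<bar> < \<gamma> / N}"
  have N: "0 < N" using n by (simp add: N_def)
  have d: "0 < d" using \<gamma> N less_le_trans[of 0 "4 * \<gamma> / N" d] by (simp add: N_def d_def Y_def)
  have C: "0 < C" using slope drift \<tau> by (simp add: C_def)
  note hit = resonance_imp_small_int_dist[OF \<gamma>(2) _ _ r(2), folded C_def Y_def, folded d_def N_def]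
  have "emeasure linear_density U \<le> ennreal (real J * (40 * slope * drift * \<gamma> / nu1 \<tau>) * r\<^sup>2 / (N * d))"
  \<comment> \<open>If d is larger than this, no resonance can be reached within [0, r].\<close>
  proof (cases "d \<le> 2 * C * r\<^sup>2 * N")
    case False
    have "U = {}"
    proof (rule ccontr)
      assume "U \<noteq> {}"
      then obtain t j m where *: "t \<in> {0..r}" "1 \<le> j" "\<bar>freq n j t - of_int m\<bar> < \<gamma> / N"
        unfolding U_def by blast
      have "\<gamma> / N \<le> 2 * \<gamma> / N" using \<gamma> N by (simp add: divide_right_mono)
      then have "\<bar>freq n j t - of_int m\<bar> < 2 * \<gamma> / N" using *(3) by linarith
      then have "d \<le> 2 * C * r\<^sup>2 * N" using hit(1)[OF *(2) _ *(1)] n by simp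
      then show False using False by simp
    qed
    then show ?thesis by simp
  next
    case True
    define s where "s = 1 / 2 + C * r\<^sup>2 * N"
    have s: "0 \<le> s" using C N by (simp add: s_def)
    define I where "I = {1..J} \<times> {\<lceil>Y - s\<rceil>..\<lfloor>Y + s\<rfloor>}"
    define A where "A p = {t\<in>{0..r}. \<bar>freq n (fst p) t - of_int (snd p)\<bar> < 2 * \<gamma> / N}" for p :: "nat \<times> int"
    \<comment> \<open>Two points of one piece differ by less than 4 \<gamma> / N in frequency;
      dividing by the speed \<open>nu1 \<tau> * N / (2 * \<tau>)\<close> gives D.\<close>
    define D where "D = 8 * \<gamma> * \<tau> / (nu1 \<tau> * N\<^sup>2)"
    have "U \<subseteq> (\<Union>p\<in>I. A p)"
    proof
      fix t assume "t \<in> U"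
      then obtain j m where *: "t \<in> {0..r}" "1 \<le> j" "\<bar>freq n j t - of_int m\<bar> < \<gamma> / N"
        unfolding U_def by blast
      \<comment> \<open>Every index beyond J is represented by J itself, at the price of doubling
        the width.\<close>
      define i where "i = min j J"
      have i: "1 \<le> i" "i \<le> J" using * J by (auto simp: i_def)
      have "\<bar>freq n j t - freq n i t\<bar> \<le> \<gamma> / N"
      proof (cases "j \<le> J")
        case True
        then show ?thesis using \<gamma> N by (simp add: i_def)
      next
        case False
        then have "\<bar>freq n j t - freq n i t\<bar> \<le> 2 * slope * R / \<tau> * N * (1 / 2) ^ J"
          unfolding N_def i_def using freq_tail[OF J(1), of j t n] * r n by auto
        also have "\<dots> \<le> \<gamma> / N"
        proof -
          have "2 * slope * R / (\<tau> * \<gamma>) * N\<^sup>2 \<le> 2 ^ J" using J(2) by (simp add: N_def flip: power_mult)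
          then have "2 * slope * R * N\<^sup>2 \<le> 2 ^ J * (\<tau> * \<gamma>)" using \<tau> \<gamma> by (simp add: field_simps)
          then show ?thesis using \<tau> N by (simp add: field_simps power2_eq_square power_one_over)
        qed
        finally show ?thesis .
      qed
      moreover have "2 * \<gamma> / N = \<gamma> / N + \<gamma> / N" by simp
      ultimately have **: "\<bar>freq n i t - of_int m\<bar> < 2 * \<gamma> / N" using *(3) by linarith
      have "\<bar>Y - of_int m\<bar> \<le> s" using hit(2)[OF i(1) _ *(1) **] n by (simp add: s_def)
      then have "m \<in> {\<lceil>Y - s\<rceil>..\<lfloor>Y + s\<rfloor>}" by (auto simp: ceiling_le_iff le_floor_iff abs_le_iff)
      then show "t \<in> (\<Union>p\<in>I. A p)"
        using i ** *(1) by (intro UN_I[of "(i, m)"]) (auto simp: I_def A_def)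
    qed
    moreover have "\<bar>x\<^sup>2 - y\<^sup>2\<bar> \<le> D" if "p \<in> I" "x \<in> A p" "y \<in> A p" for p x y
    proof -
      have "nu1 \<tau> / (2 * \<tau>) * N * \<bar>x\<^sup>2 - y\<^sup>2\<bar> \<le> \<bar>freq n (fst p) x - freq n (fst p) y\<bar>"
        unfolding N_def using that n r by (intro freq_transversal) (auto simp: I_def A_def)
      also have "\<dots> \<le> 2 * (2 * \<gamma> / N)" using that(2,3) unfolding A_def mem_Collect_eq by linarith
      finally show ?thesis using nu1_pos[OF \<tau>] \<tau> N by (simp add: D_def field_simps power2_eq_square)
    qed
    ultimately have "emeasure linear_density U \<le> ennreal (real (card I) * D)"
      using \<gamma> \<tau> nu1_pos[OF \<tau>]
      by (intro emeasure_linear_density_cover_le) (auto simp: I_def A_def D_def)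
    also have "real (card I) * D \<le> real J * (40 * slope * drift * \<gamma> / nu1 \<tau>) * r\<^sup>2 / (N * d)"
    proof -
      \<comment> \<open>The additive constant in the count is absorbed through d \<le> 2 C r^2 N,
        and d \<le> 1/2 is used in the other term: 4 + 1 = 5. With the 8 in D this makes 40.\<close>
      have "real (card {\<lceil>Y - s\<rceil>..\<lfloor>Y + s\<rfloor>}) * d \<le> (2 * s + 1) * d"
        using card_integers_near[OF s] d by (intro mult_right_mono) auto
      also have "\<dots> = 2 * d + 2 * C * r\<^sup>2 * N * d" by (simp add: s_def algebra_simps)
      also have "\<dots> \<le> 2 * (2 * C * r\<^sup>2 * N) + 2 * C * r\<^sup>2 * N * (1 / 2)"
        using True int_dist_le_half[of Y] C N unfolding d_def by (intro add_mono mult_left_mono) auto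
      also have "\<dots> = 5 * C * r\<^sup>2 * N" by simp
      finally have "real (card {\<lceil>Y - s\<rceil>..\<lfloor>Y + s\<rfloor>}) \<le> 5 * C * r\<^sup>2 * N / d"
        by (subst pos_le_divide_eq[OF d])
      then have "real J * real (card {\<lceil>Y - s\<rceil>..\<lfloor>Y + s\<rfloor>}) * D \<le> real J * (5 * C * r\<^sup>2 * N / d) * D"
        using \<gamma> \<tau> nu1_pos[OF \<tau>] by (intro mult_right_mono mult_left_mono) (auto simp: D_def)
      also have "\<dots> = real J * (40 * slope * drift * \<gamma> / nu1 \<tau>) * r\<^sup>2 / (N * d)"
        using N d \<tau> nu1_pos[OF \<tau>] by (simp add: D_def C_def field_simps power2_eq_square)
      finally show ?thesis by (simp add: I_def card_cartesian_product)
    qed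
    finally show ?thesis by (simp add: ennreal_leI)
  qed
  then show ?thesis by (simp add: U_def N_def d_def Y_def)
qed

text \<open>The cost of each n is at most r^2 times a term of a convergent series. For small r the
  finitely many n below a threshold are out of reach of resonance, so only a tail of the series
  remains.\<close>

lemma emeasure_bad_set_small:
  assumes \<gamma>: "0 < \<gamma>" "\<And>n. 2 \<le> n \<Longrightarrow> 4 * \<gamma> / (real n)\<^sup>2 \<le> int_dist (critical_freq n (nu0 \<tau>))"
    and summ: "summable (\<lambda>n. real (n + 2) powr (- 7 / 4) / int_dist (critical_freq (n + 2) (nu0 \<tau>)))"
    and e: "0 < e"
  shows "\<forall>\<^sub>F r in at_right 0. emeasure linear_density ({0..r} - good_set \<gamma>) \<le> ennreal (e * r\<^sup>2)"
proof -
  define d where "d n = int_dist (critical_freq n (nu0 \<tau>))" for n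
  have d: "0 < d n" if "2 \<le> n" for n
    using \<gamma>(1) \<gamma>(2)[OF that] that less_le_trans[of 0 "4 * \<gamma> / (real n)\<^sup>2" "d n"] by (simp add: d_def)
  define C where "C = slope * drift / \<tau>"
  define K where "K = 40 * slope * drift * \<gamma> / nu1 \<tau>"
  have K: "0 < K" using slope drift \<gamma> nu1_pos[OF \<tau>] by (simp add: K_def)
  obtain G where G: "0 < G" "\<And>n. 1 \<le> n \<Longrightarrow>
      \<exists>J\<ge>1. 2 * slope * R / (\<tau> * \<gamma>) * real n ^ 4 \<le> 2 ^ J \<and> real J \<le> G * real n powr (1 / 4)"
    using dyadic_exponent_exists by blast
  define a where "a n = G * K * (real (n + 2) powr (- 7 / 4) / d (n + 2))" for n
  have a: "summable a" unfolding a_def d_def by (intro summable_mult summ)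
  have a0: "0 \<le> a n" for n using G K d[of "n + 2"] by (simp add: a_def)
  obtain N0 where N0: "\<And>n. N0 \<le> n \<Longrightarrow> norm (\<Sum>i. a (i + n)) < e"
    using suminf_exist_split[OF e a] by blast
  obtain n0 :: nat where n0: "8 * R / nu1 \<tau> \<le> real n0" using real_arch_simple by blast
  \<comment> \<open>Beyond N0 the tail of the series is below e; beyond n0 the largeness condition
    of \<open>freq_transversal\<close> holds.\<close>
  define N where "N = max N0 n0"
  have far: "\<forall>\<^sub>F r in at_right 0. 2 * C * r\<^sup>2 * (real n)\<^sup>2 < d n" if "2 \<le> n" for n
  proof -
    have "((\<lambda>r. 2 * C * r\<^sup>2 * (real n)\<^sup>2) \<longlongrightarrow> 2 * C * 0\<^sup>2 * (real n)\<^sup>2) (at_right 0)"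
      by (intro tendsto_intros)
    then show ?thesis using d[OF that] by (intro order_tendstoD(2)[of _ 0]) auto
  qed
  have "\<forall>\<^sub>F r in at_right 0. \<forall>n\<in>{2..N + 1}. 2 * C * r\<^sup>2 * (real n)\<^sup>2 < d n"
    by (intro eventually_ball_finite ballI far) auto
  moreover have "\<forall>\<^sub>F r in at_right 0. r \<in> {0<..<range_bound}"
    using range_bound(1) by (rule eventually_at_right_real)
  ultimately show ?thesis
  proof eventually_elim
    case (elim r)
    \<comment> \<open>Written as a countable union of differences of closed sets, U n is Borel, as
      countable subadditivity requires.\<close>
    define B where "B n j m = {0..r} - {t\<in>{0..r}. \<gamma> / (real n)\<^sup>2 \<le> \<bar>freq n j t - of_int m\<bar>}" for n j and m :: int
    define U where "U n = (\<Union>j\<in>{1..}. \<Union>m. B n j m)" for n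
    have U: "U n = {t\<in>{0..r}. \<exists>j\<ge>1. \<exists>m::int. \<bar>freq n j t - of_int m\<bar> < \<gamma> / (real n)\<^sup>2}" for n
      unfolding U_def B_def
      by (intro set_eqI) (simp only: UN_iff Diff_iff mem_Collect_eq atLeast_iff not_le[symmetric] bex_simps, blast)
    have "B n j m \<in> sets borel" if "1 \<le> j" for n j m
      unfolding B_def using elim range_bound that by (intro sets.Diff borel_closed closed_nonresonant) auto
    then have meas: "U n \<in> sets borel" for n
      unfolding U_def by (intro sets.countable_UN'' countable_UN sets.countable_UN') auto
    have "{0..r} - good_set \<gamma> \<subseteq> (\<Union>i. U (i + N + 2))"
    proof
      fix t assume "t \<in> {0..r} - good_set \<gamma>"
      then obtain j n and m :: int where *: "t \<in> {0..r}" "1 \<le> j" "2 \<le> n"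
          "\<bar>freq n j t - of_int m\<bar> < \<gamma> / (real n)\<^sup>2"
        using elim unfolding good_set_def by (auto simp: not_le)
      have "\<gamma> / (real n)\<^sup>2 \<le> 2 * \<gamma> / (real n)\<^sup>2" using \<gamma>(1) by (simp add: divide_right_mono)
      then have "\<bar>freq n j t - of_int m\<bar> < 2 * \<gamma> / (real n)\<^sup>2" using *(4) by linarith
      then have "d n \<le> 2 * C * r\<^sup>2 * (real n)\<^sup>2"
        unfolding d_def C_def using * elim by (intro resonance_imp_small_int_dist(1)[OF \<gamma>(2)]) auto
      then have "\<not> n \<le> N + 1" using elim(1) *(3) by force
      then have n: "n = n - (N + 2) + N + 2" by simp
      have "t \<in> U n" using * unfolding U by blast
      then show "t \<in> (\<Union>i. U (i + N + 2))" by (subst (asm) n) blast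
    qed
    then have "emeasure linear_density ({0..r} - good_set \<gamma>) \<le> emeasure linear_density (\<Union>i. U (i + N + 2))"
      using meas by (intro emeasure_mono) auto
    also have "\<dots> \<le> (\<Sum>i. emeasure linear_density (U (i + N + 2)))"
      using meas by (intro emeasure_subadditive_countably) auto
    also have "\<dots> \<le> (\<Sum>i. ennreal (r\<^sup>2 * a (i + N)))"
    proof (intro suminf_le allI)
      fix i
      define n where "n = i + N + 2"
      have n: "2 \<le> n" "real n0 \<le> real n" by (simp_all add: n_def N_def)
      obtain J where J: "1 \<le> J" "2 * slope * R / (\<tau> * \<gamma>) * real n ^ 4 \<le> 2 ^ J" "real J \<le> G * real n powr (1 / 4)"
        using G(2)[of n] n by auto
      have "8 * R \<le> real n * nu1 \<tau>"
        using order_trans[OF n0 n(2)] by (subst (asm) pos_divide_le_eq[OF nu1_pos[OF \<tau>]])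
      then have "8 * R \<le> nu1 \<tau> * real n" by (simp only: mult.commute)
      also have "\<dots> \<le> nu1 \<tau> * (real n)\<^sup>2"
        using nu1_pos[OF \<tau>] n(1) by (intro mult_left_mono) (auto simp: power2_eq_square)
      finally have "emeasure linear_density (U n) \<le> ennreal (real J * K * r\<^sup>2 / ((real n)\<^sup>2 * d n))"
        unfolding U K_def d_def using elim n J by (intro emeasure_resonant_le \<gamma>) auto
      also have "real J * K * r\<^sup>2 / ((real n)\<^sup>2 * d n) \<le> G * real n powr (1 / 4) * K * r\<^sup>2 / ((real n)\<^sup>2 * d n)"
        using J(3) K d[OF n(1)] by (intro divide_right_mono mult_right_mono) auto
      also have "\<dots> = r\<^sup>2 * (G * K * ((real n powr (1 / 4) / (real n)\<^sup>2) / d n))" by simp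
      also have "real n powr (1 / 4) / (real n)\<^sup>2 = real n powr (- 7 / 4)"
      proof -
        have "real n powr (1 / 4) / (real n)\<^sup>2 = real n powr (1 / 4) / real n powr 2" using n by simp
        also have "\<dots> = real n powr (1 / 4 - 2)" by (rule powr_diff[symmetric])
        finally show ?thesis by simp
      qed
      also have "r\<^sup>2 * (G * K * (real n powr (- 7 / 4) / d n)) = r\<^sup>2 * a (i + N)" by (simp add: a_def n_def)
      finally show "emeasure linear_density (U (i + N + 2)) \<le> ennreal (r\<^sup>2 * a (i + N))"
        by (simp add: n_def ennreal_leI)
    qed auto
    also have "\<dots> = ennreal (\<Sum>i. r\<^sup>2 * a (i + N))"
      using a a0 by (intro suminf_ennreal2 summable_mult summable_ignore_initial_segment) auto
    also have "\<dots> \<le> ennreal (e * r\<^sup>2)"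
    proof (rule ennreal_leI)
      have "(\<Sum>i. r\<^sup>2 * a (i + N)) = r\<^sup>2 * (\<Sum>i. a (i + N))"
        using a by (intro suminf_mult summable_ignore_initial_segment)
      also have "\<dots> \<le> r\<^sup>2 * e" using N0[of N] by (intro mult_left_mono) (auto simp: N_def)
      finally show "(\<Sum>i. r\<^sup>2 * a (i + N)) \<le> e * r\<^sup>2" by (simp add: mult.commute)
    qed
    finally show ?case .
  qed
qed

text \<open>The interval [0, r] has measure r^2 / 2 under t dt, so an excluded set of measure e r^2
  / 4 changes the normalised integral by at most e / 2.\<close>

lemma good_set_density:
  assumes \<gamma>: "0 < \<gamma>" "\<And>n. 2 \<le> n \<Longrightarrow> 4 * \<gamma> / (real n)\<^sup>2 \<le> int_dist (critical_freq n (nu0 \<tau>))"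
    and summ: "summable (\<lambda>n. real (n + 2) powr (- 7 / 4) / int_dist (critical_freq (n + 2) (nu0 \<tau>)))"
  shows "((\<lambda>r. 2 / r\<^sup>2 * (LINT t:{0..r} \<inter> good_set \<gamma>|lebesgue. t)) \<longlongrightarrow> 1) (at_right 0)"
proof (rule tendstoI)
  fix e :: real assume e: "0 < e"
  have "\<forall>\<^sub>F r in at_right 0. emeasure linear_density ({0..r} - good_set \<gamma>) \<le> ennreal (e / 4 * r\<^sup>2)"
    using e by (intro emeasure_bad_set_small assms) auto
  moreover have "\<forall>\<^sub>F r in at_right 0. r \<in> {0<..<1::real}"
    by (rule eventually_at_right_real) simp
  ultimately show "\<forall>\<^sub>F r in at_right 0. dist (2 / r\<^sup>2 * (LINT t:{0..r} \<inter> good_set \<gamma>|lebesgue. t)) 1 < e"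
  proof eventually_elim
    case (elim r)
    let ?G = "{0..r} \<inter> good_set \<gamma>" and ?B = "{0..r} - good_set \<gamma>"
    have meas: "?G \<in> sets borel" "?B \<in> sets borel"
      using closed_good_set by (auto intro: borel_closed sets.Diff)
    have I: "(LINT t:?G|lebesgue. t) = measure linear_density ?G"
      using elim meas by (intro integral_linear_density[where b = r]) auto
    have total: "emeasure linear_density {0..r} = ennreal (r\<^sup>2 / 2)"
      using elim by (subst emeasure_linear_density_Icc) auto
    have fin: "emeasure linear_density A \<noteq> \<infinity>" if "A \<subseteq> {0..r}" for A
      using emeasure_mono[OF that, of linear_density] total by (auto simp: top_unique)
    have "measure linear_density {0..r} = measure linear_density ?G + measure linear_density ?B"
      using meas fin by (subst measure_Union[symmetric]) (auto intro!: arg_cong[where f = "measure linear_density"])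
    moreover have "measure linear_density {0..r} = r\<^sup>2 / 2" using total by (simp add: measure_def)
    moreover have "measure linear_density ?B \<le> e / 4 * r\<^sup>2"
      using elim(1) e unfolding measure_def by (intro enn2real_leI) auto
    moreover have "0 \<le> measure linear_density ?B" by simp
    ultimately have "\<bar>measure linear_density ?G - r\<^sup>2 / 2\<bar> \<le> e / 4 * r\<^sup>2" by linarith
    then have "2 / r\<^sup>2 * \<bar>measure linear_density ?G - r\<^sup>2 / 2\<bar> \<le> 2 / r\<^sup>2 * (e / 4 * r\<^sup>2)"
      by (intro mult_left_mono) auto
    also have "\<dots> = e / 2" using elim by simp
    finally have "\<bar>2 / r\<^sup>2 * (measure linear_density ?G - r\<^sup>2 / 2)\<bar> \<le> e / 2"
      by (simp only: abs_mult) simp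
    moreover have "2 / r\<^sup>2 * (measure linear_density ?G - r\<^sup>2 / 2) = 2 / r\<^sup>2 * measure linear_density ?G - 1"
      using elim by (simp add: field_simps)
    ultimately show ?case unfolding I dist_real_def using e by linarith
  qed
qed

end

section \<open>Lower bounds for the symbol\<close>

lemma critical_freq_1:
  assumes "0 < \<tau>"
  shows "critical_freq 1 (nu0 \<tau>) = 1"
proof -
  have "sqrt ((nu0 \<tau>)\<^sup>2 - 1) = \<tau>" using assms by (simp add: nu0_def)
  then show ?thesis using assms by (simp add: critical_freq_def zero_freq_def)
qed

text \<open>Takes the place of the Diophantine condition for |k1| = 1: there the unperturbed zero is
  |k2| = 1, a kernel frequency, and all other integers are at distance at least 1 from it.\<close>

lemma abs_snd_noncritical:
  assumes "k \<notin> kernel_freqs" "\<bar>fst k\<bar> = 1"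
  shows "1 \<le> \<bar>1 - \<bar>of_int (snd k) :: real\<bar>\<bar>"
proof -
  have "\<bar>snd k\<bar> \<noteq> 1" using assms by (cases k) (auto simp: kernel_freqs_def abs_if split: if_splits)
  then have "1 \<le> \<bar>1 - \<bar>snd k\<bar>\<bar>" by linarith
  then have "real_of_int 1 \<le> of_int \<bar>1 - \<bar>snd k\<bar>\<bar>" by (simp only: of_int_le_iff)
  then show ?thesis by simp
qed

lemma L_symbol_kernel_freqs:
  assumes "0 < \<tau>" "k \<in> kernel_freqs"
  shows "L_symbol (nu0 \<tau>) \<tau> k = 0"
  using assms by (auto simp: kernel_freqs_def L_symbol_def nu0_def)

text \<open>\<open>symbol_lower_bound\<close> with p = 1 + \<alpha>; halving p produces the loss (1
  + \<alpha>) / 2.\<close>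

lemma unperturbed_lower_bound:
  assumes \<tau>: "0 < \<tau>" and \<alpha>: "0 < \<alpha>" and dio: "diophantine \<alpha> (nu0 \<tau>)"
  obtains c where "0 < c"
    "\<And>k. k \<notin> kernel_freqs \<Longrightarrow> c * (1 + freq_norm k) powr (- ((1 + \<alpha>) / 2)) \<le> \<bar>L_symbol (nu0 \<tau>) \<tau> k - 0\<bar>"
proof -
  obtain c0 where c0: "0 < c0" "\<And>n. 2 \<le> n \<Longrightarrow> c0 * real n powr (- (1 + \<alpha>)) \<le> int_dist (critical_freq n (nu0 \<tau>))"
    using dio unfolding diophantine_def by blast
  \<comment> \<open>The minimum with 1 covers |k1| = 1, where the distance is at least 1.\<close>
  define \<gamma> where "\<gamma> = min c0 1"
  have \<gamma>: "0 < \<gamma>" using c0 by (simp add: \<gamma>_def)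
  define c where "c = symbol_const \<tau> (nu0 \<tau>) \<gamma> (1 + \<alpha>)"
  have c: "0 < c" unfolding c_def by (intro symbol_const_pos \<tau> \<gamma> nu0_gt_1)
  have zf: "zero_freq \<tau> (nu0 \<tau>) 0 n = critical_freq n (nu0 \<tau>)" for n
    using \<tau> by (simp add: critical_freq_def nu0_def)
  have "c * (1 + freq_norm k) powr (- ((1 + \<alpha>) / 2)) \<le> \<bar>L_symbol (nu0 \<tau>) \<tau> k - 0\<bar>"
    if k: "k \<notin> kernel_freqs" for k
    unfolding c_def
  proof (rule symbol_lower_bound[OF \<tau> nu0_gt_1[OF \<tau>]])
    show "k \<noteq> (0, 0)" using k by (auto simp: kernel_freqs_def)
    assume k1: "fst k \<noteq> 0"
    show "\<gamma> * \<bar>of_int (fst k)\<bar> powr (- (1 + \<alpha>)) \<le> \<bar>zero_freq \<tau> (nu0 \<tau>) 0 (nat \<bar>fst k\<bar>) - \<bar>of_int (snd k)\<bar>\<bar>"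
    proof (cases "\<bar>fst k\<bar> = 1")
      case True
      then have "\<bar>of_int (fst k) :: real\<bar> = 1" by (simp flip: of_int_abs)
      then show ?thesis
        unfolding zf using abs_snd_noncritical[OF k True] True critical_freq_1[OF \<tau>] by (simp add: \<gamma>_def)
    next
      case False
      define n where "n = nat \<bar>fst k\<bar>"
      have n: "2 \<le> n" "\<bar>of_int (fst k)\<bar> = real n" using False k1 by (auto simp: n_def)
      have "\<gamma> * real n powr (- (1 + \<alpha>)) \<le> c0 * real n powr (- (1 + \<alpha>))"
        by (intro mult_right_mono) (auto simp: \<gamma>_def)
      also have "\<dots> \<le> int_dist (critical_freq n (nu0 \<tau>))" by (rule c0(2)[OF n(1)])
      also have "\<dots> \<le> \<bar>critical_freq n (nu0 \<tau>) - of_int \<bar>snd k\<bar>\<bar>" by (rule int_dist_le)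
      finally show ?thesis unfolding zf n n_def[symmetric] by simp
    qed
  qed (use \<tau> \<alpha> \<gamma> in auto)
  with c show ?thesis by (rule that)
qed

text \<open>Outside the five known zeros the symbol has a positive lower bound.\<close>

lemma L_symbol_eq_0_iff:
  assumes "0 < \<tau>" "0 < \<alpha>" "diophantine \<alpha> (nu0 \<tau>)"
  shows "L_symbol (nu0 \<tau>) \<tau> k = 0 \<longleftrightarrow> k \<in> kernel_freqs"
proof
  assume 0: "L_symbol (nu0 \<tau>) \<tau> k = 0"
  show "k \<in> kernel_freqs"
  proof (rule ccontr)
    assume k: "k \<notin> kernel_freqs"
    obtain c where "0 < c" "c * (1 + freq_norm k) powr (- ((1 + \<alpha>) / 2)) \<le> \<bar>L_symbol (nu0 \<tau>) \<tau> k - 0\<bar>"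
      using unperturbed_lower_bound[OF assms] k by metis
    moreover have "0 < (1 + freq_norm k) powr (- ((1 + \<alpha>) / 2))" using freq_norm_nonneg[of k] by simp
    ultimately show False using 0 by (simp add: mult_le_0_iff)
  qed
qed (rule L_symbol_kernel_freqs[OF assms(1)])

definition nonresonant :: "real \<Rightarrow> real \<Rightarrow> real \<Rightarrow> (nat \<Rightarrow> real \<Rightarrow> real) \<Rightarrow> (nat \<Rightarrow> real \<Rightarrow> real) \<Rightarrow> real set \<Rightarrow> bool" where
  "nonresonant \<tau> c r0 nut kapt E \<longleftrightarrow> closed E \<and> E \<subseteq> {0..<r0} \<and>
     ((\<lambda>r. 2 / r\<^sup>2 * (LINT \<epsilon>:{0..r} \<inter> E|lebesgue. \<epsilon>)) \<longlongrightarrow> 1) (at_right 0) \<and>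
     (\<forall>\<epsilon>\<in>E. \<forall>j\<ge>1. \<forall>k. k \<notin> kernel_freqs \<longrightarrow> c * (1 + freq_norm k) powr (- 1)
       \<le> \<bar>L_symbol (nu_pert \<tau> nut j \<epsilon>) \<tau> k - kappa_pert kapt j \<epsilon>\<bar>)"

text \<open>The constant is built from \<tau> and the Diophantine constant before R and the
  perturbations are introduced; these influence only the set E. Taking p = 2 in
  \<open>symbol_lower_bound\<close> gives the loss of one derivative.\<close>

lemma perturbed_lower_bound:
  assumes \<tau>: "0 < \<tau>" and \<alpha>: "0 < \<alpha>" "\<alpha> \<le> 1" and dio: "diophantine \<alpha> (nu0 \<tau>)"
  obtains c where "0 < c" "\<And>R r0 nut kapt. \<lbrakk>0 < r0; perturbation_bounds R r0 nut kapt\<rbrakk> \<Longrightarrow>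
    \<exists>E. nonresonant \<tau> c r0 nut kapt E"
proof -
  obtain c0 where c0: "0 < c0" "\<And>n. 2 \<le> n \<Longrightarrow> c0 * real n powr (- (1 + \<alpha>)) \<le> int_dist (critical_freq n (nu0 \<tau>))"
    using dio unfolding diophantine_def by blast
  \<comment> \<open>The factor 1/4 makes 4 \<gamma> n^(-2) \<le> c0 n^(-1-\<alpha>), as \<alpha>
    \<le> 1; the entry 1/2 is for |k1| = 1.\<close>
  define \<gamma> where "\<gamma> = min (c0 / 4) (1 / 2)"
  have \<gamma>: "0 < \<gamma>" using c0 by (simp add: \<gamma>_def)
  have \<gamma>_le: "4 * \<gamma> / (real n)\<^sup>2 \<le> int_dist (critical_freq n (nu0 \<tau>))" if n: "2 \<le> n" for n
  proof -
    have "4 * \<gamma> / (real n)\<^sup>2 = 4 * \<gamma> * real n powr (- 2)"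
      using n by (simp add: powr_minus divide_inverse)
    also have "\<dots> \<le> c0 * real n powr (- (1 + \<alpha>))"
      using c0 \<alpha> n by (intro mult_mono powr_mono) (auto simp: \<gamma>_def)
    also note c0(2)[OF n]
    finally show ?thesis .
  qed
  have a: "1 < (1 + nu0 \<tau>) / 2" using nu0_gt_1[OF \<tau>] by simp
  define c where "c = symbol_const \<tau> ((1 + nu0 \<tau>) / 2) \<gamma> 2"
  have c: "0 < c" unfolding c_def by (rule symbol_const_pos[OF \<tau> a \<gamma>])
  have "\<exists>E. nonresonant \<tau> c r0 nut kapt E"
    if r0: "0 < r0" and pert: "perturbation_bounds R r0 nut kapt" for R r0 nut kapt
  proof -
    interpret perturbed_parameters \<tau> R r0 nut kapt
      using \<tau> r0 pert by unfold_locales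
    have "good_set \<gamma> \<subseteq> {0..<r0}" using range_bound r0 by (auto simp: good_set_def)
    moreover have "((\<lambda>r. 2 / r\<^sup>2 * (LINT \<epsilon>:{0..r} \<inter> good_set \<gamma>|lebesgue. \<epsilon>)) \<longlongrightarrow> 1) (at_right 0)"
      using dio unfolding diophantine_def by (intro good_set_density \<gamma> \<gamma>_le) auto
    moreover have "c * (1 + freq_norm k) powr (- 1) \<le> \<bar>L_symbol (nu_pert \<tau> nut j \<epsilon>) \<tau> k - kappa_pert kapt j \<epsilon>\<bar>"
      if E: "\<epsilon> \<in> good_set \<gamma>" and j: "1 \<le> j" and k: "k \<notin> kernel_freqs" for \<epsilon> j k
    proof -
      have \<epsilon>: "\<epsilon> \<in> {0..range_bound}" using E by (simp add: good_set_def)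
      then have e: "0 \<le> \<epsilon>" "\<epsilon> \<le> 1" "\<epsilon> \<in> {0..r0}" using range_bound r0 by auto
      have e2: "\<epsilon>\<^sup>2 \<le> range_bound"
        using \<epsilon> range_bound mult_mono[of \<epsilon> range_bound \<epsilon> 1] by (simp add: power2_eq_square)
      let ?n = "nat \<bar>fst k\<bar>"
      have "c * (1 + freq_norm k) powr (- (2 / 2)) \<le> \<bar>L_symbol (nu_pert \<tau> nut j \<epsilon>) \<tau> k - kappa_pert kapt j \<epsilon>\<bar>"
        unfolding c_def
      proof (rule symbol_lower_bound[OF \<tau> a])
        show "k \<noteq> (0, 0)" using k by (auto simp: kernel_freqs_def)
        have "\<bar>kappa_pert kapt j \<epsilon>\<bar> \<le> range_bound * (R + 1)"
          unfolding kappa_pert_def abs_mult using e2 pert_bounds(2)[OF j e(3)] range_bound by (intro mult_mono) auto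
        then show "\<bar>kappa_pert kapt j \<epsilon>\<bar> \<le> \<tau> / 2" using range_bound by linarith
        assume k1: "fst k \<noteq> 0"
        then have n1: "1 \<le> ?n" by auto
        have n_sq: "(of_int (fst k))\<^sup>2 = (real ?n)\<^sup>2" by simp
        show "(1 + nu0 \<tau>) / 2 * (of_int (fst k))\<^sup>2 \<le> nu_pert \<tau> nut j \<epsilon> * (of_int (fst k))\<^sup>2 + kappa_pert kapt j \<epsilon>"
          using amplitude_ge[OF j \<epsilon> n1] unfolding n_sq amplitude_def ellipticity_def .
        have fr: "zero_freq \<tau> (nu_pert \<tau> nut j \<epsilon>) (kappa_pert kapt j \<epsilon>) ?n = freq ?n j \<epsilon>"
          by (simp add: freq_def)
        show "\<gamma> * \<bar>of_int (fst k)\<bar> powr (- 2) \<le>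
            \<bar>zero_freq \<tau> (nu_pert \<tau> nut j \<epsilon>) (kappa_pert kapt j \<epsilon>) ?n - \<bar>of_int (snd k)\<bar>\<bar>"
        proof (cases "\<bar>fst k\<bar> = 1")
          case True
          then have "\<bar>of_int (fst k) :: real\<bar> = 1" by (simp flip: of_int_abs)
          \<comment> \<open>The zero for n = 1 moves by at most 1/2 from 1, so every |k2| other than
            1 keeps a distance of at least 1/2.\<close>
          moreover have "\<bar>freq 1 j \<epsilon> - 1\<bar> \<le> 1 / 2"
          proof -
            have "\<bar>freq 1 j \<epsilon> - 1\<bar> \<le> slope * drift / \<tau> * \<epsilon>\<^sup>2"
              using freq_close[OF j \<epsilon>, of 1] critical_freq_1[OF \<tau>] by simp
            also have "\<dots> \<le> slope * drift / \<tau> * range_bound"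
              using e2 slope drift \<tau> by (intro mult_left_mono) auto
            also have "\<dots> = slope * (range_bound * drift) / \<tau>" by simp
            also have "\<dots> \<le> 1 / 2" using range_bound(7) \<tau> by (simp add: divide_le_eq)
            finally show ?thesis .
          qed
          moreover have "\<gamma> \<le> 1 / 2" by (simp add: \<gamma>_def)
          moreover have "?n = 1" using True by simp
          moreover have "\<bar>1 - m\<bar> \<le> \<bar>freq 1 j \<epsilon> - 1\<bar> + \<bar>freq 1 j \<epsilon> - m\<bar>" for m by linarith
          note this[of "\<bar>of_int (snd k)\<bar>"]
          ultimately show ?thesis
            unfolding fr using abs_snd_noncritical[OF k True] by simp
        next
          case False
          then have n: "2 \<le> ?n" "\<bar>of_int (fst k)\<bar> = real ?n" using k1 by auto
          have "\<gamma> / (real ?n)\<^sup>2 \<le> \<bar>freq ?n j \<epsilon> - of_int \<bar>snd k\<bar>\<bar>"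
            using E j n(1) unfolding good_set_def by blast
          moreover have "real ?n powr (- 2) = 1 / (real ?n)\<^sup>2"
            using n(1) by (simp add: powr_minus divide_inverse)
          ultimately show ?thesis unfolding fr n(2) by simp
        qed
      qed (use \<gamma> in auto)
      then show ?thesis by simp
    qed
    ultimately show ?thesis
      unfolding nonresonant_def
      by (intro exI[of _ "good_set \<gamma>"] conjI closed_good_set ballI allI impI) simp_all
  qed
  with c show ?thesis by (rule that)
qed

text \<open>One Diophantine set serves both parts: it yields the lower bounds for the unperturbed
  and the perturbed symbol, and \<open>resolvent_bound\<close> turns each of them into an operator
  bound with constant 1 / c.\<close>

theorem theorem4p2:
  fixes \<alpha> :: real
  assumes "0 < \<alpha>" and "\<alpha> \<le> 1"
  shows "\<exists>\<N>::real set. \<N> \<subseteq> {1<..} \<and> {1<..} - \<N> \<in> null_sets lebesgue \<and>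
    (\<forall>\<tau>>0. nu0 \<tau> \<in> \<N> \<longrightarrow>
      (\<exists>v\<in>ker_L0 \<tau>. \<forall>a. v \<noteq> distr_of (\<lambda>Y. a)) \<and>
      ker_L0 \<tau> = distr_span {distr_of (\<lambda>Y. 1),
        distr_of (torus_char (1, 1)), distr_of (torus_char (- 1, - 1)),
        distr_of (torus_char (- 1, 1)), distr_of (torus_char (1, - 1))} \<and>
      (\<exists>c>0. \<forall>s::real. \<forall>u \<in> torus_orth (ker_L0 \<tau>) \<inter> sobolev s.
        \<exists>w. resolvent_graph (nu0 \<tau>) \<tau> 0 u w \<and> w \<in> sobolev (s - (1 + \<alpha>) / 2) \<and>
          sobolev_norm (s - (1 + \<alpha>) / 2) w \<le> c * sobolev_norm s u)) \<and>
    (\<alpha> < 1 / 78 \<longrightarrow>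
      (\<forall>\<tau>>0. nu0 \<tau> \<in> \<N> \<longrightarrow>
        (\<forall>R::real. \<exists>c>0. \<forall>r0>0. \<forall>nut kapt. perturbation_bounds R r0 nut kapt \<longrightarrow>
          (\<exists>E::real set. E \<in> sets lebesgue \<and> E \<subseteq> {0..<r0} \<and>
            ((\<lambda>r. 2 / r\<^sup>2 * (LINT \<epsilon>:{0..r} \<inter> E|lebesgue. \<epsilon>)) \<longlongrightarrow> 1) (at_right 0) \<and>
            (\<forall>\<epsilon>\<in>E. \<forall>j\<ge>1. \<forall>s::real. 1 \<le> s \<longrightarrow>
              (\<forall>u \<in> torus_orth (ker_L0 \<tau>) \<inter> sobolev s.
                \<exists>w. resolvent_graph (nu_pert \<tau> nut j \<epsilon>) \<tau> (kappa_pert kapt j \<epsilon>) u w \<and>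
                  w \<in> sobolev (s - 1) \<and>
                  sobolev_norm (s - 1) w \<le> c * sobolev_norm s u))))))"
proof (intro exI[of _ "{\<nu>. 1 < \<nu> \<and> diophantine \<alpha> \<nu>}"] conjI allI impI, goal_cases)
  case 1
  then show ?case by auto
next
  case 2
  have "AE \<nu> in lebesgue. \<not> (1 < \<nu> \<and> \<not> diophantine \<alpha> \<nu>)"
    using AE_completion[OF AE_diophantine[OF assms]] by eventually_elim blast
  then obtain Z where Z: "\<And>\<nu>. \<nu> \<in> space lebesgue - Z \<Longrightarrow> \<not> (1 < \<nu> \<and> \<not> diophantine \<alpha> \<nu>)"
    "Z \<in> null_sets lebesgue"
    by (rule AE_E3) blast
  \<comment> \<open>Measurability of the exceptional set comes from completeness of Lebesgue
    measure, as a subset of a null set.\<close>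
  have "{1<..} - {\<nu>. 1 < \<nu> \<and> diophantine \<alpha> \<nu>} \<subseteq> Z" using Z(1) by auto
  then show ?case by (rule null_sets_completion_subset[OF _ Z(2)])
next
  case (3 \<tau>)
  then show ?case
    using assms(1) by (intro nonconstant_in_ker_L0 L_symbol_eq_0_iff[where \<alpha> = \<alpha>]) auto
next
  case (4 \<tau>)
  then have "ker_L0 \<tau> = distr_span ((\<lambda>k. distr_of (torus_char k)) ` kernel_freqs)"
    using assms(1) by (intro ker_L0_eq_span L_symbol_eq_0_iff[where \<alpha> = \<alpha>]) auto
  moreover have "torus_char (0, 0) = (\<lambda>Y. 1)" by auto
  ultimately show ?case by (simp add: kernel_freqs_def)
next
  case (5 \<tau>)
  then have \<tau>: "0 < \<tau>" and dio: "diophantine \<alpha> (nu0 \<tau>)" by auto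
  obtain c where c: "0 < c" "\<And>k. k \<notin> kernel_freqs \<Longrightarrow>
      c * (1 + freq_norm k) powr (- ((1 + \<alpha>) / 2)) \<le> \<bar>L_symbol (nu0 \<tau>) \<tau> k - 0\<bar>"
    using unperturbed_lower_bound[OF \<tau> assms(1) dio] by blast
  show ?case
    using resolvent_bound[OF L_symbol_eq_0_iff[OF \<tau> assms(1) dio] c(1) _ c(2)] assms c(1)
    by (intro exI[of _ "1 / c"]) simp
next
  case (6 \<tau> R)
  then have \<tau>: "0 < \<tau>" and dio: "diophantine \<alpha> (nu0 \<tau>)" by auto
  obtain c where c: "0 < c" "\<And>R r0 nut kapt. \<lbrakk>0 < r0; perturbation_bounds R r0 nut kapt\<rbrakk> \<Longrightarrow>
      \<exists>E. nonresonant \<tau> c r0 nut kapt E"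
    using perturbed_lower_bound[OF \<tau> assms dio] by blast
  show ?case
  proof (intro exI[of _ "1 / c"] conjI allI impI, goal_cases)
    case (2 r0 nut kapt)
    then obtain E where "nonresonant \<tau> c r0 nut kapt E" using c(2) by blast
    then have E: "closed E" "E \<subseteq> {0..<r0}"
      "((\<lambda>r. 2 / r\<^sup>2 * (LINT \<epsilon>:{0..r} \<inter> E|lebesgue. \<epsilon>)) \<longlongrightarrow> 1) (at_right 0)"
      "\<And>\<epsilon> j k. \<lbrakk>\<epsilon> \<in> E; 1 \<le> j; k \<notin> kernel_freqs\<rbrakk> \<Longrightarrow> c * (1 + freq_norm k) powr (- 1)
        \<le> \<bar>L_symbol (nu_pert \<tau> nut j \<epsilon>) \<tau> k - kappa_pert kapt j \<epsilon>\<bar>"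
      unfolding nonresonant_def by blast+
    \<comment> \<open>Closedness is carried along in \<open>nonresonant\<close> to provide this
      measurability.\<close>
    have "E \<in> sets lebesgue" using E(1) by (simp add: borel_closed)
    then show ?case
      using E(2,3) resolvent_bound[OF L_symbol_eq_0_iff[OF \<tau> assms(1) dio] c(1) _ E(4)]
      by (intro exI[of _ E]) auto
  qed (use c(1) in simp)
qed

end
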